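(* Let $(M,\omega_0)$, $\chi$, $\Gamma$, $f$, $F$ be as in the context with the Standing Assumption in force. Let $G\in C(M\times\mathbb{R})$ satisfy $G(x,u_1)<G(x,u_2)$ for every $x\in M$ and all $u_1<u_2$. Then there exists at most one viscosity solution $\varphi\in C(M)$ of $$F(\chi+dd^c\varphi)=e^{G(x,\varphi)},\qquad\lambda[\chi+dd^c\varphi]\in\Gamma.$$
   Context: $(M,\omega_0)$ is a compact complex manifold without boundary of complex dimension $n$ with a Hermitian metric $\omega_0=\sqrt{-1}g_{i\bar j}dz_i\wedge d\bar z_j$; $d^c=\frac{\sqrt{-1}}{2}(\bar\partial-\partial)$, $dd^c=\sqrt{-1}\partial\bar\partial$. $\chi$ is a smooth real $(1,1)$-form. For a real $(1,1)$-form $\eta$, $\lambda[\eta]$ is the unordered $n$-tuple of eigenvalues of $g^{i\bar k}\eta_{j\bar k}$. $\Gamma\subset\mathbb{R}^n$ is a closed convex permutation-symmetric cone containing $\Gamma_n=\{\lambda_i>0\ \forall i\}$, contained in $\{\sum\lambda_i\ge0\}$ with $\mathrm{Int}\,\Gamma\subset\{\sum\lambda_i>0\}$; $f$ is smooth symmetric on $\Gamma$, $F(\eta)=f(\lambda[\eta])$. Standing Assumption: (i) $\partial f/\partial\lambda_i>0$, $f$ concave, $f>0$ in $\mathrm{Int}\,\Gamma$, $f=0$ on $\partial\Gamma$; (ii) $\lambda[\chi](x)\in\mathrm{Int}\,\Gamma$ for all $x$; (iii) $f$ is positively homogeneous of degree 1 and $f(\lambda)\ge c_0(\prod\lambda_i)^{1/n}$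 on $\Gamma_n$ for some $c_0>0$. Viscosity notions: a $C^2$ function $P$ near $x_0$ touches $u$ from above (below) at $x_0$ if $P(x_0)=u(x_0)$ and $P\ge u$ ($P\le u$) near $x_0$. An u.s.c. $u$ is a viscosity subsolution of $F(\chi+dd^cu)=H(x,u)$, $\lambda\in\Gamma$, if for each $x_0$ and each $C^2$ $P$ touching from above at $x_0$: $\lambda[\chi+dd^cP](x_0)\in\Gamma$ and $F(\chi+dd^cP)(x_0)\ge H(x_0,P(x_0))$. A l.s.c. $u$ is a viscosity supersolution if for each $x_0$ and each $C^2$ $P$ touching from below at $x_0$: either $\lambda[\chi+dd^cP](x_0)\notin\Gamma$, or it lies in $\Gamma$ and $F(\chi+dd^cP)(x_0)\le H(x_0,P(x_0))$. A viscosity solution is a continuous function which is both. *)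

theory Defs
  imports "HOL-Analysis.Analysis"
begin

fun dd :: "('a::real_normed_vector \<Rightarrow> real) \<Rightarrow> 'a list \<Rightarrow> 'a \<Rightarrow> real" where
  "dd h [] = h"
| "dd h (v # vs) = (\<lambda>z. deriv (\<lambda>t. dd h vs (z + t *\<^sub>R v)) 0)"

text \<open>C^k on an open set: all iterated directional derivatives of order \<le> k exist
  and are continuous (equivalent to the usual C^k notion on open subsets of R^N).\<close>
definition Ck_on :: "nat \<Rightarrow> 'a::real_normed_vector set \<Rightarrow> ('a \<Rightarrow> real) \<Rightarrow> bool" where
  "Ck_on k S h \<longleftrightarrow> open S \<and>
     (\<forall>vs. length vs \<le> k \<longrightarrow> continuous_on S (dd h vs)) \<and>
     (\<forall>vs v z. length vs < k \<longrightarrow> z \<in> S \<longrightarrow> (\<lambda>t. dd h vs (z + t *\<^sub>R v)) differentiable (at 0))"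

definition smooth_on :: "'a::real_normed_vector set \<Rightarrow> ('a \<Rightarrow> real) \<Rightarrow> bool" where
  "smooth_on S h \<longleftrightarrow> (\<forall>k. Ck_on k S h)"

definition csmooth_on :: "'a::real_normed_vector set \<Rightarrow> ('a \<Rightarrow> complex) \<Rightarrow> bool" where
  "csmooth_on S h \<longleftrightarrow> smooth_on S (\<lambda>z. Re (h z)) \<and> smooth_on S (\<lambda>z. Im (h z))"

definition holo_on :: "(complex^'n) set \<Rightarrow> (complex^'n \<Rightarrow> complex^'n) \<Rightarrow> bool" where
  "holo_on S h \<longleftrightarrow> (\<forall>z\<in>S. \<exists>L. (h has_derivative L) (at z) \<and> (\<forall>v. L (\<i> *s v) = \<i> *s L v))"

type_synonym ('m, 'n) chart = "'m set \<times> ('m \<Rightarrow> complex^'n)"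

definition complex_atlas :: "('m::topological_space, 'n::finite) chart set \<Rightarrow> bool" where
  "complex_atlas A \<longleftrightarrow>
     (\<forall>(U,\<phi>)\<in>A. open U \<and> open (\<phi> ` U) \<and> homeomorphism U (\<phi> ` U) \<phi> (inv_into U \<phi>)) \<and>
     (\<Union>(fst ` A) = UNIV) \<and>
     (\<forall>(U,\<phi>)\<in>A. \<forall>(V,\<psi>)\<in>A. holo_on (\<phi> ` (U \<inter> V)) (\<psi> \<circ> inv_into U \<phi>))"

definition loc :: "('m, 'n) chart \<Rightarrow> ('m \<Rightarrow> 'a) \<Rightarrow> complex^'n \<Rightarrow> 'a" where
  "loc c u = u \<circ> inv_into (fst c) (snd c)"

definition cjac :: "(complex^'n \<Rightarrow> complex^'n) \<Rightarrow> complex^'n \<Rightarrow> complex^'n^'n" where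
  "cjac h z = (\<chi> a j. frechet_derivative h (at z) (axis j 1) $ a)"

definition cnj_mat :: "complex^'n^'m \<Rightarrow> complex^'n^'m" where
  "cnj_mat B = (\<chi> a b. cnj (B $ a $ b))"

text \<open>A real (1,1)-form sqrt(-1) eta_{j kbar} dz_j /\ dzbar_k, given by its coefficient matrices
  eta c x (entry j k = eta_{j kbar}) in every chart c, Hermitian (= realness), smooth, and
  transforming as a (1,1)-form under change of charts.\<close>
definition real_11_form ::
  "('m::topological_space, 'n::finite) chart set \<Rightarrow> (('m,'n) chart \<Rightarrow> 'm \<Rightarrow> complex^'n^'n) \<Rightarrow> bool" where
  "real_11_form A \<eta> \<longleftrightarrow>
     (\<forall>c\<in>A. \<forall>x\<in>fst c. \<forall>j k. \<eta> c x $ k $ j = cnj (\<eta> c x $ j $ k)) \<and>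
     (\<forall>c\<in>A. \<forall>j k. csmooth_on (snd c ` fst c) (loc c (\<lambda>x. \<eta> c x $ j $ k))) \<and>
     (\<forall>(U,\<phi>)\<in>A. \<forall>(V,\<psi>)\<in>A. \<forall>x\<in>U \<inter> V.
        \<eta> (U,\<phi>) x = transpose (cjac (\<psi> \<circ> inv_into U \<phi>) (\<phi> x)) ** \<eta> (V,\<psi>) x
                       ** cnj_mat (cjac (\<psi> \<circ> inv_into U \<phi>) (\<phi> x)))"

definition hermitian_metric ::
  "('m::topological_space, 'n::finite) chart set \<Rightarrow> (('m,'n) chart \<Rightarrow> 'm \<Rightarrow> complex^'n^'n) \<Rightarrow> bool" where
  "hermitian_metric A g \<longleftrightarrow> real_11_form A g \<and>
     (\<forall>c\<in>A. \<forall>x\<in>fst c. \<forall>v::complex^'n. v \<noteq> 0 \<longrightarrow>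
        Re (\<Sum>j\<in>UNIV. \<Sum>k\<in>UNIV. g c x $ j $ k * v $ j * cnj (v $ k)) > 0)"

text \<open>The endomorphism with entries A^i_j = g^{i kbar} eta_{j kbar}, where g^{i kbar} g_{j kbar} = delta^i_j.\<close>
definition endo :: "complex^'n^'n \<Rightarrow> complex^'n^'n \<Rightarrow> complex^'n^'n" where
  "endo g \<eta> = matrix_inv (transpose g) ** transpose \<eta>"

definition eig_tuple :: "complex^'n^'n \<Rightarrow> complex^'n^'n \<Rightarrow> real^'n \<Rightarrow> bool" where
  "eig_tuple g \<eta> lam \<longleftrightarrow>
     (\<forall>t::complex. det (mat t - endo g \<eta>) = (\<Prod>i\<in>UNIV. t - complex_of_real (lam $ i)))"

text \<open>Coefficient d_j dbar_k h of sqrt(-1) d dbar h for a real C^2 function h on C^n,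
  with z_j = x_j + i y_j, d_j = (d_{x_j} - i d_{y_j})/2, dbar_k = (d_{x_k} + i d_{y_k})/2.\<close>
definition cHess :: "(complex^'n \<Rightarrow> real) \<Rightarrow> complex^'n \<Rightarrow> complex^'n^'n" where
  "cHess h z = (\<chi> j k.
      (complex_of_real (dd h [axis j 1, axis k 1] z + dd h [axis j \<i>, axis k \<i>] z)
       + \<i> * complex_of_real (dd h [axis j 1, axis k \<i>] z - dd h [axis j \<i>, axis k 1] z)) / 4)"

definition ddc_add :: "(('m,'n::finite) chart \<Rightarrow> 'm \<Rightarrow> complex^'n^'n) \<Rightarrow> ('m \<Rightarrow> real) \<Rightarrow> ('m,'n) chart \<Rightarrow> 'm \<Rightarrow> complex^'n^'n" where
  "ddc_add \<chi>' P c x = \<chi>' c x + cHess (loc c P) (snd c x)"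

definition C2_near :: "('m::topological_space, 'n::finite) chart set \<Rightarrow> ('m \<Rightarrow> real) \<Rightarrow> 'm \<Rightarrow> bool" where
  "C2_near A P x0 \<longleftrightarrow> (\<exists>N. open N \<and> x0 \<in> N \<and>
     (\<forall>c\<in>A. Ck_on 2 (snd c ` (fst c \<inter> N)) (loc c P)))"

definition touches_above :: "('m::topological_space \<Rightarrow> real) \<Rightarrow> ('m \<Rightarrow> real) \<Rightarrow> 'm \<Rightarrow> bool" where
  "touches_above P u x0 \<longleftrightarrow> P x0 = u x0 \<and> (\<forall>\<^sub>F x in nhds x0. u x \<le> P x)"

definition touches_below :: "('m::topological_space \<Rightarrow> real) \<Rightarrow> ('m \<Rightarrow> real) \<Rightarrow> 'm \<Rightarrow> bool" where
  "touches_below P u x0 \<longleftrightarrow> P x0 = u x0 \<and> (\<forall>\<^sub>F x in nhds x0. P x \<le> u x)"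

definition usc :: "('m::topological_space \<Rightarrow> real) \<Rightarrow> bool" where
  "usc u \<longleftrightarrow> (\<forall>x e. e > 0 \<longrightarrow> (\<forall>\<^sub>F y in nhds x. u y < u x + e))"

definition lsc :: "('m::topological_space \<Rightarrow> real) \<Rightarrow> bool" where
  "lsc u \<longleftrightarrow> (\<forall>x e. e > 0 \<longrightarrow> (\<forall>\<^sub>F y in nhds x. u x - e < u y))"

text \<open>Viscosity subsolution of F(chi + dd^c u) = H(x,u), lambda in Gamma, where F(eta) = f(lambda[eta]).
  lambda[.] at x0 is computed in any chart around x0 (it is chart independent up to ordering,
  and Gamma, f are permutation symmetric).\<close>
definition visc_sub where
  "visc_sub A g \<chi>' \<Gamma> f H u \<longleftrightarrow> usc u \<and>
     (\<forall>x0 P. C2_near A P x0 \<longrightarrow> touches_above P u x0 \<longrightarrow>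
        (\<forall>c\<in>A. x0 \<in> fst c \<longrightarrow> (\<forall>lam. eig_tuple (g c x0) (ddc_add \<chi>' P c x0) lam \<longrightarrow>
            lam \<in> \<Gamma> \<and> f lam \<ge> H x0 (P x0))))"

definition visc_super where
  "visc_super A g \<chi>' \<Gamma> f H u \<longleftrightarrow> lsc u \<and>
     (\<forall>x0 P. C2_near A P x0 \<longrightarrow> touches_below P u x0 \<longrightarrow>
        (\<forall>c\<in>A. x0 \<in> fst c \<longrightarrow> (\<forall>lam. eig_tuple (g c x0) (ddc_add \<chi>' P c x0) lam \<longrightarrow>
            lam \<notin> \<Gamma> \<or> f lam \<le> H x0 (P x0))))"

definition visc_sol where
  "visc_sol A g \<chi>' \<Gamma> f H u \<longleftrightarrow> continuous_on UNIV u \<and>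
     visc_sub A g \<chi>' \<Gamma> f H u \<and> visc_super A g \<chi>' \<Gamma> f H u"

definition perm_vec :: "('n \<Rightarrow> 'n) \<Rightarrow> real^'n \<Rightarrow> real^'n" where
  "perm_vec \<sigma> lam = (\<chi> i. lam $ \<sigma> i)"

definition admissible_cone :: "(real^'n::finite) set \<Rightarrow> bool" where
  "admissible_cone \<Gamma> \<longleftrightarrow> closed \<Gamma> \<and> convex \<Gamma> \<and> cone \<Gamma> \<and>
     (\<forall>\<sigma> lam. \<sigma> permutes UNIV \<longrightarrow> lam \<in> \<Gamma> \<longrightarrow> perm_vec \<sigma> lam \<in> \<Gamma>) \<and>
     {lam. \<forall>i. lam $ i > 0} \<subseteq> \<Gamma> \<and>
     \<Gamma> \<subseteq> {lam. (\<Sum>i\<in>UNIV. lam $ i) \<ge> 0} \<and>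
     interior \<Gamma> \<subseteq> {lam. (\<Sum>i\<in>UNIV. lam $ i) > 0}"

definition standing_f :: "(real^'n::finite) set \<Rightarrow> (real^'n \<Rightarrow> real) \<Rightarrow> bool" where
  "standing_f \<Gamma> f \<longleftrightarrow>
     smooth_on (interior \<Gamma>) f \<and> continuous_on \<Gamma> f \<and>
     (\<forall>\<sigma> lam. \<sigma> permutes UNIV \<longrightarrow> lam \<in> \<Gamma> \<longrightarrow> f (perm_vec \<sigma> lam) = f lam) \<and>
     (\<forall>lam\<in>interior \<Gamma>. \<forall>i. dd f [axis i 1] lam > 0) \<and>
     concave_on \<Gamma> f \<and>
     (\<forall>lam\<in>interior \<Gamma>. f lam > 0) \<and>
     (\<forall>lam\<in>frontier \<Gamma>. f lam = 0) \<and>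
     (\<forall>t lam. t > 0 \<longrightarrow> lam \<in> \<Gamma> \<longrightarrow> f (t *\<^sub>R lam) = t * f lam) \<and>
     (\<exists>c0>0. \<forall>lam. (\<forall>i. lam $ i > 0) \<longrightarrow>
        f lam \<ge> c0 * (\<Prod>i\<in>UNIV. lam $ i) powr (1 / real CARD('n)))"

end

theory Submission imports Defs "HOL-Library.Function_Algebras" "HOL-Complex_Analysis.Cauchy_Integral_Formula" begin

text \<open>The uniqueness follows from a comparison principle. Suppose that \<open>\<phi>1 > \<phi>2\<close> somewhere. Strict monotonicity of \<open>G\<close>
  and compactness give a small \<open>t > 0\<close> such that, at a maximum point of \<open>(1 - t) * \<phi>1 - \<phi>2\<close>, the right-hand side of the
  equation for \<open>\<phi>1\<close>, multiplied by \<open>1 - t\<close>, still strictly exceeds that for \<open>\<phi>2\<close>. Since \<open>F\<close> is concave and homogeneous,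
  replacing \<open>\<phi>1\<close> by \<open>(1 - t) * \<phi>1\<close> leaves \<open>t * \<chi>\<close> as a slack in the interior of \<open>\<Gamma>\<close>, which absorbs every error made below.

  In a chart around the maximum point the variables are doubled and the subsolution is replaced by its sup-convolution and
  then mollified. By Schur--Horn, the eigenvalue conditions become conditions on the diagonals with respect to the unitary frames
  of the metric. Once the coefficients are frozen, they are linear inequalities with constant coefficients, because
  the superlevel sets of \<open>f\<close> are convex. Such an inequality passes from a viscosity subsolution to its
  mollification, since it can be tested by comparison with the polynomial solutions of the Dirichlet problem on balls. The
  mollified subsolution has a second-order Taylor expansion everywhere, so it yields a quadratic test function for the
  supersolution at the doubled maximum; neither Alexandrov's theorem nor Jensen's lemma is needed.\<close>

section \<open>Second-order Taylor expansions and a maximum principle\<close>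

text \<open>The metric varies, so the subsolution, tested at x, and the supersolution, tested at y,
  see different unitary frames. A frame at y is carried to one at x by a single complex linear map M
  with M - 1 = O(|x - y|), and the supersolution is tested along displacements (kM, k) of the
  doubled variables. The penalty a|x - y|^2 then enters only through a|e - e'|^2 = O(a|x - y|^2),
  which is small, and complex linearity keeps Levi forms intact. Freezing the frames before
  mollifying meets a second difficulty: a Hessian touching the sup-convolution from above is bounded
  below by -4a, but has no bound above. The error is therefore charged to \<delta> times the
  shifted, nonnegative Levi form and \<delta> times its trace; only at the doubled maximum, where
  the Hessian is also at most a multiple of a, does this charge become small. This dictates the
  order of choices: a, then \<delta> of size 1/a, then the radius of the sup-convolution, then that
  of the mollification.\<close>

definition taylor2 :: "('a::euclidean_space \<Rightarrow> real) \<Rightarrow> 'a \<Rightarrow> ('a \<Rightarrow> real) \<Rightarrow> ('a \<Rightarrow> 'a \<Rightarrow> real) \<Rightarrow> bool" where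
  "taylor2 f z l B \<longleftrightarrow> linear l \<and> bilinear B \<and>
     (\<forall>e>0. \<exists>d>0. \<forall>h. norm h < d \<longrightarrow> \<bar>f (z + h) - f z - l h - B h h / 2\<bar> \<le> e * norm h ^ 2)"

lemma bilinear_scale_combine:
  assumes "bilinear B" "bilinear C"
  shows "bilinear (\<lambda>u v. a * B u v + c * C u v :: real)"
  using assms unfolding bilinear_def linear_iff by (auto simp: algebra_simps)

lemma linear_scale_combine:
  assumes "linear l" "linear m"
  shows "linear (\<lambda>v. a * l v + c * m v :: real)"
  using assms unfolding linear_iff by (auto simp: algebra_simps)

lemma bilinear_inner: "bilinear ((\<bullet>) :: 'a::real_inner \<Rightarrow> 'a \<Rightarrow> real)"
  unfolding bilinear_def linear_iff by (auto simp: inner_simps)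

lemma bilinear_scaleR_both:
  fixes B :: "'a::real_vector \<Rightarrow> 'a \<Rightarrow> real"
  assumes "bilinear B" shows "B (s *\<^sub>R u) (t *\<^sub>R v) = s * t * B u v"
  using bilinear_lmul[OF assms, of s u "t *\<^sub>R v"] bilinear_rmul[OF assms, of u t v] by simp

lemma bilinear_bound:
  fixes B :: "'a::euclidean_space \<Rightarrow> 'a \<Rightarrow> real"
  assumes "bilinear B"
  obtains K where "K > 0" "\<And>u v. \<bar>B u v\<bar> \<le> K * norm u * norm v"
  using bilinear_bounded_pos[OF assms] by auto

lemma taylor2_combine:
  assumes f: "taylor2 f z l B" and g: "taylor2 g z m C"
  shows "taylor2 (\<lambda>x. a * f x + c * g x) z (\<lambda>v. a * l v + c * m v) (\<lambda>u v. a * B u v + c * C u v)"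
  unfolding taylor2_def
proof (intro conjI allI impI)
  fix e :: real assume e: "e > 0"
  define s where "s = \<bar>a\<bar> + \<bar>c\<bar> + 1"
  have s: "s > 0" by (simp add: s_def)
  obtain d1 where d1: "d1 > 0" "\<And>h. norm h < d1 \<Longrightarrow> \<bar>f (z + h) - f z - l h - B h h / 2\<bar> \<le> e / s * norm h ^ 2"
    using f e s unfolding taylor2_def by (metis divide_pos_pos)
  obtain d2 where d2: "d2 > 0" "\<And>h. norm h < d2 \<Longrightarrow> \<bar>g (z + h) - g z - m h - C h h / 2\<bar> \<le> e / s * norm h ^ 2"
    using g e s unfolding taylor2_def by (metis divide_pos_pos)
  show "\<exists>d>0. \<forall>h. norm h < d \<longrightarrow> \<bar>a * f (z + h) + c * g (z + h) - (a * f z + c * g z)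
      - (a * l h + c * m h) - (a * B h h + c * C h h) / 2\<bar> \<le> e * norm h ^ 2"
  proof (intro exI conjI allI impI)
    show "min d1 d2 > 0" using d1 d2 by simp
    fix h :: 'a assume h: "norm h < min d1 d2"
    let ?F = "f (z + h) - f z - l h - B h h / 2" and ?G = "g (z + h) - g z - m h - C h h / 2"
    have "\<bar>a * ?F + c * ?G\<bar> \<le> \<bar>a\<bar> * \<bar>?F\<bar> + \<bar>c\<bar> * \<bar>?G\<bar>"
      by (metis abs_mult abs_triangle_ineq)
    also have "\<dots> \<le> \<bar>a\<bar> * (e / s * norm h ^ 2) + \<bar>c\<bar> * (e / s * norm h ^ 2)"
      using d1(2)[of h] d2(2)[of h] h by (intro add_mono mult_left_mono) auto
    also have "\<dots> = (\<bar>a\<bar> + \<bar>c\<bar>) / s * (e * norm h ^ 2)" using s by (simp add: field_simps)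
    also have "\<dots> \<le> 1 * (e * norm h ^ 2)"
      using e s by (intro mult_right_mono) (auto simp: s_def)
    finally show "\<bar>a * f (z + h) + c * g (z + h) - (a * f z + c * g z)
      - (a * l h + c * m h) - (a * B h h + c * C h h) / 2\<bar> \<le> e * norm h ^ 2"
      by (simp add: algebra_simps add_divide_distrib)
  qed
qed (use f g in \<open>auto simp: taylor2_def intro: linear_scale_combine bilinear_scale_combine\<close>)

lemma taylor2_const: "taylor2 (\<lambda>x. c) z (\<lambda>v. 0) (\<lambda>u v. 0)"
  unfolding taylor2_def by (auto simp: bilinear_def linear_iff intro: exI[of _ 1])

text \<open>Product rule with a linear factor: it drives the induction over monomials in
  \<open>polys_taylor2\<close>.\<close>

lemma taylor2_mult_linear:
  assumes f: "taylor2 f z l B"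
  shows "taylor2 (\<lambda>x. (x \<bullet> b) * f x) z (\<lambda>v. (v \<bullet> b) * f z + (z \<bullet> b) * l v)
    (\<lambda>u v. (u \<bullet> b) * l v + (v \<bullet> b) * l u + (z \<bullet> b) * B u v)"
  unfolding taylor2_def
proof (intro conjI allI impI)
  have l: "linear l" and B: "bilinear B" using f by (auto simp: taylor2_def)
  show "linear (\<lambda>v. (v \<bullet> b) * f z + (z \<bullet> b) * l v)"
    using l unfolding linear_iff by (auto simp: algebra_simps)
  show "bilinear (\<lambda>u v. (u \<bullet> b) * l v + (v \<bullet> b) * l u + (z \<bullet> b) * B u v)"
    using l B unfolding bilinear_def linear_iff by (auto simp: algebra_simps)
  obtain K where K: "K > 0" "\<And>u v. \<bar>B u v\<bar> \<le> K * norm u * norm v"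
    using bilinear_bound[OF B] by blast
  fix e :: real assume e: "e > 0"
  define s where "s = 2 * ((norm z + 1) * norm b + 1)"
  have s: "s > 0" by (simp add: s_def add_nonneg_pos)
  obtain d where d: "d > 0" "\<And>h. norm h < d \<Longrightarrow> \<bar>f (z + h) - f z - l h - B h h / 2\<bar> \<le> e / s * norm h ^ 2"
    using f e s unfolding taylor2_def by (metis divide_pos_pos)
  define t where "t = e / (norm b * K + 1)"
  have t: "t > 0" using e K by (simp add: t_def add_nonneg_pos)
  show "\<exists>d>0. \<forall>h. norm h < d \<longrightarrow> \<bar>((z + h) \<bullet> b) * f (z + h) - (z \<bullet> b) * f z
      - ((h \<bullet> b) * f z + (z \<bullet> b) * l h) - ((h \<bullet> b) * l h + (h \<bullet> b) * l h + (z \<bullet> b) * B h h) / 2\<bar> \<le> e * norm h ^ 2"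
  proof (intro exI conjI allI impI)
    show "min 1 (min d t) > 0" using d t by simp
    fix h :: 'a assume h: "norm h < min 1 (min d t)"
    let ?F = "f (z + h) - f z - l h - B h h / 2"
    have "\<bar>(z + h) \<bullet> b\<bar> \<le> norm (z + h) * norm b" by (rule Cauchy_Schwarz_ineq2)
    also have "\<dots> \<le> (norm z + 1) * norm b"
      using h norm_triangle_ineq[of z h] by (intro mult_right_mono) auto
    finally have 1: "\<bar>((z + h) \<bullet> b) * ?F\<bar> \<le> ((norm z + 1) * norm b) * (e / s * norm h ^ 2)"
      unfolding abs_mult using d(2)[of h] h by (intro mult_mono) auto
    also have "\<dots> = ((norm z + 1) * norm b) / s * (e * norm h ^ 2)" by simp
    also have "\<dots> \<le> 1/2 * (e * norm h ^ 2)"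
      using e s by (intro mult_right_mono) (auto simp: s_def field_simps)
    finally have 1: "\<bar>((z + h) \<bullet> b) * ?F\<bar> \<le> e * norm h ^ 2 / 2" by simp
    have "\<bar>(h \<bullet> b) * B h h\<bar> \<le> (norm h * norm b) * (K * norm h * norm h)"
      unfolding abs_mult by (intro mult_mono Cauchy_Schwarz_ineq2 K) auto
    also have "\<dots> = (norm h * (norm b * K)) * norm h ^ 2" by (simp add: power2_eq_square)
    also have "norm h * (norm b * K) \<le> e"
    proof -
      have "norm h * (norm b * K) \<le> t * (norm b * K + 1)"
        using h K t by (intro mult_mono) auto
      also have "\<dots> = e" using K by (simp add: t_def) (metis add_nonneg_pos less_irrefl less_le mult_nonneg_nonneg norm_ge_zero zero_less_one)
      finally show ?thesis .
    qed
    finally have 2: "\<bar>(h \<bullet> b) * B h h\<bar> \<le> e * norm h ^ 2" by (simp add: mult_right_mono)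
    have "((z + h) \<bullet> b) * f (z + h) - (z \<bullet> b) * f z
      - ((h \<bullet> b) * f z + (z \<bullet> b) * l h) - ((h \<bullet> b) * l h + (h \<bullet> b) * l h + (z \<bullet> b) * B h h) / 2
      = ((z + h) \<bullet> b) * ?F + (h \<bullet> b) * B h h / 2"
      by (simp add: inner_simps field_simps)
    then show "\<bar>((z + h) \<bullet> b) * f (z + h) - (z \<bullet> b) * f z
      - ((h \<bullet> b) * f z + (z \<bullet> b) * l h) - ((h \<bullet> b) * l h + (h \<bullet> b) * l h + (z \<bullet> b) * B h h) / 2\<bar> \<le> e * norm h ^ 2"
      using 1 2 by linarith
  qed
qed

text \<open>\<open>B\<close> need not be symmetric, which is why the gradient averages B(z - x0, v)
  and B(v, z - x0).\<close>

lemma taylor2_quadratic: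
  fixes B :: "'a::euclidean_space \<Rightarrow> 'a \<Rightarrow> real"
  assumes l: "linear l" and B: "bilinear B"
  shows "taylor2 (\<lambda>y. a + l (y - x0) + B (y - x0) (y - x0) / 2) z
    (\<lambda>v. l v + (B (z - x0) v + B v (z - x0)) / 2) (\<lambda>u v. B u v)"
  unfolding taylor2_def
proof (intro conjI allI impI)
  show "linear (\<lambda>v. l v + (B (z - x0) v + B v (z - x0)) / 2)"
    using l B unfolding bilinear_def linear_iff by (auto simp: algebra_simps add_divide_distrib)
  fix e :: real assume "e > 0"
  then show "\<exists>d>0. \<forall>h. norm h < d \<longrightarrow> \<bar>a + l (z + h - x0) + B (z + h - x0) (z + h - x0) / 2 -
     (a + l (z - x0) + B (z - x0) (z - x0) / 2) - (l h + (B (z - x0) h + B h (z - x0)) / 2) - B h h / 2\<bar> \<le> e * norm h ^ 2"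
  proof (intro exI[of _ 1] conjI allI impI)
    fix h :: 'a
    have *: "z + h - x0 = (z - x0) + h" by simp
    have "a + l (z + h - x0) + B (z + h - x0) (z + h - x0) / 2 -
     (a + l (z - x0) + B (z - x0) (z - x0) / 2) - (l h + (B (z - x0) h + B h (z - x0)) / 2) - B h h / 2 = 0"
      unfolding * linear_add[OF l] bilinear_ladd[OF B] bilinear_radd[OF B] by (simp add: field_simps)
    then show "\<bar>a + l (z + h - x0) + B (z + h - x0) (z + h - x0) / 2 -
     (a + l (z - x0) + B (z - x0) (z - x0) / 2) - (l h + (B (z - x0) h + B h (z - x0)) / 2) - B h h / 2\<bar> \<le> e * norm h ^ 2"
      using \<open>e > 0\<close> by (metis abs_zero less_imp_le mult_nonneg_nonneg zero_le_power2)
  qed simp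
qed (rule B)

text \<open>Adding the expansions at tv and -tv cancels the linear part, so only the quadratic term
  is left to be compared with the remainder.\<close>

lemma taylor2_max:
  assumes f: "taylor2 f z l B" and d: "d > 0" "\<And>h. norm h < d \<Longrightarrow> f (z + h) \<le> f z"
  shows "B v v \<le> 0"
proof (rule ccontr)
  assume neg: "\<not> B v v \<le> 0"
  have l: "linear l" and B: "bilinear B" using f by (auto simp: taylor2_def)
  define c where "c = norm v ^ 2 + 1"
  have c: "c > 0" by (simp add: c_def add_nonneg_pos)
  define e where "e = B v v / (4 * c)"
  have e: "e > 0" using neg c by (simp add: e_def)
  obtain d' where d': "d' > 0" "\<And>h. norm h < d' \<Longrightarrow> \<bar>f (z + h) - f z - l h - B h h / 2\<bar> \<le> e * norm h ^ 2"
    using f e unfolding taylor2_def by metis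
  define t where "t = min d d' / (2 * (norm v + 1))"
  have t: "t > 0" using d d' by (simp add: t_def add_nonneg_pos)
  have "t * norm v < min d d'"
  proof -
    have "t * norm v \<le> t * (norm v + 1)" using t by simp
    also have "\<dots> = min d d' / 2"
    proof -
      have "a / (2 * c) * c = a / 2" if "c \<noteq> 0" for a c :: real using that by simp
      moreover have "norm v + 1 \<noteq> 0" using norm_ge_zero[of v] by linarith
      ultimately show ?thesis unfolding t_def by blast
    qed
    also have "\<dots> < min d d'" using d(1) d'(1) by (simp add: min_def)
    finally show ?thesis .
  qed
  then have n: "norm (t *\<^sub>R v) < d" "norm (t *\<^sub>R v) < d'" "norm (- (t *\<^sub>R v)) < d" "norm (- (t *\<^sub>R v)) < d'"
    using t by auto
  have "B (t *\<^sub>R v) (t *\<^sub>R v) = t^2 * B v v" "B (- (t *\<^sub>R v)) (- (t *\<^sub>R v)) = t^2 * B v v"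
    using bilinear_scaleR_both[OF B, of t v t v] bilinear_scaleR_both[OF B, of "-t" v "-t" v]
    by (auto simp: power2_eq_square)
  moreover have "l (- (t *\<^sub>R v)) = - l (t *\<^sub>R v)" by (rule linear_neg[OF l])
  ultimately have "t^2 * B v v \<le> 2 * (e * norm (t *\<^sub>R v) ^ 2)"
    using d(2)[OF n(1)] d(2)[OF n(3)] d'(2)[OF n(2)] d'(2)[OF n(4)] by (simp add: abs_le_iff)
  also have "\<dots> = t^2 * (2 * e * norm v ^ 2)" by (simp add: power_mult_distrib)
  finally have "B v v \<le> 2 * e * norm v ^ 2" using t by simp
  also have "\<dots> = B v v * (norm v ^ 2 / (2 * c))"
  proof -
    have "2 * (a / (4 * c)) * y = a * (y / (2 * c))" for a c y :: real by simp
    then show ?thesis unfolding e_def .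
  qed
  also have "\<dots> < B v v * 1"
  proof (rule mult_strict_left_mono)
    have "norm v ^ 2 < 2 * c" by (simp add: c_def add_nonneg_pos)
    then show "norm v ^ 2 / (2 * c) < 1" using c by (simp add: divide_less_eq_1)
  qed (use neg in simp)
  finally show False by simp
qed

text \<open>This is tr(A B) for the matrix A = sum of c v v^T over the listed pairs (c, v): a
  constant-coefficient second-order operator acting on a Hessian B. With nonnegative weights it is
  degenerate elliptic, and \<open>qsum xs (\<bullet>)\<close> is the trace of A; that this trace is
  positive is the only ellipticity used by the maximum principle below.\<close>

definition qsum :: "(real \<times> 'a) list \<Rightarrow> ('a \<Rightarrow> 'a \<Rightarrow> real) \<Rightarrow> real" where
  "qsum xs B = (\<Sum>p\<leftarrow>xs. fst p * B (snd p) (snd p))"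

definition nonneg_weights :: "(real \<times> 'a) list \<Rightarrow> bool" where
  "nonneg_weights xs \<longleftrightarrow> (\<forall>p\<in>set xs. fst p \<ge> 0)"

lemma qsum_combine: "qsum xs (\<lambda>u v. a * B u v + c * C u v) = a * qsum xs B + c * qsum xs C"
  unfolding qsum_def by (induction xs) (auto simp: algebra_simps)

lemma qsum_zero: "qsum xs (\<lambda>u v. 0) = 0"
  unfolding qsum_def by (induction xs) auto

lemma qsum_mono:
  assumes "nonneg_weights xs" "\<And>v. B v v \<le> C v v"
  shows "qsum xs B \<le> qsum xs C"
  using assms unfolding qsum_def nonneg_weights_def
  by (intro sum_list_mono mult_left_mono) auto

lemma taylor2_touch:
  assumes xs: "nonneg_weights xs" and f: "taylor2 f x l B" and l': "linear l'" and B': "bilinear B'"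
    and d: "d > 0" "\<And>k. norm k < d \<Longrightarrow> f (x + k) \<le> f x + l' k + B' k k / 2"
  shows "qsum xs B \<le> qsum xs B'"
proof (rule qsum_mono[OF xs])
  fix v
  note q = taylor2_quadratic[OF l' B', of 0 x x]
  have "1 * B v v + (-1) * B' v v \<le> 0"
    by (rule taylor2_max[OF taylor2_combine[OF f q, of 1 "-1"] d(1)])
       (use d(2) in \<open>force simp: linear_0[OF l'] bilinear_lzero[OF B']\<close>)
  then show "B v v \<le> B' v v" by simp
qed

text \<open>Essentially the second-order superjet of \<open>w\<close> at \<open>x\<close>, except
  that the bound is by an exact quadratic polynomial without remainder and that \<open>B\<close> may
  be nonsymmetric.\<close>

definition touch_above :: "('a::euclidean_space \<Rightarrow> real) \<Rightarrow> 'a \<Rightarrow> ('a \<Rightarrow> real) \<Rightarrow> ('a \<Rightarrow> 'a \<Rightarrow> real) \<Rightarrow> bool" where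
  "touch_above w x l B \<longleftrightarrow> linear l \<and> bilinear B \<and>
     (\<exists>d>0. \<forall>k. norm k < d \<longrightarrow> w (x + k) \<le> w x + l k + B k k / 2)"

text \<open>The extra e|k|^2 / 2 swallows the Peano remainder, which turns a pointwise expansion of
  \<open>h\<close> into a genuine local upper bound for \<open>w\<close>.\<close>

lemma taylor2_touch_above:
  assumes h: "taylor2 h x l B" and e: "e > 0" and d: "d > 0"
    and w: "\<And>k. norm k < d \<Longrightarrow> w (x + k) - h (x + k) \<le> w x - h x"
  shows "touch_above w x l (\<lambda>u v. 1 * B u v + e * (u \<bullet> v))"
proof -
  obtain d' where d': "d' > 0" "\<And>k. norm k < d' \<Longrightarrow> \<bar>h (x + k) - h x - l k - B k k / 2\<bar> \<le> e / 2 * norm k ^ 2"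
    using h e unfolding taylor2_def by (metis half_gt_zero)
  show ?thesis unfolding touch_above_def
  proof (intro conjI exI allI impI)
    show "linear l" using h by (simp add: taylor2_def)
    show "bilinear (\<lambda>u v. 1 * B u v + e * (u \<bullet> v))"
      by (intro bilinear_scale_combine bilinear_inner) (use h in \<open>simp add: taylor2_def\<close>)
    show "min d d' > 0" using d d' by simp
    fix k :: 'a assume k: "norm k < min d d'"
    then show "w (x + k) \<le> w x + l k + (1 * B k k + e * (k \<bullet> k)) / 2"
      using w[of k] d'(2)[of k] unfolding power2_norm_eq_inner abs_le_iff add_divide_distrib mult_1
      by (simp add: algebra_simps)
  qed
qed

lemma taylor2_imp_continuous:
  assumes "taylor2 f z l B" shows "isCont f z"
proof -
  have l: "linear l" and B: "bilinear B" using assms by (auto simp: taylor2_def)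
  obtain K where K: "K > 0" "\<And>u v. \<bar>B u v\<bar> \<le> K * norm u * norm v"
    using bilinear_bound[OF B] by blast
  obtain M where M: "M > 0" "\<And>u. \<bar>l u\<bar> \<le> M * norm u"
    using linear_bounded_pos[OF l] by auto
  obtain d where d: "d > 0" "\<And>h. norm h < d \<Longrightarrow> \<bar>f (z + h) - f z - l h - B h h / 2\<bar> \<le> 1 * norm h ^ 2"
    using assms unfolding taylor2_def by (metis zero_less_one)
  have "((\<lambda>h. f (z + h) - f z) \<longlongrightarrow> 0) (at 0)"
  proof (rule Lim_null_comparison)
    show "((\<lambda>h. M * norm h + K * norm h * norm h / 2 + norm h ^ 2) \<longlongrightarrow> 0) (at (0::'a))"
      by (auto intro!: tendsto_eq_intros)
    show "\<forall>\<^sub>F h in at 0. norm (f (z + h) - f z) \<le> M * norm h + K * norm h * norm h / 2 + norm h ^ 2"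
      unfolding eventually_at
    proof (intro exI[of _ d] conjI ballI impI)
      fix h :: 'a assume "h \<noteq> 0 \<and> dist h 0 < d"
      then have "\<bar>f (z + h) - f z - l h - B h h / 2\<bar> \<le> norm h ^ 2" using d(2)[of h] by simp
      then show "norm (f (z + h) - f z) \<le> M * norm h + K * norm h * norm h / 2 + norm h ^ 2"
        using M(2)[of h] K(2)[of h h] unfolding real_norm_def by linarith
    qed (rule d)
  qed
  then have "((\<lambda>h. f (z + h)) \<longlongrightarrow> f z) (at 0)" by (simp add: LIM_zero_iff)
  then show ?thesis by (simp add: isCont_iff)
qed

text \<open>Since \<open>h\<close> has an expansion at every interior point, it serves itself as a
  test function at an interior maximum of w - h. The added term \<theta>|y - z|^2 makes the
  comparison strict, because the operator has positive trace; afterwards \<theta> tends to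
  0.\<close>

lemma viscosity_max_principle:
  fixes w h :: "'a::euclidean_space \<Rightarrow> real"
  assumes xs: "qsum xs (\<bullet>) > 0" and w: "continuous_on (cball z r) w" and r: "r > 0"
    and sub: "\<And>x l B. x \<in> ball z r \<Longrightarrow> touch_above w x l B \<Longrightarrow> qsum xs B \<ge> b"
    and hc: "continuous_on (cball z r) h"
    and h: "\<And>x. x \<in> ball z r \<Longrightarrow> \<exists>l B. taylor2 h x l B \<and> qsum xs B \<le> b"
    and bd: "\<And>x. x \<in> sphere z r \<Longrightarrow> w x \<le> h x + m"
    and x: "x \<in> cball z r"
  shows "w x \<le> h x + m"
proof -
  have "w x \<le> h x + m + \<theta> * r^2" if \<theta>: "\<theta> > 0" for \<theta>
  proof -
    define D where "D = (\<lambda>y. w y - h y + \<theta> * ((y - z) \<bullet> (y - z)))"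
    have Dc: "continuous_on (cball z r) D" unfolding D_def by (intro continuous_intros w hc)
    obtain x1 where x1: "x1 \<in> cball z r" "\<And>y. y \<in> cball z r \<Longrightarrow> D y \<le> D x1"
      using continuous_attains_sup[OF compact_cball _ Dc] r by fastforce
    have "x1 \<in> sphere z r"
    proof (rule ccontr)
      assume "x1 \<notin> sphere z r"
      with x1(1) have x1b: "x1 \<in> ball z r" by (auto simp: less_le)
      obtain d where d: "d > 0" "ball x1 d \<subseteq> ball z r" using x1b openE[OF open_ball] by blast
      obtain l B where lB: "taylor2 h x1 l B" "qsum xs B \<le> b" using h[OF x1b] by blast

      \<comment> \<open>The test function is h - \<theta>|y - z|^2. Its quadratic part lowers the
        operator by 2\<theta> times the trace, while the allowance for the Peano remainder gives
        back only \<theta> times it.\<close>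
      have q: "taylor2 (\<lambda>y. 0 + (\<lambda>v. 0) (y - z) + ((y - z) \<bullet> (y - z)) / 2) x1
          (\<lambda>v. (\<lambda>v. 0) v + (((x1 - z) \<bullet> v) + (v \<bullet> (x1 - z))) / 2) (\<lambda>u v. u \<bullet> v)"
        by (rule taylor2_quadratic) (auto simp: linear_iff bilinear_inner)
      have "touch_above w x1 (\<lambda>v. 1 * l v + (- (2 * \<theta>)) * (0 + (((x1 - z) \<bullet> v) + (v \<bullet> (x1 - z))) / 2))
          (\<lambda>u v. 1 * (1 * B u v + (- (2 * \<theta>)) * (u \<bullet> v)) + \<theta> * (u \<bullet> v))"
      proof (rule taylor2_touch_above[OF taylor2_combine[OF lB(1) q] \<theta> d(1)])
        fix k :: 'a assume "norm k < d"
        then have "x1 + k \<in> ball x1 d" by (simp add: dist_norm)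
        then have "D (x1 + k) \<le> D x1" using d(2) by (intro x1(2)) auto
        then show "w (x1 + k) - (1 * h (x1 + k) + - (2 * \<theta>) * (0 + 0 + (x1 + k - z) \<bullet> (x1 + k - z) / 2))
          \<le> w x1 - (1 * h x1 + - (2 * \<theta>) * (0 + 0 + (x1 - z) \<bullet> (x1 - z) / 2))"
          unfolding D_def by simp
      qed
      from sub[OF x1b this] have "b \<le> 1 * (1 * qsum xs B + (- (2 * \<theta>)) * qsum xs (\<bullet>)) + \<theta> * qsum xs (\<bullet>)"
        unfolding qsum_combine .
      then have "\<theta> * qsum xs (\<bullet>) \<le> 0" using lB(2) by simp
      then show False using \<theta> xs by (simp add: mult_le_0_iff)
    qed
    then have "D x1 \<le> m + \<theta> * r^2"
      using bd[of x1] by (auto simp: D_def dist_norm norm_minus_commute power2_norm_eq_inner[symmetric])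
    moreover have "w x - h x \<le> D x" using \<theta> by (simp add: D_def)
    ultimately show ?thesis using x1(2)[OF x] by simp
  qed
  moreover have "((\<lambda>\<theta>. h x + m + \<theta> * r^2) \<longlongrightarrow> h x + m + 0 * r^2) (at_right 0)"
    by (intro tendsto_intros)
  ultimately have "w x \<le> h x + m + 0 * r^2"
    by (intro tendsto_lowerbound[of _ _ "at_right 0"]) (auto simp: eventually_at_right_less eventually_at_topological intro: eventually_mono[OF eventually_at_right_less])
  then show ?thesis by simp
qed

section \<open>Polynomial solutions of the Dirichlet problem\<close>

interpretation fs: vector_space "\<lambda>(c::real) (f::'a::euclidean_space \<Rightarrow> real) x. c * f x"
  by unfold_locales (auto simp: algebra_simps fun_eq_iff)

definition monomial :: "'a::euclidean_space list \<Rightarrow> 'a \<Rightarrow> real" where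
  "monomial bs x = (\<Prod>b\<leftarrow>bs. x \<bullet> b)"

text \<open>Degrees are integers so that two derivatives lower the degree by exactly 2 without
  truncation; for negative \<open>d\<close> the set is empty and its span is zero.\<close>

definition monomials :: "int \<Rightarrow> ('a::euclidean_space \<Rightarrow> real) set" where
  "monomials d = {monomial bs | bs. set bs \<subseteq> Basis \<and> int (length bs) \<le> d}"

definition polys :: "int \<Rightarrow> ('a::euclidean_space \<Rightarrow> real) set" where
  "polys d = fs.span (monomials d)"

lemma finite_monomials: "finite (monomials d :: ('a::euclidean_space \<Rightarrow> real) set)"
proof -
  have "monomials d \<subseteq> monomial ` {bs. set bs \<subseteq> (Basis::'a set) \<and> length bs \<le> nat d}"
    by (auto simp: monomials_def)
  then show ?thesis
    by (rule finite_subset) (intro finite_imageI finite_lists_length_le finite_Basis)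
qed

section \<open>Closure properties of polynomials of bounded degree\<close>

lemma polys_add: "f \<in> polys d \<Longrightarrow> g \<in> polys d \<Longrightarrow> (\<lambda>x. f x + g x) \<in> polys d"
  using fs.span_add[of f "monomials d" g] by (simp add: polys_def plus_fun_def)

lemma polys_scale: "f \<in> polys d \<Longrightarrow> (\<lambda>x. c * f x) \<in> polys d"
  unfolding polys_def by (rule fs.span_scale)

lemma polys_zero: "(\<lambda>x. 0) \<in> polys d"
  using fs.span_zero[of "monomials d"] by (simp add: polys_def zero_fun_def)

lemma polys_mono: "d \<le> e \<Longrightarrow> f \<in> polys d \<Longrightarrow> f \<in> polys e"
  unfolding polys_def using fs.span_mono[of "monomials d" "monomials e"] by (force simp: monomials_def)

lemma polys_diff: "f \<in> polys d \<Longrightarrow> g \<in> polys d \<Longrightarrow> (\<lambda>x. f x - g x) \<in> polys d"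
  using polys_add[of f d "\<lambda>x. (-1) * g x"] polys_scale[of g d "-1"] by simp

lemma polys_sum:
  assumes "finite I" "\<And>i. i \<in> I \<Longrightarrow> f i \<in> polys d" shows "(\<lambda>x. \<Sum>i\<in>I. f i x) \<in> polys d"
  using assms by (induction I rule: finite_induct) (auto intro: polys_zero polys_add)

lemma polys_induct [consumes 1, case_names zero monomial combine]:
  assumes f: "f \<in> polys d" and z: "P (\<lambda>x. 0)"
    and m: "\<And>bs. set bs \<subseteq> Basis \<Longrightarrow> int (length bs) \<le> d \<Longrightarrow> P (monomial bs)"
    and c: "\<And>c f g. P f \<Longrightarrow> P g \<Longrightarrow> P (\<lambda>x. c * f x + g x)"
  shows "P f"
  using f unfolding polys_def
proof (induction rule: fs.span_induct_alt)
  case base then show ?case using z by (simp add: zero_fun_def)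
next
  case (step c x y)
  then have "P x" using m by (auto simp: monomials_def)
  then show ?case using c[of x y c] step by (simp add: plus_fun_def)
qed

lemma monomial_in_polys: "set bs \<subseteq> Basis \<Longrightarrow> int (length bs) \<le> d \<Longrightarrow> monomial bs \<in> polys d"
  unfolding polys_def by (rule fs.span_base) (auto simp: monomials_def)

lemma polys_const: "0 \<le> d \<Longrightarrow> (\<lambda>x. c) \<in> polys d"
  using polys_scale[OF monomial_in_polys[of "[]" d], of c] by (simp add: monomial_def)

lemma polys_mult_coord:
  assumes "b \<in> Basis" "f \<in> polys d" shows "(\<lambda>x. (x \<bullet> b) * f x) \<in> polys (d + 1)"
  using assms(2)
proof (induction rule: polys_induct)
  case zero then show ?case by (simp add: polys_zero)
next
  case (monomial bs)
  then have "monomial (b # bs) \<in> polys (d + 1)" using assms(1) by (intro monomial_in_polys) auto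
  then show ?case by (simp add: monomial_def[abs_def])
next
  case (combine c f g)
  then have "(\<lambda>x. c * ((x \<bullet> b) * f x) + (x \<bullet> b) * g x) \<in> polys (d + 1)" by (intro polys_add polys_scale)
  then show ?case by (simp add: algebra_simps)
qed

lemma polys_mult:
  assumes "f \<in> polys d" "g \<in> polys e" shows "(\<lambda>x. f x * g x) \<in> polys (d + e)"
  using assms(1)
proof (induction rule: polys_induct)
  case zero then show ?case by (simp add: polys_zero)
next
  case (monomial bs)
  then have "(\<lambda>x. monomial bs x * g x) \<in> polys (int (length bs) + e)"
  proof (induction bs)
    case Nil then show ?case using assms(2) by (simp add: monomial_def)
  next
    case (Cons b bs)
    then have "(\<lambda>x. (x \<bullet> b) * (monomial bs x * g x)) \<in> polys (int (length bs) + e + 1)"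
      by (intro polys_mult_coord) auto
    then show ?case by (simp add: monomial_def mult.assoc add_ac)
  qed
  then show ?case by (rule polys_mono[rotated]) (use monomial in simp)
next
  case (combine c f1 f2)
  then have "(\<lambda>x. c * (f1 x * g x) + f2 x * g x) \<in> polys (d + e)" by (intro polys_add polys_scale)
  then show ?case by (simp add: algebra_simps)
qed

lemma polys_linear:
  assumes "linear (f :: 'a::euclidean_space \<Rightarrow> real)" shows "f \<in> polys 1"
proof -
  have "f = (\<lambda>x. \<Sum>b\<in>Basis. f b * (x \<bullet> b))"
  proof
    fix x :: 'a
    have "f x = f (\<Sum>b\<in>Basis. (x \<bullet> b) *\<^sub>R b)" by (simp add: euclidean_representation)
    also have "\<dots> = (\<Sum>b\<in>Basis. f b * (x \<bullet> b))"
      using assms by (simp add: linear_sum linear_cmul mult.commute)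
    finally show "f x = (\<Sum>b\<in>Basis. f b * (x \<bullet> b))" .
  qed
  moreover have "(\<lambda>x. \<Sum>b\<in>Basis. f b * (x \<bullet> b)) \<in> polys 1"
    by (intro polys_sum polys_scale finite_Basis)
       (use monomial_in_polys[of "[_]" 1] in \<open>force simp: monomial_def[abs_def]\<close>)
  ultimately show ?thesis by simp
qed

lemma real_polynomial_function_in_polys:
  assumes "real_polynomial_function f" shows "\<exists>d\<ge>0. f \<in> polys d"
  using assms
proof (induction rule: real_polynomial_function.induct)
  case (linear f) then show ?case
    using polys_linear bounded_linear.linear by (metis zero_le_one)
next
  case (const c) then show ?case using polys_const by blast
next
  case (add f g)
  then obtain d e where "d \<ge> 0" "e \<ge> 0" "f \<in> polys d" "g \<in> polys e" by blast
  then have "(\<lambda>x. f x + g x) \<in> polys (max d e)"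
    by (intro polys_add) (auto intro: polys_mono[of d] polys_mono[of e])
  then show ?case using \<open>d \<ge> 0\<close> by (metis max.coboundedI1)
next
  case (mult f g)
  then show ?case using polys_mult by (metis add_nonneg_nonneg)
qed

text \<open>The degree count for the derivatives is what makes the operator q -> L(k q), with k
  quadratic, map each space of polynomials of bounded degree into itself.\<close>

lemma polys_taylor2:
  assumes "f \<in> polys d"
  shows "\<exists>f1 f2. (\<forall>v. f1 v \<in> polys (d - 1)) \<and> (\<forall>u v. f2 u v \<in> polys (d - 2)) \<and>
    (\<forall>z. taylor2 f z (\<lambda>v. f1 v z) (\<lambda>u v. f2 u v z))"
  using assms
proof (induction rule: polys_induct)
  case zero
  show ?case
    by (rule exI[of _ "\<lambda>v x. 0"], rule exI[of _ "\<lambda>u v x. 0"]) (auto simp: polys_zero taylor2_const)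
next
  case (monomial bs)
  then have "\<exists>f1 f2. (\<forall>v. f1 v \<in> polys (int (length bs) - 1)) \<and> (\<forall>u v. f2 u v \<in> polys (int (length bs) - 2)) \<and>
    (\<forall>z. taylor2 (monomial bs) z (\<lambda>v. f1 v z) (\<lambda>u v. f2 u v z))"
  proof (induction bs)
    case Nil
    show ?case
      by (rule exI[of _ "\<lambda>v x. 0"], rule exI[of _ "\<lambda>u v x. 0"])
         (auto simp: polys_zero monomial_def[abs_def] taylor2_const)
  next
    case (Cons b bs)
    then obtain f1 f2 where f: "\<And>v. f1 v \<in> polys (int (length bs) - 1)"
      "\<And>u v. f2 u v \<in> polys (int (length bs) - 2)"
      "\<And>z. taylor2 (monomial bs) z (\<lambda>v. f1 v z) (\<lambda>u v. f2 u v z)" by auto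
    have b: "b \<in> Basis" using Cons by simp
    define n where "n = int (length bs)"
    let ?g1 = "\<lambda>v x. (v \<bullet> b) * monomial bs x + (x \<bullet> b) * f1 v x"
    let ?g2 = "\<lambda>u v x. (u \<bullet> b) * f1 v x + (v \<bullet> b) * f1 u x + (x \<bullet> b) * f2 u v x"
    have "?g1 v \<in> polys n" for v
    proof (intro polys_add polys_scale)
      show "monomial bs \<in> polys n" using Cons by (intro monomial_in_polys) (auto simp: n_def)
      show "(\<lambda>x. (x \<bullet> b) * f1 v x) \<in> polys n"
        using polys_mult_coord[OF b f(1)[of v]] by (simp add: n_def)
    qed
    moreover have "?g2 u v \<in> polys (n - 1)" for u v
    proof (intro polys_add polys_scale)
      show "(\<lambda>x. (x \<bullet> b) * f2 u v x) \<in> polys (n - 1)"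
        using polys_mult_coord[OF b f(2)[of u v]] by (simp add: n_def)
    qed (use f(1) in \<open>auto simp: n_def\<close>)
    moreover have "taylor2 (monomial (b # bs)) z (\<lambda>v. ?g1 v z) (\<lambda>u v. ?g2 u v z)" for z
      using taylor2_mult_linear[OF f(3)[of z], of b] by (simp add: monomial_def[abs_def])
    ultimately show ?case
      by (intro exI[of _ ?g1] exI[of _ ?g2]) (auto simp: n_def)
  qed
  then show ?case using monomial polys_mono by (metis diff_right_mono)
next
  case (combine c f g)
  then obtain f1 f2 g1 g2 where fg: "\<And>v. f1 v \<in> polys (d - 1)" "\<And>u v. f2 u v \<in> polys (d - 2)"
      "\<And>z. taylor2 f z (\<lambda>v. f1 v z) (\<lambda>u v. f2 u v z)"
      "\<And>v. g1 v \<in> polys (d - 1)" "\<And>u v. g2 u v \<in> polys (d - 2)"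
      "\<And>z. taylor2 g z (\<lambda>v. g1 v z) (\<lambda>u v. g2 u v z)" by metis
  show ?case
  proof (rule exI[of _ "\<lambda>v x. c * f1 v x + g1 v x"], rule exI[of _ "\<lambda>u v x. c * f2 u v x + g2 u v x"], intro conjI allI)
    fix z show "taylor2 (\<lambda>x. c * f x + g x) z (\<lambda>v. c * f1 v z + g1 v z) (\<lambda>u v. c * f2 u v z + g2 u v z)"
      using taylor2_combine[OF fg(3)[of z] fg(6)[of z], of c 1] by simp
  qed (intro polys_add polys_scale fg)+
qed

text \<open>Only the diagonal of \<open>B\<close> is determined by the function, since
  \<open>B\<close> may be nonsymmetric; \<open>qsum\<close> sees nothing else, so \<open>Lop\<close>
  is well defined.\<close>

lemma taylor2_unique:
  assumes "taylor2 f z l B" "taylor2 f z l' B'" shows "B v v = B' v v"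
proof -
  have "1 * B v v + (-1) * B' v v \<le> 0"
    by (rule taylor2_max[OF taylor2_combine[OF assms, of 1 "-1"], of 1]) auto
  moreover have "1 * B' v v + (-1) * B v v \<le> 0"
    by (rule taylor2_max[OF taylor2_combine[OF assms(2,1), of 1 "-1"], of 1]) auto
  ultimately show ?thesis by simp
qed

definition Lop :: "(real \<times> 'a::euclidean_space) list \<Rightarrow> ('a \<Rightarrow> real) \<Rightarrow> 'a \<Rightarrow> real" where
  "Lop xs f z = (THE c. \<exists>l B. taylor2 f z l B \<and> c = qsum xs B)"

lemma Lop_eq:
  assumes "taylor2 f z l B" shows "Lop xs f z = qsum xs B"
  unfolding Lop_def
proof (rule the_equality)
  fix c assume "\<exists>l B. taylor2 f z l B \<and> c = qsum xs B"
  then obtain l' B' where "taylor2 f z l' B'" "c = qsum xs B'" by blast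
  then show "c = qsum xs B" using taylor2_unique[OF assms] by (auto simp: qsum_def)
qed (use assms in blast)

lemma Lop_polys:
  assumes "f \<in> polys d"
  shows "Lop xs f \<in> polys (d - 2)" and "\<exists>l B. taylor2 f z l B \<and> qsum xs B = Lop xs f z"
proof -
  obtain f1 f2 where f: "\<And>u v. f2 u v \<in> polys (d - 2)" "\<And>z. taylor2 f z (\<lambda>v. f1 v z) (\<lambda>u v. f2 u v z)"
    using polys_taylor2[OF assms] by blast
  show "\<exists>l B. taylor2 f z l B \<and> qsum xs B = Lop xs f z" using f(2)[of z] Lop_eq[OF f(2)[of z]] by metis
  have "Lop xs f = (\<lambda>z. qsum xs (\<lambda>u v. f2 u v z))" using Lop_eq[OF f(2)] by auto
  moreover have "(\<lambda>z. qsum xs (\<lambda>u v. f2 u v z)) \<in> polys (d - 2)"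
    unfolding qsum_def by (induction xs) (auto intro: polys_zero intro!: polys_add polys_scale f(1))
  ultimately show "Lop xs f \<in> polys (d - 2)" by simp
qed

lemma Lop_combine:
  assumes "f \<in> polys d" "g \<in> polys e"
  shows "Lop xs (\<lambda>x. a * f x + c * g x) z = a * Lop xs f z + c * Lop xs g z"
proof -
  obtain l B m C where "taylor2 f z l B" "qsum xs B = Lop xs f z" "taylor2 g z m C" "qsum xs C = Lop xs g z"
    using Lop_polys(2)[OF assms(1), of z xs] Lop_polys(2)[OF assms(2), of z xs] by blast
  then show ?thesis using Lop_eq[OF taylor2_combine, of f z l B g m C xs a c] by (simp add: qsum_combine)
qed

text \<open>Injectivity sends a basis to an independent family of the same size. A vector outside
  the span of that family could be added to it, giving too many independent vectors in the original
  span.\<close>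

lemma linear_injective_on_span_surj:
  fixes S :: "('a::euclidean_space \<Rightarrow> real) set" and T :: "('a \<Rightarrow> real) \<Rightarrow> 'a \<Rightarrow> real"
  assumes S: "finite S"
    and T: "\<And>f. f \<in> fs.span S \<Longrightarrow> T f \<in> fs.span S"
    and lin: "\<And>f g a c. f \<in> fs.span S \<Longrightarrow> g \<in> fs.span S \<Longrightarrow>
      T (\<lambda>x. a * f x + c * g x) = (\<lambda>x. a * T f x + c * T g x)"
    and inj: "\<And>f. f \<in> fs.span S \<Longrightarrow> T f = 0 \<Longrightarrow> f = 0"
    and y: "y \<in> fs.span S"
  shows "\<exists>f\<in>fs.span S. T f = y"
proof -
  obtain B where B: "B \<subseteq> S" "fs.independent B" "S \<subseteq> fs.span B"
    using fs.maximal_independent_subset[of S] by blast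
  have finB: "finite B" using B S finite_subset by blast
  have spB: "fs.span B = fs.span S" using B by (metis fs.span_eq fs.span_superset subset_trans)
  have T0: "T (\<lambda>x. 0) = (\<lambda>x. 0)"
    using lin[of "\<lambda>x. 0" "\<lambda>x. 0" 0 0] fs.span_zero[of S] by (simp add: zero_fun_def)
  have Tsum: "T (\<lambda>x. \<Sum>b\<in>C. c b * b x) = (\<lambda>x. \<Sum>b\<in>C. c b * T b x) \<and> (\<lambda>x. \<Sum>b\<in>C. c b * b x) \<in> fs.span S"
    if "finite C" "C \<subseteq> fs.span S" for C c
    using that
  proof (induction C rule: finite_induct)
    case empty then show ?case using T0 fs.span_zero[of S] by (simp add: zero_fun_def)
  next
    case (insert b C)
    then have "T (\<lambda>x. c b * b x + 1 * (\<Sum>b\<in>C. c b * b x)) = (\<lambda>x. c b * T b x + 1 * T (\<lambda>x. \<Sum>b\<in>C. c b * b x) x)"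
      by (intro lin) auto
    moreover have "(\<lambda>x. c b * b x + (\<Sum>b\<in>C. c b * b x)) \<in> fs.span S"
      using fs.span_add[OF fs.span_scale[of b S "c b"], of "\<lambda>x. \<Sum>b\<in>C. c b * b x"] insert
      by (auto simp: plus_fun_def)
    ultimately show ?case using insert by simp
  qed
  have BS: "B \<subseteq> fs.span S" using B(1) fs.span_superset by blast
  have injB: "inj_on T B"
  proof (rule inj_onI)
    fix b b' assume bb: "b \<in> B" "b' \<in> B" "T b = T b'"
    have "T (\<lambda>x. 1 * b x + (-1) * b' x) = (\<lambda>x. 1 * T b x + (-1) * T b' x)" using bb BS by (intro lin) auto
    then have "T (\<lambda>x. b x - b' x) = 0" using bb by (simp add: zero_fun_def)
    moreover have "(\<lambda>x. b x - b' x) \<in> fs.span S"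
      using fs.span_diff[of b S b'] bb BS by (auto simp: fun_diff_def)
    ultimately have "(\<lambda>x. b x - b' x) = 0" using inj by blast
    then show "b = b'" by (auto simp: fun_eq_iff)
  qed
  have sum_fun: "(\<Sum>v\<in>C. (\<lambda>x. u v * v x)) = (\<lambda>x. \<Sum>v\<in>C. u v * v x)" for C :: "('a \<Rightarrow> real) set" and u
    by (induction C rule: infinite_finite_induct) (auto simp: fun_eq_iff)
  have indT: "fs.independent (T ` B)"
  proof
    assume "fs.dependent (T ` B)"
    then obtain u v where u: "v \<in> T ` B" "u v \<noteq> 0" "(\<Sum>v\<in>T ` B. (\<lambda>x. u v * v x)) = 0"
      using fs.dependent_finite[of "T ` B"] finB by auto
    have "(\<lambda>x. \<Sum>b\<in>B. u (T b) * T b x) = 0"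
      using u(3) unfolding sum_fun by (simp add: sum.reindex[OF injB])
    then have "T (\<lambda>x. \<Sum>b\<in>B. u (T b) * b x) = 0" using Tsum[OF finB BS, of "\<lambda>b. u (T b)"] by simp
    then have "(\<lambda>x. \<Sum>b\<in>B. u (T b) * b x) = 0" using inj Tsum[OF finB BS, of "\<lambda>b. u (T b)"] by blast
    then have "\<exists>u. (\<exists>v\<in>B. u v \<noteq> 0) \<and> (\<Sum>v\<in>B. (\<lambda>x. u v * v x)) = 0"
      using u(1,2) by (intro exI[of _ "\<lambda>b. u (T b)"]) (auto simp: sum_fun)
    then show False using B(2) fs.dependent_finite[OF finB] by auto
  qed
  have TBS: "T ` B \<subseteq> fs.span B" using T BS spB by auto
  have "y \<in> fs.span (T ` B)"
  proof (rule ccontr)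
    assume ny: "y \<notin> fs.span (T ` B)"
    then have "fs.independent (insert y (T ` B))" using indT by (simp add: fs.independent_insert)
    moreover have "insert y (T ` B) \<subseteq> fs.span B" using TBS y spB by auto
    ultimately have "card (insert y (T ` B)) \<le> card B" using fs.independent_span_bound[OF finB, of "insert y (T ` B)"] by simp
    moreover have "y \<notin> T ` B" using ny fs.span_base[of y "T ` B"] by argo
    ultimately show False using finB by (simp add: card_image[OF injB])
  qed
  then have "y \<in> range (\<lambda>u. \<Sum>v\<in>T ` B. (\<lambda>x. u v * v x))"
    using fs.span_finite[of "T ` B"] finB by simp
  then obtain u where u: "y = (\<Sum>v\<in>T ` B. (\<lambda>x. u v * v x))" by (rule rangeE)
  have "y = (\<lambda>x. \<Sum>b\<in>B. u (T b) * T b x)"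
    unfolding u sum_fun by (simp add: sum.reindex[OF injB])
  also have "\<dots> = T (\<lambda>x. \<Sum>b\<in>B. u (T b) * b x)"
    by (rule Tsum[OF finB BS, of "\<lambda>b. u (T b)", THEN conjunct1, symmetric])
  finally have "T (\<lambda>x. \<Sum>b\<in>B. u (T b) * b x) = y" ..
  moreover have "(\<lambda>x. \<Sum>b\<in>B. u (T b) * b x) \<in> fs.span S"
    using Tsum[OF finB BS, of "\<lambda>b. u (T b)"] by (rule conjunct2)
  ultimately show ?thesis by (rule bexI)
qed

text \<open>On the line through z and x the polynomial becomes one of a single variable that
  vanishes on a whole interval.\<close>

lemma polys_vanish:
  assumes f: "f \<in> polys d" and r: "r > 0" and z: "\<And>x. x \<in> ball z r \<Longrightarrow> f x = 0"
  shows "f x = 0"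
proof -
  define p where "p = (\<lambda>t::real. f (z + t *\<^sub>R (x - z)))"
  have lin: "real_polynomial_function (\<lambda>t::real. u + t * v)" for u v
    by (rule real_polynomial_function.intros(3)[OF real_polynomial_function.intros(2)
          real_polynomial_function.intros(1)[OF bounded_linear_mult_left]])
  have mon: "real_polynomial_function (\<lambda>t::real. monomial bs (z + t *\<^sub>R (x - z)))" for bs
  proof (induction bs)
    case Nil then show ?case by (simp add: monomial_def real_polynomial_function.intros(2))
  next
    case (Cons b bs)
    have "real_polynomial_function (\<lambda>t::real. (z \<bullet> b + t * ((x - z) \<bullet> b)) * monomial bs (z + t *\<^sub>R (x - z)))"
      by (rule real_polynomial_function.intros(4)[OF lin Cons])
    moreover have "monomial (b # bs) (z + t *\<^sub>R (x - z)) = (z \<bullet> b + t * ((x - z) \<bullet> b)) * monomial bs (z + t *\<^sub>R (x - z))" for t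
      by (simp add: monomial_def inner_simps)
    ultimately show ?case by simp
  qed
  have "real_polynomial_function (\<lambda>t::real. f (z + t *\<^sub>R (x - z)))"
    using f
  proof (induction rule: polys_induct)
    case zero show ?case by (rule real_polynomial_function.intros(2))
  next
    case (monomial bs) show ?case by (rule mon)
  next
    case (combine c f g)
    show ?case
      by (rule real_polynomial_function.intros(3)[OF real_polynomial_function.intros(4)[OF real_polynomial_function.intros(2) combine(1)] combine(2)])
  qed
  then have "real_polynomial_function p" by (simp add: p_def)
  then obtain a n where p: "p = (\<lambda>t. \<Sum>i\<le>n. a i * t ^ i)" using real_polynomial_function_imp_sum by blast
  define s where "s = r / (norm (x - z) + 1)"
  have s: "s > 0" using r by (simp add: s_def add_nonneg_pos)
  have p0: "p t = 0" if "\<bar>t\<bar> < s" for t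
  proof -
    have "\<bar>t\<bar> * norm (x - z) \<le> \<bar>t\<bar> * (norm (x - z) + 1)" by (simp add: mult_left_mono)
    also have "\<dots> < s * (norm (x - z) + 1)" using that by (intro mult_strict_right_mono) (auto simp: add_nonneg_pos)
    also have "\<dots> = r"
    proof -
      have "norm (x - z) + 1 \<noteq> 0" using norm_ge_zero[of "x - z"] by linarith
      then show ?thesis unfolding s_def by simp
    qed
    finally show ?thesis unfolding p_def by (intro z) (simp add: dist_norm)
  qed
  have "{-s<..<s} \<subseteq> {t. (\<Sum>i\<le>n. a i * t ^ i) = 0}"
  proof
    fix t assume "t \<in> {-s<..<s}"
    then have "p t = 0" by (intro p0) (simp add: abs_less_iff)
    then show "t \<in> {t. (\<Sum>i\<le>n. a i * t ^ i) = 0}" by (simp only: p mem_Collect_eq)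
  qed
  moreover have "infinite {-s<..<s}" using s by (intro infinite_Ioo) simp
  ultimately have "infinite {t. (\<Sum>i\<le>n. a i * t ^ i) = 0}" by (rule infinite_super)
  then have "\<not> (\<exists>i\<le>n. a i \<noteq> 0)" by (simp only: Transcendental.polyfun_finite_roots[of a n] simp_thms)
  then have "\<forall>i\<le>n. a i = 0" by simp
  then have "p 1 = 0" unfolding p by simp
  then show ?thesis by (simp add: p_def)
qed

lemma polys_continuous: "f \<in> polys d \<Longrightarrow> continuous_on S f"
  using polys_taylor2 taylor2_imp_continuous continuous_at_imp_continuous_on by metis

text \<open>Let k = r^2 - |x - z|^2, which vanishes on the sphere. The map q -> L(k q) is an
  endomorphism of the polynomials of degree at most d, injective by the maximum principle and hence
  onto. So any polynomial p can be corrected to h = p - k q with L h = b and the same values on the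
  sphere; Stone-Weierstrass supplies p close to g. Only the positive trace of L enters, so
  degenerate operators are covered.\<close>

lemma dirichlet_polynomial:
  fixes g :: "'a::euclidean_space \<Rightarrow> real"
  assumes nn: "nonneg_weights xs" and xs: "qsum xs (\<bullet>) > 0" and r: "r > 0"
    and g: "continuous_on (sphere z r) g" and e: "e > 0"
  obtains h where "\<And>x. x \<in> sphere z r \<Longrightarrow> \<bar>h x - g x\<bar> < e" "continuous_on UNIV h"
    "\<And>x. \<exists>l B. taylor2 h x l B \<and> qsum xs B = b"
proof -
  obtain p where "real_polynomial_function p" and pg: "\<And>x. x \<in> sphere z r \<Longrightarrow> \<bar>g x - p x\<bar> < e"
    using Stone_Weierstrass_real_polynomial_function[OF compact_sphere g e] by blast
  then obtain d0 where d0: "d0 \<ge> 0" "p \<in> polys d0" using real_polynomial_function_in_polys by blast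
  define d where "d = d0"
  have pd: "p \<in> polys (d + 2)" using polys_mono[OF _ d0(2)] by (simp add: d_def)
  define k where "k = (\<lambda>x. r^2 - (x - z) \<bullet> (x - z))"
  have k: "k \<in> polys 2"
  proof -
    have c: "(\<lambda>x. x \<bullet> v) \<in> polys 2" for v :: 'a
      by (rule polys_mono[OF _ polys_linear]) (auto simp: linear_iff inner_simps)
    have cc: "(\<lambda>x. (x \<bullet> v) * (x \<bullet> v)) \<in> polys 2" for v :: 'a
      using polys_mult[OF polys_linear polys_linear, of "\<lambda>x. x \<bullet> v" "\<lambda>x. x \<bullet> v"] by (auto simp: linear_iff inner_simps)
    have "k = (\<lambda>x. (r^2 - z \<bullet> z) + (2 * (x \<bullet> z) - (\<Sum>b\<in>Basis. (x \<bullet> b) * (x \<bullet> b))))"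
      by (auto simp: k_def fun_eq_iff euclidean_inner[of x x for x, symmetric] inner_simps inner_commute)
    also have "\<dots> \<in> polys 2"
      by (intro polys_add polys_diff polys_const polys_sum polys_scale c cc) auto
    finally show ?thesis .
  qed
  define T where "T = (\<lambda>q. Lop xs (\<lambda>x. k x * q x))"
  have kq: "(\<lambda>x. k x * q x) \<in> polys (d + 2)" if "q \<in> polys d" for q
    using polys_mult[OF k that] by (simp add: add.commute)
  have "\<exists>q\<in>fs.span (monomials d). T q = (\<lambda>x. Lop xs p x - b)"
  proof (rule linear_injective_on_span_surj[OF finite_monomials], unfold polys_def[symmetric])
    show "T f \<in> polys d" if "f \<in> polys d" for f
      using Lop_polys(1)[OF kq[OF that], of xs] by (simp add: T_def)
    show "T (\<lambda>x. a * f x + c * g x) = (\<lambda>x. a * T f x + c * T g x)" if "f \<in> polys d" "g \<in> polys d" for f g a c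
    proof
      fix x
      have "(\<lambda>x. k x * (a * f x + c * g x)) = (\<lambda>x. a * (k x * f x) + c * (k x * g x))"
        by (auto simp: algebra_simps)
      then show "T (\<lambda>x. a * f x + c * g x) x = a * T f x + c * T g x"
        unfolding T_def using Lop_combine[OF kq[OF that(1)] kq[OF that(2)], of xs a c x] by simp
    qed
    show "(\<lambda>x. Lop xs p x - b) \<in> polys d"
      using Lop_polys(1)[OF pd, of xs] d0 by (intro polys_diff polys_const) (auto simp: d_def)
    fix q :: "'a \<Rightarrow> real" assume q: "q \<in> polys d" and T0: "T q = 0"
    define F where "F = (\<lambda>x. k x * q x)"
    have F: "F \<in> polys (d + 2)" using kq[OF q] by (simp add: F_def)
    have L0: "\<exists>l B. taylor2 F x l B \<and> qsum xs B = 0" for x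
      using Lop_polys(2)[OF F, of x xs] T0 by (simp add: T_def F_def fun_eq_iff)
    \<comment> \<open>Used with a = 1 and a = -1: F = k q vanishes on the sphere and is annihilated
      by the operator, so it vanishes in the ball.\<close>
    have comp: "0 \<le> a * F x" if x: "x \<in> cball z r" for x a
    proof -
      have "(\<lambda>x. 0) x \<le> a * F x + 0"
      proof (rule viscosity_max_principle[OF xs _ r, where b = 0 and z = z])
        fix x :: 'a and l B assume "touch_above (\<lambda>x. 0) x l B"
        then show "0 \<le> qsum xs B"
          using taylor2_touch[OF nn taylor2_const[of 0 x], of l B] unfolding touch_above_def
          by (auto simp: qsum_zero)
      next
        fix x
        obtain l B where "taylor2 F x l B" "qsum xs B = 0" using L0 by blast
        then show "\<exists>l B. taylor2 (\<lambda>x. a * F x) x l B \<and> qsum xs B \<le> 0"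
          using taylor2_combine[of F x l B F l B a 0] qsum_combine[of xs a B 0 B] by force
      next
        show "continuous_on (cball z r) (\<lambda>x. a * F x)"
          by (rule continuous_on_mult_left[OF polys_continuous[OF F]])
        fix x assume "x \<in> sphere z r"
        then have "k x = 0" by (simp add: k_def power2_norm_eq_inner[symmetric] dist_norm norm_minus_commute)
        then show "0 \<le> a * F x + 0" by (simp add: F_def)
      qed (use x in auto)
      then show ?thesis by simp
    qed
    have "q x = 0" if x: "x \<in> ball z r" for x
    proof -
      have "F x = 0" using comp[of x 1] comp[of x "-1"] x by simp
      moreover have "k x > 0"
        using x by (simp add: k_def power2_norm_eq_inner[symmetric] dist_norm norm_minus_commute power_strict_mono)
      ultimately show ?thesis by (simp add: F_def)
    qed
    then show "q = 0" using polys_vanish[OF q r] by (auto simp: fun_eq_iff)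
  qed
  then obtain q where q: "q \<in> polys d" "T q = (\<lambda>x. Lop xs p x - b)" by (auto simp: polys_def)
  define h where "h = (\<lambda>x. 1 * p x + (-1) * (k x * q x))"
  have hd: "h \<in> polys (d + 2)" unfolding h_def by (intro polys_add polys_scale pd kq q)
  show ?thesis
  proof
    show "\<bar>h x - g x\<bar> < e" if "x \<in> sphere z r" for x
    proof -
      have "k x = 0" using that by (simp add: k_def power2_norm_eq_inner[symmetric] dist_norm norm_minus_commute)
      then show ?thesis using pg[OF that] by (simp add: h_def abs_minus_commute)
    qed
    show "continuous_on UNIV h" by (rule polys_continuous[OF hd])
    fix x
    have "Lop xs h x = 1 * Lop xs p x + (-1) * T q x"
      using Lop_combine[OF pd kq[OF q(1)], of xs 1 "-1" x] by (simp only: h_def T_def)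
    also have "\<dots> = b" unfolding q(2) by simp
    finally have "Lop xs h x = b" .
    then show "\<exists>l B. taylor2 h x l B \<and> qsum xs B = b" using Lop_polys(2)[OF hd, of x xs] by (simp only:)
  qed
qed

section \<open>Mollification\<close>

text \<open>The positive part of t, cubed, has a Lipschitz second derivative, so the remainder stays
  cubic across the kink at 0.\<close>

lemma cube_pos_part_taylor:
  fixes t u :: real
  shows "\<bar>max 0 (t + u) ^ 3 - max 0 t ^ 3 - 3 * max 0 t ^ 2 * u - 3 * max 0 t * u ^ 2\<bar> \<le> \<bar>u\<bar> ^ 3"
proof -
  consider "t \<ge> 0" "t + u \<ge> 0" | "t \<ge> 0" "t + u < 0" | "t < 0" "t + u \<ge> 0" | "t < 0" "t + u < 0" by linarith
  then show ?thesis
  proof cases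
    case 1
    have "(t + u) ^ 3 - t ^ 3 - 3 * t ^ 2 * u - 3 * t * u ^ 2 = u ^ 3"
      by (simp add: power3_eq_cube power2_eq_square algebra_simps)
    then show ?thesis using 1 by (simp add: max_def power_abs)
  next
    case 2
    have "- (t ^ 3) - 3 * t ^ 2 * u - 3 * t * u ^ 2 = (- (t + u)) ^ 3 - (- u) ^ 3"
      by (simp add: power3_eq_cube power2_eq_square algebra_simps)
    moreover have "0 \<le> (- (t + u)) ^ 3" "(- (t + u)) ^ 3 \<le> (- u) ^ 3"
      using 2 by (intro zero_le_power power_mono; linarith)+
    moreover have "\<bar>u\<bar> = - u" using 2 by linarith
    ultimately show ?thesis using 2 by (simp add: max_def)
  next
    case 3
    then have "(t + u) ^ 3 \<le> \<bar>u\<bar> ^ 3" by (intro power_mono) auto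
    then show ?thesis using 3 by (simp add: max_def)
  next
    case 4 then show ?thesis by (simp add: max_def)
  qed
qed

text \<open>The cube is the smallest power for which the kernel is C^2. \<open>bump'\<close> and
  \<open>bump''\<close> below are the derivatives of the cubed positive part at m^2 - |s|^2; they
  are not derivatives in s.\<close>

definition bump :: "real \<Rightarrow> 'a::euclidean_space \<Rightarrow> real" where
  "bump m s = max 0 (m\<^sup>2 - s \<bullet> s) ^ 3"

definition bump' :: "real \<Rightarrow> 'a::euclidean_space \<Rightarrow> real" where
  "bump' m s = 3 * max 0 (m\<^sup>2 - s \<bullet> s) ^ 2"

definition bump'' :: "real \<Rightarrow> 'a::euclidean_space \<Rightarrow> real" where
  "bump'' m s = 6 * max 0 (m\<^sup>2 - s \<bullet> s)"

text \<open>Replacing s by s - h changes m^2 - |s|^2 by u = 2 s.h - |h|^2. In the expansion in u,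
  everything beyond 4 (s.h)^2 in u^2 is already of third order in h. The bound is uniform in s, as
  needed under the integral.\<close>

lemma bump_taylor:
  fixes s h :: "'a::euclidean_space"
  assumes s: "norm s \<le> M" and h: "norm h \<le> 1"
  shows "\<bar>bump m (s - h) - bump m s - bump' m s * (2 * (s \<bullet> h))
      - (bump'' m s * 4 * ((s \<bullet> h) * (s \<bullet> h)) - 2 * bump' m s * (h \<bullet> h)) / 2\<bar>
    \<le> ((2 * M + 1) ^ 3 + 3 * m\<^sup>2 * (4 * M + 1)) * norm h ^ 3"
proof -
  define t u p where "t = m\<^sup>2 - s \<bullet> s" and "u = 2 * (s \<bullet> h) - h \<bullet> h" and "p = max 0 t"
  have M: "M \<ge> 0" using s norm_ge_zero[of s] by linarith
  have hh: "h \<bullet> h = norm h * norm h" by (simp add: power2_norm_eq_inner[symmetric] power2_eq_square)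
  have sh: "\<bar>s \<bullet> h\<bar> \<le> M * norm h"
    using Cauchy_Schwarz_ineq2[of s h] s by (meson mult_right_mono norm_ge_zero order_trans)
  have hh1: "h \<bullet> h \<le> norm h" unfolding hh using h by (simp add: mult_left_le_one_le)
  have u: "\<bar>u\<bar> \<le> (2 * M + 1) * norm h"
  proof -
    have "\<bar>u\<bar> \<le> 2 * \<bar>s \<bullet> h\<bar> + h \<bullet> h" unfolding u_def using inner_ge_zero[of h] by linarith
    also have "\<dots> \<le> 2 * (M * norm h) + norm h" using sh hh1 by linarith
    finally show ?thesis by (simp add: algebra_simps)
  qed
  have tu: "m\<^sup>2 - (s - h) \<bullet> (s - h) = t + u" by (simp add: t_def u_def inner_simps inner_commute)
  have p: "0 \<le> p" "p \<le> m\<^sup>2" by (auto simp: p_def t_def)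
  have R: "\<bar>max 0 (t + u) ^ 3 - p ^ 3 - 3 * p ^ 2 * u - 3 * p * u ^ 2\<bar> \<le> (2 * M + 1) ^ 3 * norm h ^ 3"
    using cube_pos_part_taylor[of t u] power_mono[OF u, of 3] by (simp add: p_def power_mult_distrib)
  have u2: "u ^ 2 = 4 * ((s \<bullet> h) * (s \<bullet> h)) - 4 * (s \<bullet> h) * (h \<bullet> h) + (h \<bullet> h) ^ 2"
    unfolding u_def by (simp add: power2_eq_square algebra_simps)
  have E: "\<bar>(h \<bullet> h) ^ 2 - 4 * (s \<bullet> h) * (h \<bullet> h)\<bar> \<le> (4 * M + 1) * norm h ^ 3"
  proof -
    have "\<bar>(s \<bullet> h) * (h \<bullet> h)\<bar> \<le> (M * norm h) * (norm h * norm h)"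
      unfolding abs_mult hh using sh by (intro mult_mono) auto
    moreover have "(h \<bullet> h) ^ 2 \<le> norm h ^ 3"
    proof -
      have "(h \<bullet> h) ^ 2 = norm h ^ 4" unfolding hh by (simp add: power2_eq_square eval_nat_numeral)
      also have "\<dots> \<le> norm h ^ 3" using h by (intro power_decreasing) auto
      finally show ?thesis .
    qed
    moreover have "\<bar>a ^ 2 - 4 * (s \<bullet> h) * a\<bar> \<le> (4 * M + 1) * y"
      if "\<bar>(s \<bullet> h) * a\<bar> \<le> M * y" "a ^ 2 \<le> y" for a y
    proof -
      have "\<bar>a ^ 2 - 4 * (s \<bullet> h) * a\<bar> \<le> a ^ 2 + 4 * \<bar>(s \<bullet> h) * a\<bar>"
        using zero_le_power2[of a] unfolding mult.assoc by linarith
      also have "\<dots> \<le> y + 4 * (M * y)" using that by linarith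
      finally show ?thesis by (simp add: algebra_simps)
    qed
    ultimately show ?thesis by (simp add: power3_eq_cube)
  qed
  have E3: "\<bar>3 * p * ((h \<bullet> h) ^ 2 - 4 * (s \<bullet> h) * (h \<bullet> h))\<bar> \<le> 3 * m\<^sup>2 * ((4 * M + 1) * norm h ^ 3)"
    unfolding abs_mult[of "3 * p"] using p by (intro mult_mono E) auto
  have "bump m (s - h) - bump m s - bump' m s * (2 * (s \<bullet> h))
      - (bump'' m s * 4 * ((s \<bullet> h) * (s \<bullet> h)) - 2 * bump' m s * (h \<bullet> h)) / 2
    = (max 0 (t + u) ^ 3 - p ^ 3 - 3 * p ^ 2 * u - 3 * p * u ^ 2)
      + 3 * p * ((h \<bullet> h) ^ 2 - 4 * (s \<bullet> h) * (h \<bullet> h))"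
    unfolding bump_def bump'_def bump''_def tu t_def[symmetric] p_def[symmetric] u2
    unfolding u_def by (simp add: field_simps)
  also have "\<bar>\<dots>\<bar> \<le> (2 * M + 1) ^ 3 * norm h ^ 3 + 3 * m\<^sup>2 * ((4 * M + 1) * norm h ^ 3)"
    using R E3 by linarith
  finally show ?thesis by (simp add: algebra_simps)
qed

lemma continuous_bump: "continuous_on S (bump m)" "continuous_on S (bump' m)" "continuous_on S (bump'' m)"
  unfolding bump_def[abs_def] bump'_def[abs_def] bump''_def[abs_def] by (intro continuous_intros)+

lemma bump_nonneg: "bump m s \<ge> 0" by (simp add: bump_def)

abbreviation sbox :: "real \<Rightarrow> 'a::euclidean_space set" where
  "sbox m \<equiv> cbox (- (m *\<^sub>R One)) (m *\<^sub>R One)"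

lemma norm_sbox:
  fixes m :: real
  assumes "x \<in> sbox m" shows "norm (x :: 'a::euclidean_space) \<le> DIM('a) * m"
proof -
  have "norm x \<le> (\<Sum>b\<in>Basis. \<bar>x \<bullet> b\<bar>)" by (rule norm_le_l1)
  also have "\<dots> \<le> (\<Sum>b\<in>(Basis::'a set). m)"
    using assms by (intro sum_mono) (auto simp: mem_box inner_simps abs_le_iff)
  finally show ?thesis by simp
qed

lemma bump_outside:
  assumes m: "m > 0" and x: "x \<notin> sbox m" shows "bump m (x :: 'a::euclidean_space) = 0"
proof -
  obtain b where b: "b \<in> Basis" "m < \<bar>x \<bullet> b\<bar>" using x by (auto simp: mem_box inner_simps)
  then have "m < norm x" using Basis_le_norm[OF b(1), of x] by linarith
  then have "m\<^sup>2 < (norm x)\<^sup>2" using m by (intro power_strict_mono) auto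
  then show ?thesis by (simp add: bump_def power2_norm_eq_inner)
qed

lemma bump_integral_pos:
  assumes m: "m > 0" shows "integral (sbox m) (bump m :: 'a::euclidean_space \<Rightarrow> real) > 0"
proof -
  have int: "bump m integrable_on (sbox m :: 'a set)" by (intro integrable_continuous continuous_bump)
  have "integral (sbox m) (bump m :: 'a \<Rightarrow> real) \<noteq> 0"
  proof
    assume "integral (sbox m) (bump m :: 'a \<Rightarrow> real) = 0"
    then have "(bump m has_integral 0) (sbox m :: 'a set)" using int by (metis integrable_integral)
    moreover have "(0::'a) \<in> sbox m" using m by (simp add: mem_box inner_simps)
    moreover have "box (- (m *\<^sub>R One)) (m *\<^sub>R One) \<noteq> ({} :: 'a set)" using m by (simp add: box_ne_empty inner_simps)
    ultimately have "bump m (0::'a) = 0"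
      by (intro has_integral_0_cbox_imp_0[of "- (m *\<^sub>R One)" "m *\<^sub>R One" "bump m"]) (auto simp: continuous_bump bump_nonneg)
    then show False using m by (simp add: bump_def)
  qed
  moreover have "integral (sbox m) (bump m :: 'a \<Rightarrow> real) \<ge> 0"
    by (intro integral_nonneg int bump_nonneg)
  ultimately show ?thesis by linarith
qed

definition mollify :: "real \<Rightarrow> ('a::euclidean_space \<Rightarrow> real) \<Rightarrow> 'a \<Rightarrow> real" where
  "mollify m w x = integral (sbox m) (\<lambda>s. w (x + s) * bump m s) / integral (sbox m) (bump m :: 'a \<Rightarrow> real)"

lemma linear_integral_inner:
  assumes "continuous_on (cbox a b) c"
  shows "linear (\<lambda>h. integral (cbox a b) (\<lambda>s. c s * (s \<bullet> h)) :: real)"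
  unfolding linear_iff
proof (intro conjI allI)
  have int: "(\<lambda>s. c s * (s \<bullet> h)) integrable_on cbox a b" for h
    by (intro integrable_continuous continuous_intros assms)
  fix x y and k :: real
  show "integral (cbox a b) (\<lambda>s. c s * (s \<bullet> (x + y))) = integral (cbox a b) (\<lambda>s. c s * (s \<bullet> x)) + integral (cbox a b) (\<lambda>s. c s * (s \<bullet> y))"
    using integral_add[OF int int, of x y] by (simp add: inner_simps algebra_simps)
  show "integral (cbox a b) (\<lambda>s. c s * (s \<bullet> (k *\<^sub>R x))) = k *\<^sub>R integral (cbox a b) (\<lambda>s. c s * (s \<bullet> x))"
    using integral_mult_right[where c = k and f = "\<lambda>s. c s * (s \<bullet> x)" and S = "cbox a b"]
    by (simp add: algebra_simps)
qed

lemma bilinear_integral_inner: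
  assumes c: "continuous_on (cbox a b) c" and d: "continuous_on (cbox a b) d"
  shows "bilinear (\<lambda>u v. integral (cbox a b) (\<lambda>s. c s * ((s \<bullet> u) * (s \<bullet> v)) + d s * (u \<bullet> v)) :: real)"
  unfolding bilinear_def linear_iff
proof (intro conjI allI)
  have int: "(\<lambda>s. c s * ((s \<bullet> u) * (s \<bullet> v)) + d s * (u \<bullet> v)) integrable_on cbox a b" for u v
    by (intro integrable_continuous continuous_intros c d)
  fix x y z and k :: real
  show "integral (cbox a b) (\<lambda>s. c s * ((s \<bullet> x) * (s \<bullet> (y + z))) + d s * (x \<bullet> (y + z)))
    = integral (cbox a b) (\<lambda>s. c s * ((s \<bullet> x) * (s \<bullet> y)) + d s * (x \<bullet> y)) + integral (cbox a b) (\<lambda>s. c s * ((s \<bullet> x) * (s \<bullet> z)) + d s * (x \<bullet> z))"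
    using integral_add[OF int int, of x y x z] by (simp add: inner_simps algebra_simps)
  show "integral (cbox a b) (\<lambda>s. c s * ((s \<bullet> (y + z)) * (s \<bullet> x)) + d s * ((y + z) \<bullet> x))
    = integral (cbox a b) (\<lambda>s. c s * ((s \<bullet> y) * (s \<bullet> x)) + d s * (y \<bullet> x)) + integral (cbox a b) (\<lambda>s. c s * ((s \<bullet> z) * (s \<bullet> x)) + d s * (z \<bullet> x))"
    using integral_add[OF int int, of y x z x] by (simp add: inner_simps algebra_simps)
  have s: "integral (cbox a b) (\<lambda>s. k * (c s * ((s \<bullet> u) * (s \<bullet> v)) + d s * (u \<bullet> v)))
      = k * integral (cbox a b) (\<lambda>s. c s * ((s \<bullet> u) * (s \<bullet> v)) + d s * (u \<bullet> v))" for u v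
    by (rule integral_mult_right)
  show "integral (cbox a b) (\<lambda>s. c s * ((s \<bullet> x) * (s \<bullet> (k *\<^sub>R y))) + d s * (x \<bullet> (k *\<^sub>R y)))
    = k *\<^sub>R integral (cbox a b) (\<lambda>s. c s * ((s \<bullet> x) * (s \<bullet> y)) + d s * (x \<bullet> y))"
    using s[of x y] by (simp add: algebra_simps)
  show "integral (cbox a b) (\<lambda>s. c s * ((s \<bullet> (k *\<^sub>R y)) * (s \<bullet> x)) + d s * ((k *\<^sub>R y) \<bullet> x))
    = k *\<^sub>R integral (cbox a b) (\<lambda>s. c s * ((s \<bullet> y) * (s \<bullet> x)) + d s * (y \<bullet> x))"
    using s[of y x] by (simp add: algebra_simps)
qed

lemma continuous_translate:
  "continuous_on UNIV w \<Longrightarrow> continuous_on S (\<lambda>s. w (z + s :: 'a::real_normed_vector) :: real)"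
  by (rule continuous_on_compose2[of UNIV w]) (auto intro!: continuous_intros)

lemma continuous_bump_diff: "continuous_on S (\<lambda>s. bump m (s - h))"
  by (rule continuous_on_compose2[OF continuous_bump(1)[of UNIV]]) (auto intro!: continuous_intros)

text \<open>After the substitution y = s + h the displacement h sits only in the kernel, which is
  expanded under the integral sign; continuity of w suffices.\<close>

lemma mollify_taylor2:
  fixes w :: "'a::euclidean_space \<Rightarrow> real"
  assumes w: "continuous_on UNIV w" and m: "m > 0"
  shows "\<exists>l B. taylor2 (mollify m w) z l B"
proof -
  define C0 where "C0 = integral (sbox m) (bump m :: 'a \<Rightarrow> real)"
  have C0: "C0 > 0" unfolding C0_def by (rule bump_integral_pos[OF m])
  define a where "a = (\<lambda>s. 2 * (w (z + s) * bump' m s))"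
  define c where "c = (\<lambda>s. 4 * (w (z + s) * bump'' m s))"
  define d where "d = (\<lambda>s. - 2 * (w (z + s) * bump' m s))"
  note wc = continuous_translate[OF w]
  have cont: "continuous_on S a" "continuous_on S c" "continuous_on S d" for S
    unfolding a_def c_def d_def by (intro continuous_intros wc continuous_bump)+
  \<comment> \<open>The enlarged box contains the translated supports of the kernel for all |h| <=
    1, so a single domain of integration serves every h.\<close>
  let ?b = "sbox (m + 1) :: 'a set"
  define l where "l = (\<lambda>h. integral ?b (\<lambda>s. a s * (s \<bullet> h)))"
  define B where "B = (\<lambda>u v. integral ?b (\<lambda>s. c s * ((s \<bullet> u) * (s \<bullet> v)) + d s * (u \<bullet> v)))"
  have lB: "linear l" "bilinear B" unfolding l_def B_def
    by (intro linear_integral_inner bilinear_integral_inner cont)+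
  have shift: "C0 * mollify m w (z + h) = integral ?b (\<lambda>s. w (z + s) * bump m (s - h))" if h: "norm h \<le> 1" for h
  proof -
    have box: "x - h \<in> sbox m \<Longrightarrow> x \<in> ?b" for x
    proof -
      assume x: "x - h \<in> sbox m"
      have "\<bar>h \<bullet> b\<bar> \<le> 1" if "b \<in> Basis" for b using Basis_le_norm[OF that, of h] h by linarith
      then show "x \<in> ?b" using x by (force simp: mem_box inner_simps)
    qed
    have mem: "x - h \<in> sbox m \<longleftrightarrow> x \<in> cbox (- (m *\<^sub>R One) + h) (m *\<^sub>R One + h)" for x
      unfolding mem_box by (intro ball_cong refl) (auto simp: inner_simps)
    have sub: "cbox (- (m *\<^sub>R One) + h) (m *\<^sub>R One + h) \<subseteq> ?b"
    proof
      fix x assume "x \<in> cbox (- (m *\<^sub>R One) + h) (m *\<^sub>R One + h)"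
      then show "x \<in> ?b" by (intro box) (simp only: mem)
    qed
    have "C0 * mollify m w (z + h) = integral (sbox m) ((\<lambda>y. w (z + y) * bump m (y - h)) \<circ> (+) h)"
      using C0 by (simp add: mollify_def C0_def[symmetric] o_def add.assoc)
    also have "\<dots> = integral (cbox (- (m *\<^sub>R One) + h) (m *\<^sub>R One + h)) (\<lambda>y. w (z + y) * bump m (y - h))"
      by (rule integral_shift_cbox_plus)
    also have "\<dots> = integral ?b (\<lambda>s. w (z + s) * bump m (s - h))"
    proof (rule integral_unique[symmetric], rule has_integral_on_superset[OF _ _ sub])
      show "((\<lambda>s. w (z + s) * bump m (s - h)) has_integral
        integral (cbox (- (m *\<^sub>R One) + h) (m *\<^sub>R One + h)) (\<lambda>y. w (z + y) * bump m (y - h))) (cbox (- (m *\<^sub>R One) + h) (m *\<^sub>R One + h))"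
        by (intro integrable_integral integrable_continuous continuous_intros wc continuous_bump_diff)
      fix x assume "x \<notin> cbox (- (m *\<^sub>R One) + h) (m *\<^sub>R One + h)"
      then have "x - h \<notin> sbox m" by (simp only: mem simp_thms)
      then show "w (z + x) * bump m (x - h) = 0" using bump_outside[OF m] by auto
    qed
    finally show ?thesis .
  qed
  define M where "M = DIM('a) * (m + 1)"
  define K where "K = (2 * M + 1) ^ 3 + 3 * m\<^sup>2 * (4 * M + 1)"
  define J where "J = integral ?b (\<lambda>s. \<bar>w (z + s)\<bar>)"
  have M0: "M \<ge> 0" using m by (simp add: M_def)
  have K0: "K \<ge> 0" using M0 by (simp add: K_def)
  have J0: "J \<ge> 0" unfolding J_def
    by (intro integral_nonneg integrable_continuous continuous_intros wc) auto
  have est: "\<bar>C0 * mollify m w (z + h) - C0 * mollify m w z - l h - B h h / 2\<bar> \<le> K * J * norm h ^ 3"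
    if h: "norm h \<le> 1" for h
  proof -
    have i1: "(\<lambda>s. w (z + s) * bump m (s - h)) integrable_on ?b" "(\<lambda>s. w (z + s) * bump m (s - 0)) integrable_on ?b"
      "(\<lambda>s. a s * (s \<bullet> h)) integrable_on ?b" "(\<lambda>s. (c s * ((s \<bullet> h) * (s \<bullet> h)) + d s * (h \<bullet> h)) / 2) integrable_on ?b"
      by (intro integrable_continuous continuous_intros wc continuous_bump_diff cont; simp)+
    have B2: "B h h / 2 = integral ?b (\<lambda>s. (c s * ((s \<bullet> h) * (s \<bullet> h)) + d s * (h \<bullet> h)) / 2)"
      unfolding B_def by simp
    have eq: "C0 * mollify m w (z + h) - C0 * mollify m w z - l h - B h h / 2
      = integral ?b (\<lambda>s. w (z + s) * bump m (s - h) - w (z + s) * bump m (s - 0) - a s * (s \<bullet> h)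
          - (c s * ((s \<bullet> h) * (s \<bullet> h)) + d s * (h \<bullet> h)) / 2)"
      unfolding l_def B2 shift[OF h] using shift[of 0]
      by (simp add: integral_diff i1[simplified] integrable_diff)
    have "norm (C0 * mollify m w (z + h) - C0 * mollify m w z - l h - B h h / 2)
      \<le> integral ?b (\<lambda>s. \<bar>w (z + s)\<bar> * (K * norm h ^ 3))"
      unfolding eq
    proof (rule integral_norm_bound_integral)
      fix s :: 'a assume "s \<in> ?b"
      then have s: "norm s \<le> M" using norm_sbox[of s "m + 1"] by (simp add: M_def)
      have "w (z + s) * bump m (s - h) - w (z + s) * bump m (s - 0) - a s * (s \<bullet> h)
          - (c s * ((s \<bullet> h) * (s \<bullet> h)) + d s * (h \<bullet> h)) / 2
        = w (z + s) * (bump m (s - h) - bump m s - bump' m s * (2 * (s \<bullet> h))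
      - (bump'' m s * 4 * ((s \<bullet> h) * (s \<bullet> h)) - 2 * bump' m s * (h \<bullet> h)) / 2)"
        by (simp add: a_def c_def d_def algebra_simps diff_divide_distrib add_divide_distrib)
      also have "norm \<dots> \<le> \<bar>w (z + s)\<bar> * (K * norm h ^ 3)"
        unfolding real_norm_def abs_mult[of "w (z + s)"] K_def
        using bump_taylor[OF s h, of m] by (intro mult_left_mono) auto
      finally show "norm (w (z + s) * bump m (s - h) - w (z + s) * bump m (s - 0) - a s * (s \<bullet> h)
          - (c s * ((s \<bullet> h) * (s \<bullet> h)) + d s * (h \<bullet> h)) / 2) \<le> \<bar>w (z + s)\<bar> * (K * norm h ^ 3)" .
    next
      show "(\<lambda>s. w (z + s) * bump m (s - h) - w (z + s) * bump m (s - 0) - a s * (s \<bullet> h)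
          - (c s * ((s \<bullet> h) * (s \<bullet> h)) + d s * (h \<bullet> h)) / 2) integrable_on ?b"
        by (intro integrable_diff i1)
      show "(\<lambda>s. \<bar>w (z + s)\<bar> * (K * norm h ^ 3)) integrable_on ?b"
        by (intro integrable_continuous continuous_on_mult_right continuous_on_rabs wc)
    qed
    also have "\<dots> = J * (K * norm h ^ 3)" unfolding J_def by (rule integral_mult_left)
    finally show ?thesis by (simp only: real_norm_def mult.assoc mult.left_commute[of J])
  qed
  have "taylor2 (mollify m w) z (\<lambda>h. (1 / C0) * l h + 0 * l h) (\<lambda>u v. (1 / C0) * B u v + 0 * B u v)"
    unfolding taylor2_def
  proof (intro conjI linear_scale_combine bilinear_scale_combine lB allI impI)
    fix e :: real assume e: "e > 0"
    define \<delta> where "\<delta> = min 1 (e * C0 / (K * J + 1))"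
    have KJ: "K * J \<ge> 0" using K0 J0 by simp
    show "\<exists>d>0. \<forall>h. norm h < d \<longrightarrow> \<bar>mollify m w (z + h) - mollify m w z - ((1 / C0) * l h + 0 * l h)
        - ((1 / C0) * B h h + 0 * B h h) / 2\<bar> \<le> e * (norm h)\<^sup>2"
    proof (intro exI conjI allI impI)
      show "\<delta> > 0" using e C0 KJ by (simp add: \<delta>_def)
      fix h :: 'a assume h: "norm h < \<delta>"
      have "(K * J) * norm h \<le> (K * J + 1) * (e * C0 / (K * J + 1))"
        using h KJ by (intro mult_mono) (auto simp: \<delta>_def)
      also have "\<dots> = e * C0" using KJ by simp
      finally have 1: "(K * J) * norm h \<le> e * C0" .
      have "mollify m w (z + h) - mollify m w z - ((1 / C0) * l h + 0 * l h) - ((1 / C0) * B h h + 0 * B h h) / 2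
        = (C0 * mollify m w (z + h) - C0 * mollify m w z - l h - B h h / 2) / C0"
        using C0 by (simp add: diff_divide_distrib)
      also have "\<bar>\<dots>\<bar> \<le> (K * J * norm h ^ 3) / C0"
        unfolding abs_divide using est[of h] h C0 by (simp add: \<delta>_def divide_right_mono)
      also have "K * J * norm h ^ 3 = (K * J * norm h) * (norm h)\<^sup>2"
        by (simp add: power3_eq_cube power2_eq_square)
      also have "\<dots> / C0 \<le> (e * C0) * (norm h)\<^sup>2 / C0"
        using 1 C0 by (intro divide_right_mono mult_right_mono) auto
      also have "\<dots> = e * (norm h)\<^sup>2" using C0 by simp
      finally show "\<bar>mollify m w (z + h) - mollify m w z - ((1 / C0) * l h + 0 * l h)
        - ((1 / C0) * B h h + 0 * B h h) / 2\<bar> \<le> e * (norm h)\<^sup>2" .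
    qed
  qed
  then show ?thesis by blast
qed

section \<open>Mollified viscosity subsolutions\<close>

lemma touch_above_translate:
  "touch_above (\<lambda>x. w (x + s)) x l B \<Longrightarrow> touch_above w (x + s) l B"
  unfolding touch_above_def by (simp add: add.assoc add.commute[of s]) 

text \<open>Each piece of a fine tagged division receives as weight the exact integral of the kernel
  over it, so that the weights sum to 1 exactly; only w is replaced by its value at the tag.\<close>

lemma mollify_finite_average:
  fixes w :: "'a::euclidean_space \<Rightarrow> real" and m :: real
  assumes w: "continuous_on UNIV w" and m: "m > 0" and e: "e > 0"
  obtains I :: "('a \<times> 'a set) set" and c s where "finite I" "\<And>i. i \<in> I \<Longrightarrow> c i \<ge> 0" "(\<Sum>i\<in>I. c i) = 1"
    "\<And>i. i \<in> I \<Longrightarrow> norm (s i) \<le> DIM('a) * m"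
    "\<And>x. x \<in> cball z r \<Longrightarrow> \<bar>mollify m w x - (\<Sum>i\<in>I. c i * w (x + s i))\<bar> \<le> e"
proof -
  define C0 where "C0 = integral (sbox m) (bump m :: 'a \<Rightarrow> real)"
  have C0: "C0 > 0" unfolding C0_def by (rule bump_integral_pos[OF m])
  let ?R = "r + DIM('a) * m"
  have "uniformly_continuous_on (cball z ?R) w"
    by (intro compact_uniformly_continuous continuous_on_subset[OF w]) auto
  then obtain d where d: "d > 0" "\<And>x y. x \<in> cball z ?R \<Longrightarrow> y \<in> cball z ?R \<Longrightarrow> dist y x < d \<Longrightarrow> dist (w y) (w x) < e"
    using e unfolding uniformly_continuous_on_def by metis
  obtain p where p: "p tagged_division_of (sbox m :: 'a set)" "(\<lambda>x. ball x d) fine p"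
    using fine_division_exists[OF gauge_ball[OF d(1)]] by blast
  have fin: "finite p" using p(1) by (rule tagged_division_of_finite)
  define c where "c = (\<lambda>i::'a \<times> 'a set. integral (snd i) (bump m) / C0)"
  have bint: "bump m integrable_on (sbox m :: 'a set)" by (intro integrable_continuous continuous_bump)
  have tag: "fst i \<in> sbox m" "snd i \<subseteq> sbox m" "fst i \<in> snd i" "\<exists>a b. snd i = cbox a b" "snd i \<subseteq> ball (fst i) d"
    if "i \<in> p" for i
    using that tagged_division_ofD(2,3,4)[OF p(1), of "fst i" "snd i"] fineD[OF p(2), of "fst i" "snd i"] by auto
  show ?thesis
  proof
    show "finite p" by (rule fin)
    show "c i \<ge> 0" if "i \<in> p" for i
      using tag(4)[OF that] C0 unfolding c_def
      by (auto intro!: divide_nonneg_pos integral_nonneg integrable_continuous continuous_bump bump_nonneg)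
    have "(\<Sum>i\<in>p. integral (snd i) (bump m)) = C0"
      unfolding C0_def using integral_combine_tagged_division_topdown[OF bint p(1)]
      by (simp add: case_prod_beta)
    then show "(\<Sum>i\<in>p. c i) = 1" unfolding c_def using C0 by (simp add: sum_divide_distrib[symmetric])
    show "norm (fst i) \<le> DIM('a) * m" if "i \<in> p" for i using tag(1)[OF that] by (rule norm_sbox)
    fix x assume x: "x \<in> cball z r"
    have wint: "(\<lambda>s. w (x + s) * bump m s) integrable_on cbox a b" for a b
      by (intro integrable_continuous continuous_intros continuous_translate w continuous_bump)
    have bint': "(\<lambda>s. k * bump m s) integrable_on cbox a b" for a b :: 'a and k
      by (intro integrable_continuous continuous_on_mult_left continuous_bump)
    have inR: "x + s \<in> cball z ?R" if "s \<in> sbox m" for s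
      using norm_sbox[OF that] x norm_triangle_ineq[of "x - z" s]
      by (simp add: dist_norm norm_minus_commute[of z] algebra_simps)
    have eq1: "mollify m w x = (\<Sum>i\<in>p. integral (snd i) (\<lambda>s. w (x + s) * bump m s)) / C0"
      unfolding mollify_def C0_def[symmetric]
      using integral_combine_tagged_division_topdown[OF wint p(1), of ]
      by (simp add: case_prod_beta)
    have eq2: "mollify m w x - (\<Sum>i\<in>p. c i * w (x + fst i))
      = (\<Sum>i\<in>p. (integral (snd i) (\<lambda>s. w (x + s) * bump m s) - w (x + fst i) * integral (snd i) (bump m)) / C0)"
      unfolding eq1 by (simp add: c_def sum_divide_distrib sum_subtractf[symmetric] diff_divide_distrib mult.commute)
    have "\<bar>mollify m w x - (\<Sum>i\<in>p. c i * w (x + fst i))\<bar> \<le> (\<Sum>i\<in>p. e * c i)"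
      unfolding eq2
    proof (intro order_trans[OF sum_abs] sum_mono)
      fix i assume i: "i \<in> p"
      obtain a b where ab: "snd i = cbox a b" using tag(4)[OF i] by blast
      have eq3: "integral (snd i) (\<lambda>s. w (x + s) * bump m s) - w (x + fst i) * integral (snd i) (bump m)
        = integral (snd i) (\<lambda>s. w (x + s) * bump m s - w (x + fst i) * bump m s)"
        unfolding ab by (subst integral_diff) (auto intro: wint bint')
      have "norm (integral (snd i) (\<lambda>s. w (x + s) * bump m s) - w (x + fst i) * integral (snd i) (bump m))
        \<le> integral (snd i) (\<lambda>s. e * bump m s)"
        unfolding eq3 unfolding ab
      proof (rule integral_norm_bound_integral)
        show "(\<lambda>s. w (x + s) * bump m s - w (x + fst i) * bump m s) integrable_on cbox a b"
          by (intro integrable_diff wint bint')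
        show "(\<lambda>s. e * bump m s) integrable_on cbox a b" by (rule bint')
        fix s assume s: "s \<in> cbox a b"
        then have "s \<in> sbox m" "s \<in> ball (fst i) d" using tag(2,5)[OF i] ab by auto
        then have "dist (w (x + s)) (w (x + fst i)) < e"
          using inR tag(1)[OF i] by (intro d(2)) (auto simp: dist_commute)
        then have "\<bar>w (x + s) - w (x + fst i)\<bar> * bump m s \<le> e * bump m s"
          by (intro mult_right_mono bump_nonneg) (simp add: dist_real_def)
        then show "norm (w (x + s) * bump m s - w (x + fst i) * bump m s) \<le> e * bump m s"
          by (simp add: left_diff_distrib[symmetric] abs_mult bump_nonneg)
      qed
      also have "\<dots> = e * integral (snd i) (bump m)" by simp
      finally show "\<bar>(integral (snd i) (\<lambda>s. w (x + s) * bump m s) - w (x + fst i) * integral (snd i) (bump m)) / C0\<bar> \<le> e * c i"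
        using C0 by (simp add: c_def abs_divide divide_right_mono)
    qed
    also have "\<dots> = e" using \<open>(\<Sum>i\<in>p. c i) = 1\<close> by (simp add: sum_distrib_left[symmetric])
    finally show "\<bar>mollify m w x - (\<Sum>i\<in>p. c i * w (x + fst i))\<bar> \<le> e" .
  qed
qed

text \<open>Read off from the finite averages: their translations have length at most DIM times m,
  and w is uniformly continuous on balls.\<close>

lemma mollify_close:
  fixes w :: "'a::euclidean_space \<Rightarrow> real"
  assumes w: "continuous_on UNIV w" and e: "e > 0"
  obtains \<delta> where "\<delta> > 0" "\<And>m x. 0 < m \<Longrightarrow> m < \<delta> \<Longrightarrow> x \<in> cball z r \<Longrightarrow> \<bar>mollify m w x - w x\<bar> \<le> e"
proof -
  have "uniformly_continuous_on (cball z (r + 1)) w"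
    by (intro compact_uniformly_continuous continuous_on_subset[OF w]) auto
  then obtain d where d: "d > 0" "\<And>x y. x \<in> cball z (r + 1) \<Longrightarrow> y \<in> cball z (r + 1) \<Longrightarrow> dist y x < d \<Longrightarrow> dist (w y) (w x) < e / 2"
    using e unfolding uniformly_continuous_on_def by (metis half_gt_zero)
  have N: "real DIM('a) > 0" by simp
  show ?thesis
  proof
    show "min 1 d / (2 * DIM('a)) > 0" using d(1) N by (intro divide_pos_pos) auto
    fix m x assume m: "0 < m" "m < min 1 d / (2 * DIM('a))" and x: "x \<in> cball z r"
    have Nm: "DIM('a) * m < min 1 d"
    proof -
      have "m * (2 * DIM('a)) < min 1 d" using m(2) N by (simp add: pos_less_divide_eq)
      moreover have "DIM('a) * m > 0" using m(1) N by (rule mult_pos_pos[rotated])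
      ultimately show ?thesis by (simp add: mult.commute)
    qed
    obtain I :: "('a \<times> 'a set) set" and c s where I: "finite I" "\<And>i. i \<in> I \<Longrightarrow> c i \<ge> 0" "(\<Sum>i\<in>I. c i) = 1"
      "\<And>i. i \<in> I \<Longrightarrow> norm (s i) \<le> DIM('a) * m"
      "\<And>x. x \<in> cball z r \<Longrightarrow> \<bar>mollify m w x - (\<Sum>i\<in>I. c i * w (x + s i))\<bar> \<le> e / 2"
      by (rule mollify_finite_average[OF w m(1) half_gt_zero[OF e], of z r]) (rule that)
    have eq: "(\<Sum>i\<in>I. c i * w (x + s i)) - w x = (\<Sum>i\<in>I. c i * (w (x + s i) - w x))"
      using I(3) by (simp add: right_diff_distrib sum_subtractf sum_distrib_right[symmetric])
    have "\<bar>(\<Sum>i\<in>I. c i * w (x + s i)) - w x\<bar> \<le> (\<Sum>i\<in>I. c i * (e / 2))"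
      unfolding eq
    proof (intro order_trans[OF sum_abs] sum_mono)
      fix i assume i: "i \<in> I"
      have "dist (w (x + s i)) (w x) < e / 2"
      proof (rule d(2))
        show "x \<in> cball z (r + 1)" using x by simp
        show "x + s i \<in> cball z (r + 1)"
          using x I(4)[OF i] Nm norm_triangle_ineq[of "x - z" "s i"]
          by (simp add: dist_norm norm_minus_commute[of z] algebra_simps)
        show "dist (x + s i) x < d" using I(4)[OF i] Nm by (simp add: dist_norm)
      qed
      then show "\<bar>c i * (w (x + s i) - w x)\<bar> \<le> c i * (e / 2)"
        unfolding abs_mult using I(2)[OF i] by (intro mult_mono) (auto simp: dist_real_def)
    qed
    also have "\<dots> = (\<Sum>i\<in>I. c i) * (e / 2)" by (rule sum_distrib_right[symmetric])
    also have "\<dots> = e / 2" by (simp add: I(3))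
    finally show "\<bar>mollify m w x - w x\<bar> \<le> e" using I(5)[OF x] by linarith
  qed
qed

lemma taylor2_sum:
  assumes "finite I" "\<And>i. i \<in> I \<Longrightarrow> \<exists>l B. taylor2 (h i) x l B \<and> qsum xs B = b"
  shows "\<exists>l B. taylor2 (\<lambda>y. \<Sum>i\<in>I. c i * h i y) x l B \<and> qsum xs B = (\<Sum>i\<in>I. c i) * b"
  using assms
proof (induction I rule: finite_induct)
  case empty then show ?case using taylor2_const[of 0 x] qsum_zero by (auto intro!: exI)
next
  case (insert i I)
  obtain l B where 1: "taylor2 (h i) x l B" "qsum xs B = b" using insert by blast
  obtain m C where 2: "taylor2 (\<lambda>y. \<Sum>i\<in>I. c i * h i y) x m C" "qsum xs C = (\<Sum>i\<in>I. c i) * b"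
    using insert by auto
  have "taylor2 (\<lambda>y. \<Sum>i\<in>insert i I. c i * h i y) x (\<lambda>v. c i * l v + 1 * m v) (\<lambda>u v. c i * B u v + 1 * C u v)"
    using taylor2_combine[OF 1(1) 2(1), of "c i" 1] insert by simp
  moreover have "qsum xs (\<lambda>u v. c i * B u v + 1 * C u v) = (\<Sum>i\<in>insert i I. c i) * b"
    unfolding qsum_combine using 1(2) 2(2) insert by (simp add: algebra_simps)
  ultimately show ?case by blast
qed

text \<open>Each translate of w lies below a polynomial solution with almost the same boundary
  values, and these average to H with L H = b. If the operator at the Taylor polynomial p of W were
  smaller than b by \<theta>, then D = H - p would satisfy L D = \<theta> and its value at the
  center would lie below its boundary maximum by at least \<theta> r^2 / (2 Q). But D is almost
  nonpositive on the sphere and almost nonnegative at the center.\<close>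

lemma average_viscosity_inequality:
  fixes w W :: "'a::euclidean_space \<Rightarrow> real"
  assumes nn: "nonneg_weights xs" and xs: "qsum xs (\<bullet>) > 0"
    and w: "continuous_on UNIV w" and R: "R > 0"
    and sub: "\<And>x l B. x \<in> ball z (2 * R) \<Longrightarrow> touch_above w x l B \<Longrightarrow> qsum xs B \<ge> b"
    and W: "taylor2 W z l B"
    and avg: "\<And>r e. r > 0 \<Longrightarrow> e > 0 \<Longrightarrow> \<exists>(I :: 'i set) c s. finite I \<and> (\<forall>i\<in>I. c i \<ge> 0) \<and> (\<Sum>i\<in>I. c i) = 1 \<and>
      (\<forall>i\<in>I. norm (s i) \<le> R) \<and> (\<forall>x\<in>cball z r. \<bar>W x - (\<Sum>i\<in>I. c i * w (x + s i))\<bar> \<le> e)"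
  shows "qsum xs B \<ge> b"
proof (rule ccontr)
  assume "\<not> qsum xs B \<ge> b"
  define \<theta> Q where "\<theta> = b - qsum xs B" and "Q = qsum xs ((\<bullet>) :: 'a \<Rightarrow> 'a \<Rightarrow> real)"
  have \<theta>: "\<theta> > 0" using \<open>\<not> qsum xs B \<ge> b\<close> by (simp add: \<theta>_def)
  have Q: "Q > 0" using xs by (simp add: Q_def)
  have l: "linear l" and B: "bilinear B" using W by (auto simp: taylor2_def)
  obtain d where d: "d > 0" "\<And>h. norm h < d \<Longrightarrow> \<bar>W (z + h) - W z - l h - B h h / 2\<bar> \<le> \<theta> / (8 * Q) * norm h ^ 2"
    using W \<theta> Q unfolding taylor2_def by (metis divide_pos_pos mult_pos_pos zero_less_numeral)
  define r where "r = min R d / 2"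
  have r: "r > 0" "r < R" "r < d" using d(1) R by (auto simp: r_def)
  \<comment> \<open>With k = \<theta> / Q, the approximation errors are 4e = k r^2 / 4 and the
    Taylor remainder is k r^2 / 8; together they are less than the drop k r^2 / 2.\<close>
  define e where "e = \<theta> * r\<^sup>2 / (16 * Q)"
  have e: "e > 0" using \<theta> Q r by (simp add: e_def)
  obtain I :: "'i set" and c s where I: "finite I" "\<And>i. i \<in> I \<Longrightarrow> c i \<ge> 0" "(\<Sum>i\<in>I. c i) = 1"
    "\<And>i. i \<in> I \<Longrightarrow> norm (s i) \<le> R" "\<And>x. x \<in> cball z r \<Longrightarrow> \<bar>W x - (\<Sum>i\<in>I. c i * w (x + s i))\<bar> \<le> e"
    using avg[OF r(1) e] by blast
  note wt = continuous_on_compose2[OF w, of _ "\<lambda>x. x + s i" for i]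
  have wc: "continuous_on S (\<lambda>x. w (x + s i))" for S i by (rule wt) (auto intro!: continuous_intros)
  have "\<exists>h. (\<forall>x\<in>sphere z r. \<bar>h x - w (x + s i)\<bar> < e) \<and> continuous_on UNIV h \<and>
      (\<forall>x. \<exists>l B. taylor2 h x l B \<and> qsum xs B = b)" for i
    using dirichlet_polynomial[OF nn xs r(1) wc e] by metis
  then obtain h where h: "\<And>i x. x \<in> sphere z r \<Longrightarrow> \<bar>h i x - w (x + s i)\<bar> < e" "\<And>i. continuous_on UNIV (h i)"
      "\<And>i x. \<exists>l B. taylor2 (h i) x l B \<and> qsum xs B = b" by metis
  have major: "w (x + s i) \<le> h i x + e" if i: "i \<in> I" and x: "x \<in> cball z r" for i x
  proof (rule viscosity_max_principle[OF xs wc r(1), where h = "h i" and b = b])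
    fix x l' B' assume x: "x \<in> ball z r" and t: "touch_above (\<lambda>x. w (x + s i)) x l' B'"
    have "x + s i \<in> ball z (2 * R)"
      using x I(4)[OF i] r norm_triangle_ineq[of "x - z" "s i"]
      by (simp add: dist_norm norm_minus_commute[of z] algebra_simps)
    then show "b \<le> qsum xs B'" using sub touch_above_translate[OF t] by blast
  next
    fix x assume "x \<in> sphere z r"
    then show "w (x + s i) \<le> h i x + e" using h(1)[of x i] by linarith
  qed (use h x in \<open>auto intro: continuous_on_subset\<close>, metis order_refl)
  define H where "H = (\<lambda>x. \<Sum>i\<in>I. c i * h i x)"
  define p where "p = (\<lambda>x. W z + l (x - z) + B (x - z) (x - z) / 2)"
  define D where "D = (\<lambda>x. 1 * H x + (-1) * p x)"
  have D2: "\<exists>l B. taylor2 D x l B \<and> qsum xs B = \<theta>" for x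
  proof -
    obtain l1 B1 where 1: "taylor2 H x l1 B1" "qsum xs B1 = b"
      using taylor2_sum[OF I(1), of h x xs b c] h(3) I(3) by (auto simp: H_def)
    have "taylor2 D x (\<lambda>v. 1 * l1 v + (-1) * (l v + (B (x - z) v + B v (x - z)) / 2)) (\<lambda>u v. 1 * B1 u v + (-1) * B u v)"
      unfolding D_def p_def by (rule taylor2_combine[OF 1(1) taylor2_quadratic[OF l B]])
    moreover have "qsum xs (\<lambda>u v. 1 * B1 u v + (-1) * B u v) = \<theta>"
      unfolding qsum_combine using 1(2) by (simp add: \<theta>_def)
    ultimately show ?thesis by blast
  qed
  \<comment> \<open>The paraboloid k|x - z|^2 / 2 carries the same value \<theta> of the operator as
    D, so D can be compared with it.\<close>
  define k where "k = \<theta> / Q"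
  define q where "q = (\<lambda>x::'a. 0 + (\<lambda>v. 0) (x - z) + (k * ((x - z) \<bullet> (x - z)) + 0 * ((x - z) \<bullet> (x - z))) / 2)"
  have q2: "\<exists>l B. taylor2 q x l B \<and> qsum xs B \<le> \<theta>" for x
  proof -
    have bq: "bilinear (\<lambda>u v::'a. k * (u \<bullet> v) + 0 * (u \<bullet> v))"
      by (intro bilinear_scale_combine bilinear_inner)
    have "taylor2 q x (\<lambda>v. (\<lambda>v. 0) v + ((k * ((x - z) \<bullet> v) + 0 * ((x - z) \<bullet> v)) + (k * (v \<bullet> (x - z)) + 0 * (v \<bullet> (x - z)))) / 2)
        (\<lambda>u v. k * (u \<bullet> v) + 0 * (u \<bullet> v))"
      unfolding q_def by (rule taylor2_quadratic[OF _ bq]) (simp add: linear_iff)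
    moreover have "qsum xs (\<lambda>u v. k * (u \<bullet> v) + 0 * (u \<bullet> v)) \<le> \<theta>"
      unfolding qsum_combine Q_def[symmetric] using Q by (simp add: k_def)
    ultimately show ?thesis by blast
  qed
  have cD: "continuous_on S D" for S using D2 taylor2_imp_continuous continuous_at_imp_continuous_on by metis
  have cq: "continuous_on S q" for S using q2 taylor2_imp_continuous continuous_at_imp_continuous_on by metis
  let ?m = "2 * e + \<theta> / (8 * Q) * r\<^sup>2 - k * r\<^sup>2 / 2"
  have "D z \<le> q z + ?m"
  proof (rule viscosity_max_principle[OF xs cD r(1) _ cq q2])
    fix x l' B' assume t: "touch_above D x l' B'"
    obtain l1 B1 where "taylor2 D x l1 B1" "qsum xs B1 = \<theta>" using D2 by blast
    then show "\<theta> \<le> qsum xs B'" using taylor2_touch[OF nn, of D x l1 B1 l' B'] t unfolding touch_above_def by blast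
  next
    fix x assume x: "x \<in> sphere z r"
    then have nx: "norm (x - z) = r" by (simp add: dist_norm norm_minus_commute)
    have "H x \<le> (\<Sum>i\<in>I. c i * (w (x + s i) + e))"
      unfolding H_def using h(1)[OF x] I(2) by (intro sum_mono mult_left_mono) (smt (verit))+
    also have "\<dots> = (\<Sum>i\<in>I. c i * w (x + s i)) + e"
      using I(3) by (simp add: distrib_left sum.distrib sum_distrib_right[symmetric])
    also have "\<dots> \<le> W x + 2 * e" using I(5)[of x] x by (simp add: abs_le_iff)
    also have "W x \<le> p x + \<theta> / (8 * Q) * r\<^sup>2"
      using d(2)[of "x - z"] nx r by (simp add: p_def abs_le_iff)
    finally have "D x \<le> 2 * e + \<theta> / (8 * Q) * r\<^sup>2" by (simp add: D_def)
    moreover have "q x = k * r\<^sup>2 / 2" using nx by (simp add: q_def power2_norm_eq_inner[symmetric])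
    ultimately show "D x \<le> q x + ?m" by simp
  qed (use r in auto)
  moreover have "q z = 0" by (simp add: q_def)
  moreover have "D z \<ge> - 2 * e"
  proof -
    have "(\<Sum>i\<in>I. c i * w (z + s i)) - e = (\<Sum>i\<in>I. c i * (w (z + s i) - e))"
      using I(3) by (simp add: right_diff_distrib sum_subtractf sum_distrib_right[symmetric])
    also have "\<dots> \<le> H z"
      unfolding H_def using major[of _ z] r I(2) by (intro sum_mono mult_left_mono) (auto simp: diff_le_eq)
    finally show ?thesis using I(5)[of z] r by (simp add: D_def p_def linear_0[OF l] bilinear_lzero[OF B] abs_le_iff)
  qed
  ultimately have "k * r\<^sup>2 / 2 \<le> 4 * e + \<theta> / (8 * Q) * r\<^sup>2" by linarith
  moreover have "4 * e = k * r\<^sup>2 / 4" "\<theta> / (8 * Q) * r\<^sup>2 = k * r\<^sup>2 / 8" by (auto simp: e_def k_def)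
  moreover have "k * r\<^sup>2 > 0" using \<theta> Q r by (simp add: k_def)
  ultimately show False by linarith
qed

text \<open>\<open>W\<close> is chosen before the operator: one mollification inherits all
  constant-coefficient inequalities at once. Membership in a closed convex set, which is a family of
  such inequalities, can therefore be passed to it.\<close>

lemma viscosity_regularization:
  fixes w :: "'a::euclidean_space \<Rightarrow> real"
  assumes w: "continuous_on UNIV w" and r: "r > 0" and e: "e > 0"
  obtains W where "\<And>x. x \<in> cball x0 r \<Longrightarrow> \<bar>W x - w x\<bar> \<le> e"
    "\<And>z. \<exists>l B. taylor2 W z l B \<and> (\<forall>xs b. nonneg_weights xs \<longrightarrow> qsum xs (\<bullet>) > 0 \<longrightarrow>
      (\<forall>x\<in>ball z r. \<forall>l' B'. touch_above w x l' B' \<longrightarrow> qsum xs B' \<ge> b) \<longrightarrow> qsum xs B \<ge> b)"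
proof -
  obtain \<delta> where \<delta>: "\<delta> > 0" "\<And>m x. 0 < m \<Longrightarrow> m < \<delta> \<Longrightarrow> x \<in> cball x0 r \<Longrightarrow> \<bar>mollify m w x - w x\<bar> \<le> e"
    using mollify_close[OF w e, of x0 r] by metis
  have N: "real DIM('a) > 0" by simp
  define m where "m = min (\<delta> / 2) (r / (2 * DIM('a)))"
  have m: "m > 0" "m < \<delta>" using \<delta>(1) r N by (auto simp: m_def)
  have Nm: "DIM('a) * m \<le> r / 2"
  proof -
    have "DIM('a) * m \<le> DIM('a) * (r / (2 * DIM('a)))" by (intro mult_left_mono) (auto simp: m_def)
    then show ?thesis using N by simp
  qed
  show ?thesis
  proof
    show "\<bar>mollify m w x - w x\<bar> \<le> e" if "x \<in> cball x0 r" for x by (rule \<delta>(2)[OF m that])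
    fix z
    obtain l B where lB: "taylor2 (mollify m w) z l B" using mollify_taylor2[OF w m(1)] by blast
    have "qsum xs B \<ge> b" if "nonneg_weights xs" "qsum xs (\<bullet>) > 0"
      "\<forall>x\<in>ball z r. \<forall>l' B'. touch_above w x l' B' \<longrightarrow> qsum xs B' \<ge> b" for xs b
    proof (rule average_viscosity_inequality[OF that(1,2) w _ _ lB, where R = "r / 2"])
      fix r' e' :: real assume e': "e' > 0"
      obtain I :: "('a \<times> 'a set) set" and c s where "finite I" "\<And>i. i \<in> I \<Longrightarrow> c i \<ge> 0" "(\<Sum>i\<in>I. c i) = 1"
        "\<And>i. i \<in> I \<Longrightarrow> norm (s i) \<le> DIM('a) * m"
        "\<And>x. x \<in> cball z r' \<Longrightarrow> \<bar>mollify m w x - (\<Sum>i\<in>I. c i * w (x + s i))\<bar> \<le> e'"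
        by (rule mollify_finite_average[OF w m(1) e', of z r']) (rule that)
      then show "\<exists>(I :: ('a \<times> 'a set) set) c s. finite I \<and> (\<forall>i\<in>I. c i \<ge> 0) \<and> (\<Sum>i\<in>I. c i) = 1 \<and>
        (\<forall>i\<in>I. norm (s i) \<le> r / 2) \<and> (\<forall>x\<in>cball z r'. \<bar>mollify m w x - (\<Sum>i\<in>I. c i * w (x + s i))\<bar> \<le> e')"
        using order_trans[OF _ Nm] by (intro exI[of _ I] exI[of _ c] exI[of _ s] conjI ballI) simp_all
    qed (use r that in auto)
    with lB show "\<exists>l B. taylor2 (mollify m w) z l B \<and> (\<forall>xs b. nonneg_weights xs \<longrightarrow> qsum xs (\<bullet>) > 0 \<longrightarrow>
      (\<forall>x\<in>ball z r. \<forall>l' B'. touch_above w x l' B' \<longrightarrow> qsum xs B' \<ge> b) \<longrightarrow> qsum xs B \<ge> b)" by blast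
  qed
qed

section \<open>Hermitian forms and unitary frames\<close>

definition hf :: "complex^'n^'n \<Rightarrow> complex^'n \<Rightarrow> complex^'n \<Rightarrow> complex" where
  "hf M v w = (\<Sum>j\<in>UNIV. \<Sum>k\<in>UNIV. M $ j $ k * v $ j * cnj (w $ k))"

definition hermitian :: "complex^'n^'n \<Rightarrow> bool" where
  "hermitian M \<longleftrightarrow> (\<forall>j k. M $ k $ j = cnj (M $ j $ k))"

definition adjoint_mat :: "complex^'n^'n \<Rightarrow> complex^'n^'n" where
  "adjoint_mat E = cnj_mat (transpose E)"

text \<open>The frame vectors are the rows of \<open>E\<close>, so that moving them all by one
  linear map is the right multiplication \<open>E ** M\<close>.\<close>

definition frames :: "complex^'n^'n \<Rightarrow> (complex^'n^'n) set" where
  "frames g = {E. \<forall>i j. hf g (E $ i) (E $ j) = (if i = j then 1 else 0)}"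

definition diagvec :: "complex^'n^'n \<Rightarrow> complex^'n^'n \<Rightarrow> real^'n" where
  "diagvec M E = (\<chi> i. Re (hf M (E $ i) (E $ i)))"

lemma hf_add_left: "hf M (u + v) w = hf M u w + hf M v w"
  and hf_add_right: "hf M w (u + v) = hf M w u + hf M w v"
  and hf_scale_left: "hf M (c *s v) w = c * hf M v w"
  and hf_scale_right: "hf M w (c *s v) = cnj c * hf M w v"
  and hf_mat_add: "hf (M + N) v w = hf M v w + hf N v w"
  and hf_mat_diff: "hf (M - N) v w = hf M v w - hf N v w"
  by (simp_all add: hf_def algebra_simps sum.distrib sum_distrib_left sum_subtractf)

lemma hf_swap: "hermitian M \<Longrightarrow> hf M w v = cnj (hf M v w)"
proof -
  assume M: "hermitian M"
  have "hf M w v = (\<Sum>k\<in>UNIV. \<Sum>j\<in>UNIV. M $ j $ k * w $ j * cnj (v $ k))"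
    unfolding hf_def by (rule sum.swap)
  also have "\<dots> = (\<Sum>k\<in>UNIV. \<Sum>j\<in>UNIV. cnj (M $ k $ j * v $ k * cnj (w $ j)))"
  proof (intro sum.cong refl)
    fix k j
    have "M $ j $ k = cnj (M $ k $ j)" using M unfolding hermitian_def by blast
    then show "M $ j $ k * w $ j * cnj (v $ k) = cnj (M $ k $ j * v $ k * cnj (w $ j))" by simp
  qed
  finally show ?thesis by (simp add: hf_def)
qed

lemma hf_matrix: "hf M (E $ i) (F $ j) = (E ** M ** adjoint_mat F) $ i $ j"
proof -
  have "(E ** M ** adjoint_mat F) $ i $ j = (\<Sum>k\<in>UNIV. \<Sum>l\<in>UNIV. E $ i $ l * M $ l $ k * cnj (F $ j $ k))"
    by (simp add: matrix_matrix_mult_def adjoint_mat_def cnj_mat_def transpose_def sum_distrib_right)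
  also have "\<dots> = (\<Sum>l\<in>UNIV. \<Sum>k\<in>UNIV. E $ i $ l * M $ l $ k * cnj (F $ j $ k))" by (rule sum.swap)
  finally show ?thesis by (simp add: hf_def mult_ac)
qed

lemma frames_matrix: "E \<in> frames g \<longleftrightarrow> E ** g ** adjoint_mat E = mat 1"
  unfolding frames_def mem_Collect_eq hf_matrix by (simp add: vec_eq_iff mat_def)

lemma matrix_diff_left: "(A - B) ** C = A ** C - B ** (C :: complex^'n^'n)"
  and matrix_diff_right: "C ** (A - B) = C ** A - C ** (B :: complex^'n^'n)"
  by (simp_all add: matrix_matrix_mult_def vec_eq_iff algebra_simps sum_subtractf)

lemma matrix_inv_unique:
  fixes A B :: "complex^'n^'n"
  assumes "A ** B = mat 1" "B ** A = mat 1" shows "matrix_inv A = B"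
proof -
  have "A ** matrix_inv A = mat 1 \<and> matrix_inv A ** A = mat 1"
    unfolding matrix_inv_def by (rule someI[of _ B]) (use assms in simp)
  then have "matrix_inv A = (B ** A) ** matrix_inv A" using assms by simp
  also have "\<dots> = B ** (A ** matrix_inv A)" by (simp add: matrix_mul_assoc)
  finally show ?thesis using \<open>A ** matrix_inv A = mat 1 \<and> _\<close> by simp
qed

text \<open>Transposing the frame relation yields \<open>matrix_inv (transpose g) = X ** Y\<close>,
  so \<open>endo g A\<close> is conjugate through X to the matrix D, which is diagonal by the
  assumption on the off-diagonal entries.\<close>

lemma eigenframe_eig_tuple:
  fixes g A :: "complex^'n^'n"
  assumes E: "E \<in> frames g" and A: "hermitian A" and off: "\<And>i j. i \<noteq> j \<Longrightarrow> hf A (E $ i) (E $ j) = 0"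
  shows "eig_tuple g A (diagvec A E)"
proof -
  define X Y where "X = transpose E" and "Y = cnj_mat E"
  define D where "D = Y ** transpose A ** X"
  have YT: "transpose (adjoint_mat E) = Y" by (simp add: Y_def adjoint_mat_def cnj_mat_def transpose_def)
  have tr: "transpose (E ** M ** adjoint_mat E) = Y ** transpose M ** X" for M
    by (simp add: matrix_transpose_mul YT X_def matrix_mul_assoc)
  have 1: "Y ** transpose g ** X = mat 1"
    using tr[of g] E by (simp add: frames_matrix)
  then have 2: "X ** (Y ** transpose g) = mat 1" by (simp add: matrix_left_right_inverse)
  then have 3: "(X ** Y) ** transpose g = mat 1" by (simp add: matrix_mul_assoc)
  then have 4: "transpose g ** (X ** Y) = mat 1" by (simp add: matrix_left_right_inverse)
  have inv: "matrix_inv (transpose g) = X ** Y" by (rule matrix_inv_unique[OF 4 3])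
  have D: "D = (\<chi> i j. if i = j then complex_of_real (diagvec A E $ i) else 0)"
  proof -
    have "D $ i $ j = hf A (E $ j) (E $ i)" for i j
      unfolding D_def tr[of A, symmetric] hf_matrix by (simp add: transpose_def)
    moreover have "hf A (E $ i) (E $ i) = complex_of_real (diagvec A E $ i)" for i
      using hf_swap[OF A, of "E $ i" "E $ i"] by (simp add: diagvec_def complex_eq_iff)
    ultimately show ?thesis using off by (auto simp: vec_eq_iff)
  qed
  have EX: "endo g A ** X = X ** D"
    unfolding endo_def inv D_def by (simp add: matrix_mul_assoc)
  have "det X \<noteq> 0" using 2 by (metis det_I det_mul mult_zero_left zero_neq_one)
  have "det (mat t - endo g A) = (\<Prod>i\<in>UNIV. t - complex_of_real (diagvec A E $ i))" for t
  proof -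
    have "(mat t - endo g A) ** X = X ** (mat t - D)"
    proof -
      have "mat t ** X = X ** mat t" by (simp add: matrix_matrix_mult_def mat_def vec_eq_iff if_distrib[of "\<lambda>x. x * _"] if_distrib[of "\<lambda>x. _ * x"] cong: if_cong)
      then show ?thesis by (simp add: matrix_diff_left matrix_diff_right EX)
    qed
    then have "det (mat t - endo g A) * det X = det X * det (mat t - D)" by (metis det_mul)
    then have "det (mat t - endo g A) = det (mat t - D)" using \<open>det X \<noteq> 0\<close> by simp
    also have "\<dots> = (\<Prod>i\<in>UNIV. (mat t - D) $ i $ i)" by (rule det_diagonal) (simp add: D mat_def)
    finally show ?thesis by (simp add: D mat_def)
  qed
  then show ?thesis by (simp add: eig_tuple_def)
qed

section \<open>Norm bounds and compactness of the set of unitary frames\<close>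

lemma norm_vector_smult: "norm (c *s v :: complex^'n) = norm c * norm v"
  unfolding norm_vec_def by (simp add: norm_mult L2_set_right_distrib)

lemma norm_hf_le: "norm (hf M v w) \<le> (\<Sum>j\<in>UNIV. \<Sum>k\<in>UNIV. norm (M $ j $ k)) * norm v * norm w"
proof -
  have "norm (hf M v w) \<le> (\<Sum>j\<in>UNIV. \<Sum>k\<in>UNIV. norm (M $ j $ k * v $ j * cnj (w $ k)))"
    unfolding hf_def by (intro order_trans[OF norm_sum] sum_mono order_refl norm_sum)
  also have "\<dots> \<le> (\<Sum>j\<in>UNIV. \<Sum>k\<in>UNIV. norm (M $ j $ k) * norm v * norm w)"
    unfolding norm_mult complex_mod_cnj by (intro sum_mono mult_mono Finite_Cartesian_Product.norm_nth_le) auto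
  finally show ?thesis by (simp add: sum_distrib_right)
qed

lemma continuous_hf:
  "continuous_on S M \<Longrightarrow> continuous_on S v \<Longrightarrow> continuous_on S w \<Longrightarrow> continuous_on S (\<lambda>x. hf (M x) (v x) (w x))"
  unfolding hf_def by (intro continuous_intros) auto

definition coercive :: "real \<Rightarrow> complex^'n^'n \<Rightarrow> bool" where
  "coercive m g \<longleftrightarrow> hermitian g \<and> m > 0 \<and> (\<forall>v. m * (norm v)\<^sup>2 \<le> Re (hf g v v))"

lemma frame_norm_le:
  assumes "coercive m g" "E \<in> frames g" shows "m * (norm (E $ i))\<^sup>2 \<le> 1"
proof -
  have "m * (norm (E $ i))\<^sup>2 \<le> Re (hf g (E $ i) (E $ i))" using assms(1) unfolding coercive_def by blast
  then show ?thesis using assms(2) by (simp add: frames_def)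
qed

lemma frame_norm_le':
  assumes "coercive m g" "E \<in> frames g" shows "norm (E $ i) \<le> 1 / sqrt m"
proof -
  have "m > 0" using assms(1) by (simp add: coercive_def)
  have "(norm (E $ i))\<^sup>2 \<le> 1 / m" using frame_norm_le[OF assms, of i] \<open>m > 0\<close> by (simp add: field_simps)
  then have "norm (E $ i) \<le> sqrt (1 / m)" by (rule real_le_rsqrt)
  then show ?thesis by (simp add: real_sqrt_divide)
qed

lemma compact_frames:
  assumes "coercive m (g :: complex^'n^'n)" shows "compact (frames g)"
proof -
  have "bounded (frames g)"
    unfolding bounded_iff
  proof (intro exI ballI)
    fix E assume E: "E \<in> frames g"
    have "norm E \<le> (\<Sum>i\<in>UNIV. norm (E $ i))" unfolding norm_vec_def by (rule L2_set_le_sum) simp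
    also have "\<dots> \<le> (\<Sum>i\<in>(UNIV::'n set). 1 / sqrt m)" by (intro sum_mono frame_norm_le'[OF assms E])
    finally show "norm E \<le> (\<Sum>i\<in>(UNIV::'n set). 1 / sqrt m)" .
  qed
  moreover have "closed (frames g)"
  proof -
    have "frames g = (\<Inter>i. \<Inter>j. {E. hf g (E $ i) (E $ j) = (if i = j then 1 else 0)})"
      by (auto simp: frames_def)
    also have "closed \<dots>"
      by (intro closed_INT ballI closed_Collect_eq continuous_hf continuous_intros)
    finally show ?thesis .
  qed
  ultimately show ?thesis by (simp add: compact_eq_bounded_closed)
qed

text \<open>Near k = 0 the linear term dominates, and its sign changes with k.\<close>

lemma small_perturbation_nonneg:
  fixes p y :: real
  assumes "\<And>k. k\<^sup>2 * p + 2 * k * y \<ge> 0" shows "y = 0"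
proof (rule ccontr)
  assume y: "y \<noteq> 0"
  define a where "a = \<bar>p\<bar> + 1"
  have a: "a > 0" "p \<le> a" by (auto simp: a_def)
  have "(- y / a)\<^sup>2 * p + 2 * (- y / a) * y \<le> (- y / a)\<^sup>2 * a + 2 * (- y / a) * y"
    using a by (intro add_right_mono mult_left_mono) auto
  also have "\<dots> = - (y\<^sup>2 / a)" using a by (simp add: field_simps power2_eq_square)
  also have "\<dots> < 0" using a y by simp
  finally show False using assms[of "- y / a"] by simp
qed

text \<open>A minimiser over the compact set of frames is stationary under rotations in the plane of
  E_i and E_j. The first-order term of such a rotation is a multiple of (ll_i - ll_j)|A(E_i, E_j)|,
  so distinct weights force the entry to vanish. The minimality is kept in the conclusion for the
  Schur--Horn argument.\<close>

lemma diagonalizing_frame: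
  fixes g A :: "complex^'n^'n" and ll :: "real^'n"
  assumes g: "coercive m g" and ne: "frames g \<noteq> {}" and A: "hermitian A"
    and ll: "\<And>i j. i \<noteq> j \<Longrightarrow> ll $ i \<noteq> ll $ j"
  obtains E where "E \<in> frames g" "\<And>i j. i \<noteq> j \<Longrightarrow> hf A (E $ i) (E $ j) = 0"
    "\<And>F. F \<in> frames g \<Longrightarrow> ll \<bullet> diagvec A E \<le> ll \<bullet> diagvec A F"
proof -
  have "continuous_on (frames g) (\<lambda>E. ll \<bullet> diagvec A E)"
    unfolding diagvec_def inner_vec_def by (simp, intro continuous_intros continuous_hf)
  then obtain E where E: "E \<in> frames g" and min: "\<And>F. F \<in> frames g \<Longrightarrow> ll \<bullet> diagvec A E \<le> ll \<bullet> diagvec A F"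
    using continuous_attains_inf[OF compact_frames[OF g] ne] by blast
  have "hf A (E $ i) (E $ j) = 0" if ij: "i \<noteq> j" for i j
  proof (rule ccontr)
    assume nz: "hf A (E $ i) (E $ j) \<noteq> 0"
    define z where "z = hf A (E $ i) (E $ j)"
    \<comment> \<open>The phase of the off-diagonal entry: rotating with it replaces the entry by
      its modulus in the first-order term.\<close>
    define \<omega> where "\<omega> = z / of_real (norm z)"
    have z: "z \<noteq> 0" using nz by (simp add: z_def)
    have \<omega>: "\<omega> * cnj \<omega> = 1" "cnj \<omega> * z = of_real (norm z)"
      using z by (simp_all add: \<omega>_def complex_norm_square[symmetric] power2_eq_square mult.commute[of "cnj z"])
    define a b where "a = Re (hf A (E $ i) (E $ i))" and "b = Re (hf A (E $ j) (E $ j))"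
    define p y where "p = (ll $ i - ll $ j) * (b - a)" and "y = (ll $ i - ll $ j) * norm z"
    have Gij: "hf g (E $ k) (E $ l) = (if k = l then 1 else 0)" for k l
      using E by (simp add: frames_def)
    have Aii: "hf A (E $ k) (E $ k) = of_real (Re (hf A (E $ k) (E $ k)))" for k
      using hf_swap[OF A, of "E $ k" "E $ k"] by (simp add: complex_eq_iff)
    have Aab: "hf A (E $ i) (E $ i) = of_real a" "hf A (E $ j) (E $ j) = of_real b"
      using Aii[of i] Aii[of j] by (simp_all only: a_def b_def)
    have Aji: "hf A (E $ j) (E $ i) = cnj z" unfolding z_def by (rule hf_swap[OF A])
    have "k\<^sup>2 * p + 2 * k * y \<ge> 0" for k
    proof -
      \<comment> \<open>Cosine and sine of the rotation with tangent k. The functional then changes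
        by c^2 times a quadratic polynomial in k.\<close>
      define c where "c = 1 / sqrt (1 + k\<^sup>2)"
      define s where "s = k * c"
      have k1: "1 + k\<^sup>2 > 0" by (simp add: add_pos_nonneg)
      have c2: "c\<^sup>2 * (1 + k\<^sup>2) = 1" using k1 by (simp add: c_def power_divide)
      then have cs: "c\<^sup>2 + s\<^sup>2 = 1" by (simp add: s_def power_mult_distrib algebra_simps)
      have cs': "complex_of_real c * complex_of_real c + complex_of_real s * complex_of_real s = 1"
        using cs by (metis of_real_1 of_real_add of_real_mult power2_eq_square)
      define F :: "complex^'n^'n" where "F = (\<chi> k. if k = i then of_real c *s (E $ i) + (of_real s * \<omega>) *s (E $ j)
        else if k = j then (- (of_real s * cnj \<omega>)) *s (E $ i) + of_real c *s (E $ j) else E $ k)"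
      have Fi: "F $ i = of_real c *s (E $ i) + (of_real s * \<omega>) *s (E $ j)" by (simp add: F_def)
      have Fj: "F $ j = (- (of_real s * cnj \<omega>)) *s (E $ i) + of_real c *s (E $ j)" using ij by (simp add: F_def)
      have Fk: "F $ k = E $ k" if "k \<noteq> i" "k \<noteq> j" for k using that by (simp add: F_def)
      note expand = hf_add_left hf_add_right hf_scale_left hf_scale_right
      have \<omega>1: "\<omega> * (cnj \<omega> * x) = x" "cnj \<omega> * (\<omega> * x) = x" for x
        using \<omega>(1) by (simp_all add: mult.assoc[symmetric] mult.commute[of "cnj \<omega>"])
      have FF: "F \<in> frames g"
        unfolding frames_def
      proof (intro CollectI allI)
        fix k l
        have ii: "hf g (F $ i) (F $ i) = 1" using ij cs' unfolding Fi expand Gij by (simp add: mult_ac \<omega>1 \<omega>(1))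
        have jj: "hf g (F $ j) (F $ j) = 1" using ij cs' unfolding Fj expand Gij by (simp add: mult_ac \<omega>1 \<omega>(1) add.commute)
        have ij0: "hf g (F $ i) (F $ j) = 0" "hf g (F $ j) (F $ i) = 0" using ij unfolding Fi Fj expand Gij by (simp_all add: mult_ac)
        have k0: "hf g (F $ i) (F $ k) = 0" "hf g (F $ k) (F $ i) = 0" "hf g (F $ j) (F $ k) = 0" "hf g (F $ k) (F $ j) = 0"
          if "k \<noteq> i" "k \<noteq> j" for k
          using that ij unfolding Fi Fj Fk[OF that] expand Gij by simp_all
        show "hf g (F $ k) (F $ l) = (if k = l then 1 else 0)"
        proof -
          consider "k = i" | "k = j" | "k \<noteq> i" "k \<noteq> j" by blast
          then show ?thesis
          proof cases
            case 1
            consider "l = i" | "l = j" | "l \<noteq> i" "l \<noteq> j" by blast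
            then show ?thesis by cases (use 1 ii ij0 k0(1)[of l] ij in simp_all)
          next
            case 2
            consider "l = i" | "l = j" | "l \<noteq> i" "l \<noteq> j" by blast
            then show ?thesis by cases (use 2 jj ij0 k0(3)[of l] ij in simp_all)
          next
            case 3
            consider "l = i" | "l = j" | "l \<noteq> i" "l \<noteq> j" by blast
            then show ?thesis by cases (use 3 k0(2,4)[of k] Fk Gij in simp_all)
          qed
        qed
      qed
      have zz: "cnj \<omega> * z + \<omega> * cnj z = of_real (2 * norm z)"
      proof -
        have "\<omega> * cnj z = cnj (cnj \<omega> * z)" by simp
        then show ?thesis unfolding \<omega>(2) by simp
      qed
      have "hf A (F $ i) (F $ i) = of_real (c\<^sup>2 * a + s\<^sup>2 * b) + of_real (c * s) * (cnj \<omega> * z + \<omega> * cnj z)"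
        unfolding Fi expand z_def[symmetric] Aji Aab
        by (simp add: power2_eq_square algebra_simps \<omega>1)
      then have dFi: "diagvec A F $ i = c\<^sup>2 * a + s\<^sup>2 * b + 2 * (c * s) * norm z" unfolding zz by (simp add: diagvec_def)
      have "hf A (F $ j) (F $ j) = of_real (s\<^sup>2 * a + c\<^sup>2 * b) - of_real (c * s) * (cnj \<omega> * z + \<omega> * cnj z)"
        unfolding Fj expand z_def[symmetric] Aji Aab
        by (simp add: power2_eq_square algebra_simps \<omega>1)
      then have dFj: "diagvec A F $ j = s\<^sup>2 * a + c\<^sup>2 * b - 2 * (c * s) * norm z" unfolding zz by (simp add: diagvec_def)
      have "0 \<le> (\<Sum>k\<in>UNIV. ll $ k * (diagvec A F $ k - diagvec A E $ k))"
        using min[OF FF] by (simp add: inner_vec_def right_diff_distrib sum_subtractf)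
      also have "\<dots> = (\<Sum>k\<in>{i, j}. ll $ k * (diagvec A F $ k - diagvec A E $ k))"
        by (rule sum.mono_neutral_right) (auto simp: diagvec_def Fk)
      also have "\<dots> = ll $ i * (c\<^sup>2 * a + s\<^sup>2 * b + 2 * (c * s) * norm z - a) + ll $ j * (s\<^sup>2 * a + c\<^sup>2 * b - 2 * (c * s) * norm z - b)"
        using ij by (simp add: dFi dFj) (simp add: diagvec_def a_def b_def)
      also have "\<dots> = s\<^sup>2 * p + 2 * (c * s) * y"
      proof -
        have s2: "s\<^sup>2 = 1 - c\<^sup>2" using cs by simp
        show ?thesis unfolding p_def y_def s2 by (simp add: algebra_simps)
      qed
      also have "\<dots> = c\<^sup>2 * (k\<^sup>2 * p + 2 * k * y)" by (simp add: s_def power2_eq_square algebra_simps)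
      finally have "0 \<le> c\<^sup>2 * (k\<^sup>2 * p + 2 * k * y)" .
      moreover have "c\<^sup>2 > 0" using c2 by (metis mult_zero_left zero_less_power2 zero_neq_one zero_power2)
      ultimately show ?thesis by (simp add: zero_le_mult_iff)
    qed
    then have "y = 0" by (rule small_perturbation_nonneg)
    then show False using ll[OF ij] z by (simp add: y_def)
  qed
  then show ?thesis using that E min by blast
qed

section \<open>Existence of frames and finiteness of the spectrum\<close>

lemma distinct_vector: "\<exists>p :: real^'n. \<forall>i j. i \<noteq> j \<longrightarrow> p $ i \<noteq> p $ j"
proof -
  obtain h :: "'n \<Rightarrow> nat" where h: "inj h" using finite_imp_inj_to_nat_seg[of "UNIV :: 'n set"] by auto
  show ?thesis by (rule exI[of _ "\<chi> i. real (h i)"]) (use h in \<open>auto simp: inj_def\<close>)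
qed

lemma hf_mat_1: "hf (mat 1) v v = of_real ((norm v)\<^sup>2)"
proof -
  have "hf (mat 1) v v = (\<Sum>j\<in>UNIV. v $ j * cnj (v $ j))"
    unfolding hf_def by (intro sum.cong refl) (simp add: mat_def if_distrib[of "\<lambda>x. x * _"] cong: if_cong)
  also have "\<dots> = of_real (\<Sum>j\<in>UNIV. (norm (v $ j))\<^sup>2)" unfolding of_real_sum complex_norm_square ..
  finally show ?thesis by (simp add: norm_vec_def L2_set_def sum_nonneg)
qed

lemma coercive_mat_1: "coercive 1 (mat 1)"
  unfolding coercive_def hf_mat_1 by (simp add: hermitian_def mat_def)

lemma mat_1_frame: "mat 1 \<in> frames (mat 1)"
  by (simp add: frames_matrix adjoint_mat_def transpose_mat) (simp add: cnj_mat_def mat_def vec_eq_iff)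

text \<open>A frame that is unitary for the identity and diagonalises g becomes g-unitary once each
  row is divided by its g-norm.\<close>

lemma frames_nonempty:
  fixes g :: "complex^'n^'n"
  assumes g: "coercive m g" shows "frames g \<noteq> {}"
proof -
  obtain p :: "real^'n" where p: "\<And>i j. i \<noteq> j \<Longrightarrow> p $ i \<noteq> p $ j" using distinct_vector by blast
  have herm: "hermitian g" using g by (simp add: coercive_def)
  obtain E where E: "E \<in> frames (mat 1)" "\<And>i j. i \<noteq> j \<Longrightarrow> hf g (E $ i) (E $ j) = 0"
    by (rule diagonalizing_frame[OF coercive_mat_1 _ herm p]) (use mat_1_frame in blast, assumption, rule that)
  have En: "norm (E $ i) = 1" for i
  proof -
    have "complex_of_real ((norm (E $ i))\<^sup>2) = 1" using E(1) unfolding hf_mat_1[symmetric] by (simp add: frames_def)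
    then have "(norm (E $ i))\<^sup>2 = 1" by (simp only: of_real_eq_1_iff)
    then show ?thesis using norm_ge_zero[of "E $ i"] by (simp add: power2_eq_1_iff)
  qed
  define \<mu> where "\<mu> = (\<lambda>i. Re (hf g (E $ i) (E $ i)))"
  have \<mu>: "\<mu> i > 0" for i
  proof -
    have "m * (norm (E $ i))\<^sup>2 \<le> \<mu> i" "m > 0" using g by (auto simp: coercive_def \<mu>_def)
    then show ?thesis using En[of i] by simp
  qed
  have Eii: "hf g (E $ i) (E $ i) = of_real (\<mu> i)" for i
    using hf_swap[OF herm, of "E $ i" "E $ i"] by (simp add: complex_eq_iff \<mu>_def)
  have "(\<chi> i. of_real (1 / sqrt (\<mu> i)) *s (E $ i)) \<in> frames g"
    unfolding frames_def
  proof (intro CollectI allI)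
    fix i j
    have "1 / sqrt (\<mu> i) * (1 / sqrt (\<mu> i)) * \<mu> i = 1" using \<mu>[of i] by (simp add: field_simps)
    then have "complex_of_real (1 / sqrt (\<mu> i)) * (complex_of_real (1 / sqrt (\<mu> i)) * complex_of_real (\<mu> i)) = 1"
      by (metis mult.assoc of_real_1 of_real_mult)
    then show "hf g ((\<chi> i. of_real (1 / sqrt (\<mu> i)) *s (E $ i)) $ i) ((\<chi> i. of_real (1 / sqrt (\<mu> i)) *s (E $ i)) $ j)
      = (if i = j then 1 else 0)"
      using E(2)[of i j] by (cases "i = j") (simp_all add: hf_scale_left hf_scale_right Eii del: of_real_divide)
  qed
  then show ?thesis by blast
qed

text \<open>All entries are roots of one characteristic polynomial. Finiteness makes the convex hull
  of the tuples compact and lets one small perturbation of a functional work for all tuples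
  simultaneously.\<close>

lemma finite_eig_tuples: "finite {lam :: real^'n. eig_tuple g A lam}"
proof (cases "\<exists>d :: real^'n. eig_tuple g A d")
  case True
  then obtain d :: "real^'n" where d: "eig_tuple g A d" by blast
  have "{lam :: real^'n. eig_tuple g A lam} \<subseteq> vec_lambda ` (UNIV \<rightarrow>\<^sub>E range (($) d))"
  proof
    fix lam :: "real^'n" assume "lam \<in> {lam. eig_tuple g A lam}"
    then have l: "eig_tuple g A lam" by simp
    have "lam $ i \<in> range (($) d)" for i
    proof -
      have "(\<Prod>k\<in>UNIV. complex_of_real (lam $ i) - complex_of_real (lam $ k))
        = (\<Prod>k\<in>UNIV. complex_of_real (lam $ i) - complex_of_real (d $ k))"
        using l d unfolding eig_tuple_def by metis
      moreover have "(\<Prod>k\<in>UNIV. complex_of_real (lam $ i) - complex_of_real (lam $ k)) = 0"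
        by (rule prod_zero) auto
      ultimately obtain k where "complex_of_real (lam $ i) - complex_of_real (d $ k) = 0"
        by (metis (no_types, lifting) finite prod_zero_iff)
      then show ?thesis by auto
    qed
    then show "lam \<in> vec_lambda ` (UNIV \<rightarrow>\<^sub>E range (($) d))"
      by (intro image_eqI[of _ _ "($) lam"]) (auto simp: vec_lambda_eta)
  qed
  then show ?thesis by (rule finite_subset) (intro finite_imageI finite_PiE; simp)
qed auto

text \<open>The Schur--Horn inclusion: a linear functional separating the diagonal from the convex hull of
  the spectrum may be taken with distinct coefficients, and is then minimised over all frames by
  an eigenframe.\<close>

lemma diagvec_in_eig_hull:
  fixes g A :: "complex^'n^'n"
  assumes g: "coercive m g" and A: "hermitian A" and E: "E \<in> frames g"
  shows "diagvec A E \<in> convex hull {lam :: real^'n. eig_tuple g A lam}"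
proof (rule ccontr)
  let ?S = "{lam :: real^'n. eig_tuple g A lam}"
  assume "diagvec A E \<notin> convex hull ?S"
  moreover have "closed (convex hull ?S)"
    by (intro compact_imp_closed compact_convex_hull finite_imp_compact finite_eig_tuples)
  ultimately obtain a b where ab: "a \<bullet> diagvec A E < b" "\<And>x. x \<in> convex hull ?S \<Longrightarrow> b < a \<bullet> x"
    using separating_hyperplane_closed_point[OF convex_convex_hull] by blast
  obtain p :: "real^'n" where p: "\<And>i j. i \<noteq> j \<Longrightarrow> p $ i \<noteq> p $ j" using distinct_vector by blast
  have 1: "\<forall>\<^sub>F s in at_right (0::real). \<forall>x\<in>?S. (a + s *\<^sub>R p) \<bullet> diagvec A E < (a + s *\<^sub>R p) \<bullet> x"
  proof (intro eventually_ball_finite finite_eig_tuples ballI)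
    fix x assume "x \<in> ?S"
    then have "a \<bullet> diagvec A E < a \<bullet> x" using ab hull_inc[of x ?S convex] by force
    moreover have "((\<lambda>s. (a + s *\<^sub>R p) \<bullet> x - (a + s *\<^sub>R p) \<bullet> diagvec A E)
      \<longlongrightarrow> (a + 0 *\<^sub>R p) \<bullet> x - (a + 0 *\<^sub>R p) \<bullet> diagvec A E) (at_right (0::real))"
      by (intro tendsto_intros)
    ultimately have "\<forall>\<^sub>F s in at_right (0::real). 0 < (a + s *\<^sub>R p) \<bullet> x - (a + s *\<^sub>R p) \<bullet> diagvec A E"
      by (intro order_tendstoD(1)) auto
    then show "\<forall>\<^sub>F s in at_right (0::real). (a + s *\<^sub>R p) \<bullet> diagvec A E < (a + s *\<^sub>R p) \<bullet> x"
      by (rule eventually_mono) simp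
  qed
  have 2: "\<forall>\<^sub>F s in at_right (0::real). \<forall>i\<in>UNIV. \<forall>j\<in>UNIV. i \<noteq> j \<longrightarrow> (a + s *\<^sub>R p) $ i \<noteq> (a + s *\<^sub>R p) $ j"
  proof (intro eventually_ball_finite finite ballI)
    fix i j
    show "\<forall>\<^sub>F s in at_right (0::real). i \<noteq> j \<longrightarrow> (a + s *\<^sub>R p) $ i \<noteq> (a + s *\<^sub>R p) $ j"
    proof (cases "i = j")
      case False
      define s0 where "s0 = (a $ j - a $ i) / (p $ i - p $ j)"
      have "\<forall>\<^sub>F s in at_right (0::real). s \<noteq> s0"
        by (cases "s0 > 0") (auto simp: eventually_at_right_field intro: exI[of _ s0] exI[of _ 1])
      then show ?thesis
      proof (rule eventually_mono)
        fix s assume "s \<noteq> s0"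
        then show "i \<noteq> j \<longrightarrow> (a + s *\<^sub>R p) $ i \<noteq> (a + s *\<^sub>R p) $ j"
          using p[OF False] by (auto simp: s0_def field_simps)
      qed
    qed simp
  qed
  obtain s where s: "\<forall>x\<in>?S. (a + s *\<^sub>R p) \<bullet> diagvec A E < (a + s *\<^sub>R p) \<bullet> x"
      "\<forall>i\<in>UNIV. \<forall>j\<in>UNIV. i \<noteq> j \<longrightarrow> (a + s *\<^sub>R p) $ i \<noteq> (a + s *\<^sub>R p) $ j"
    using eventually_happens'[OF _ eventually_conj[OF 1 2]] by auto
  obtain F where F: "F \<in> frames g" "\<And>i j. i \<noteq> j \<Longrightarrow> hf A (F $ i) (F $ j) = 0"
    "(a + s *\<^sub>R p) \<bullet> diagvec A F \<le> (a + s *\<^sub>R p) \<bullet> diagvec A E"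
  proof (rule diagonalizing_frame[OF g _ A, of "a + s *\<^sub>R p"])
    show "frames g \<noteq> {}" using E by blast
    show "(a + s *\<^sub>R p) $ i \<noteq> (a + s *\<^sub>R p) $ j" if "i \<noteq> j" for i j using s(2) that by blast
    fix F assume "F \<in> frames g" "\<And>i j. i \<noteq> j \<Longrightarrow> hf A (F $ i) (F $ j) = 0"
      "\<And>F'. F' \<in> frames g \<Longrightarrow> (a + s *\<^sub>R p) \<bullet> diagvec A F \<le> (a + s *\<^sub>R p) \<bullet> diagvec A F'"
    then show thesis using E by (intro that)
  qed
  have "diagvec A F \<in> ?S" using eigenframe_eig_tuple[OF F(1) A F(2)] by simp
  then show False using s(1) F(3) by fastforce
qed

lemma eigenframe_exists:
  fixes g A :: "complex^'n^'n"
  assumes g: "coercive m g" and A: "hermitian A"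
  obtains E where "E \<in> frames g" "eig_tuple g A (diagvec A E)"
proof -
  obtain p :: "real^'n" where p: "\<And>i j. i \<noteq> j \<Longrightarrow> p $ i \<noteq> p $ j" using distinct_vector by blast
  obtain E where "E \<in> frames g" "\<And>i j. i \<noteq> j \<Longrightarrow> hf A (E $ i) (E $ j) = 0"
    by (rule diagonalizing_frame[OF g frames_nonempty[OF g] A p]) (assumption, rule that)
  then show ?thesis by (intro that[of E] eigenframe_eig_tuple[OF _ A])
qed

section \<open>Transport of frames\<close>

lemma adjoint_mat_mul: "adjoint_mat (A ** B) = adjoint_mat B ** adjoint_mat (A :: complex^'n^'n)"
  by (simp add: adjoint_mat_def cnj_mat_def transpose_def matrix_matrix_mult_def vec_eq_iff mult.commute)

lemma adjoint_mat_adjoint: "adjoint_mat (adjoint_mat A) = A"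
  by (simp add: adjoint_mat_def cnj_mat_def transpose_def vec_eq_iff)

lemma adjoint_mat_hermitian: "hermitian g \<Longrightarrow> adjoint_mat g = g"
proof -
  assume "hermitian g"
  then have "cnj (g $ j $ i) = g $ i $ j" for i j unfolding hermitian_def by metis
  then show ?thesis by (simp add: adjoint_mat_def cnj_mat_def transpose_def vec_eq_iff)
qed

lemma row_matrix_mult: "(F ** M) $ i = F $ i v* M"
  by (simp add: matrix_matrix_mult_def vector_matrix_mult_def vec_eq_iff mult.commute)

lemma row_matrix_mult_scale: "(c *s v) v* M = c *s (v v* (M :: complex^'n^'n))"
  by (simp add: vector_matrix_mult_def vec_eq_iff sum_distrib_left mult_ac)

lemma frame_expansion:
  fixes g :: "complex^'n^'n"
  assumes E: "E \<in> frames g"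
  shows "v v* (g ** adjoint_mat E ** F) = (\<Sum>i\<in>UNIV. hf g v (E $ i) *s (F $ i))"
    and "v = (\<Sum>i\<in>UNIV. hf g v (E $ i) *s (E $ i))"
proof -
  show 1: "v v* (g ** adjoint_mat E ** F) = (\<Sum>i\<in>UNIV. hf g v (E $ i) *s (F $ i))" for F
  proof -
    define V :: "complex^'n^'n" where "V = (\<chi> i. v)"
    have Vi: "V $ i = v" for i by (simp add: V_def)
    have "v v* (g ** adjoint_mat E ** F) = (V ** (g ** adjoint_mat E ** F)) $ k" for k
      by (simp add: row_matrix_mult Vi)
    also have "(V ** (g ** adjoint_mat E ** F)) $ k = ((V ** g ** adjoint_mat E) ** F) $ k" for k
      by (simp add: matrix_mul_assoc)
    also have "\<dots> k = (\<Sum>i\<in>UNIV. (V ** g ** adjoint_mat E) $ k $ i *s (F $ i))" for k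
      by (simp add: matrix_matrix_mult_def[of "V ** g ** adjoint_mat E" F] vec_eq_iff)
    finally show ?thesis by (simp add: hf_matrix[symmetric] Vi)
  qed
  have "E ** (g ** adjoint_mat E) = mat 1" using E by (simp add: frames_matrix matrix_mul_assoc)
  then have "g ** adjoint_mat E ** E = mat 1" by (simp add: matrix_left_right_inverse)
  with 1[of E] show "v = (\<Sum>i\<in>UNIV. hf g v (E $ i) *s (E $ i))" by simp
qed

text \<open>Take a g1-frame E that diagonalises g2, with diagonal entries \<mu>, and rescale it to a
  g2-frame E'. The matrix M reads off the coordinates of a vector in E and reassembles it with E'.
  It is one complex linear map serving all frames F, and it differs from the identity only through
  the factors 1 / sqrt \<mu> - 1, which are O(D).\<close>

lemma frame_transport:
  fixes g1 g2 :: "complex^'n^'n" and m K D :: real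
  assumes g1: "coercive m g1" and g2: "coercive m g2" and K: "K > 0"
    and g1K: "\<And>v w. norm (hf g1 v w) \<le> K * norm v * norm w"
    and D: "\<And>v w. norm (hf (g2 - g1) v w) \<le> D * norm v * norm w"
  obtains M where "\<And>F. F \<in> frames g1 \<Longrightarrow> F ** M \<in> frames g2"
    "\<And>v. norm (v v* M - v) \<le> CARD('n) * K * sqrt (K / m) / m\<^sup>2 * D * norm v"
proof -
  have m: "m > 0" and h1: "hermitian g1" and h2: "hermitian g2" using g1 g2 by (auto simp: coercive_def)
  obtain p :: "real^'n" where p: "\<And>i j. i \<noteq> j \<Longrightarrow> p $ i \<noteq> p $ j" using distinct_vector by blast
  obtain E where E: "E \<in> frames g1" and off: "\<And>i j. i \<noteq> j \<Longrightarrow> hf g2 (E $ i) (E $ j) = 0"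
    by (rule diagonalizing_frame[OF g1 frames_nonempty[OF g1] h2 p]) (assumption, rule that)
  define \<mu> where "\<mu> = (\<lambda>i. Re (hf g2 (E $ i) (E $ i)))"
  have Eii: "hf g2 (E $ i) (E $ i) = of_real (\<mu> i)" for i
    using hf_swap[OF h2, of "E $ i" "E $ i"] by (simp add: complex_eq_iff \<mu>_def)
  have E1: "hf g1 (E $ i) (E $ i) = 1" for i using E by (simp add: frames_def)
  have nE: "(norm (E $ i))\<^sup>2 \<le> 1 / m" for i using frame_norm_le[OF g1 E, of i] m by (simp add: field_simps)
  have nE': "norm (E $ i) \<le> 1 / sqrt m" for i by (rule frame_norm_le'[OF g1 E])
  have \<mu>_lower: "\<mu> i \<ge> m / K" for i
  proof -
    have "1 \<le> K * (norm (E $ i))\<^sup>2" using g1K[of "E $ i" "E $ i"] E1[of i] by (simp add: power2_eq_square mult.assoc)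
    then have "1 / K \<le> (norm (E $ i))\<^sup>2" using K by (simp add: field_simps)
    then have "m * (1 / K) \<le> m * (norm (E $ i))\<^sup>2" using m by (intro mult_left_mono) auto
    also have "\<dots> \<le> \<mu> i" using g2 by (simp add: coercive_def \<mu>_def)
    finally show ?thesis by simp
  qed
  have mK: "m / K > 0" using m K by simp
  have \<mu>_pos: "\<mu> i > 0" for i using \<mu>_lower[of i] mK by linarith
  have D0: "D \<ge> 0"
    using order_trans[OF norm_ge_zero D[of "axis undefined 1" "axis undefined 1"]]
    by (simp add: norm_axis_1)
  define r where "r = (\<lambda>i. 1 / sqrt (\<mu> i))"
  \<comment> \<open>|1 / sqrt \<mu> - 1| = |sqrt \<mu> - 1| / sqrt \<mu> <= |\<mu> - 1| / sqrt
    \<mu>, and \<open>\<mu>_lower\<close> keeps \<mu> away from 0.\<close>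
  have r_close: "\<bar>r i - 1\<bar> \<le> D / m * sqrt (K / m)" for i
  proof -
    have "\<bar>\<mu> i - 1\<bar> \<le> D / m"
    proof -
      have "hf (g2 - g1) (E $ i) (E $ i) = of_real (\<mu> i - 1)" by (simp add: hf_mat_diff Eii E1)
      then have "\<bar>\<mu> i - 1\<bar> \<le> D * (norm (E $ i))\<^sup>2"
        using D[of "E $ i" "E $ i"] by (simp only: norm_of_real power2_eq_square mult.assoc)
      also have "\<dots> \<le> D * (1 / m)" using nE D0 by (intro mult_left_mono) auto
      finally show ?thesis by simp
    qed
    moreover have "\<bar>r i - 1\<bar> \<le> \<bar>\<mu> i - 1\<bar> * r i"
    proof -
      have s: "sqrt (\<mu> i) > 0" "(sqrt (\<mu> i))\<^sup>2 = \<mu> i" using \<mu>_pos[of i] by auto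
      have "\<bar>sqrt (\<mu> i) - 1\<bar> * 1 \<le> \<bar>sqrt (\<mu> i) - 1\<bar> * \<bar>sqrt (\<mu> i) + 1\<bar>"
        using s by (intro mult_left_mono) auto
      also have "\<dots> = \<bar>\<mu> i - 1\<bar>" unfolding abs_mult[symmetric] using s(2) by (simp add: algebra_simps power2_eq_square)
      finally have "\<bar>sqrt (\<mu> i) - 1\<bar> \<le> \<bar>\<mu> i - 1\<bar>" by simp
      moreover have "\<bar>r i - 1\<bar> = \<bar>sqrt (\<mu> i) - 1\<bar> * r i"
      proof -
        have "r i - 1 = (1 - sqrt (\<mu> i)) * r i" using s by (simp add: r_def field_simps)
        then show ?thesis using s by (simp add: abs_mult r_def abs_minus_commute)
      qed
      ultimately show ?thesis using s by (simp add: r_def divide_right_mono)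
    qed
    moreover have "r i \<le> sqrt (K / m)"
    proof -
      have "sqrt (m / K) \<le> sqrt (\<mu> i)" using \<mu>_lower by simp
      then have "r i \<le> 1 / sqrt (m / K)" unfolding r_def using mK by (intro divide_left_mono) (auto simp: \<mu>_pos m K)
      then show ?thesis by (simp add: real_sqrt_divide)
    qed
    moreover have "r i \<ge> 0" using \<mu>_pos[of i] by (simp add: r_def)
    moreover have "D / m \<ge> 0" using D0 m by simp
    ultimately show ?thesis using mult_mono[of "\<bar>\<mu> i - 1\<bar>" "D / m" "r i" "sqrt (K / m)"] by linarith
  qed
  define E' :: "complex^'n^'n" where "E' = (\<chi> i. of_real (r i) *s (E $ i))"
  have E': "E' \<in> frames g2"
    unfolding frames_def
  proof (intro CollectI allI)
    fix i j
    have "r i * r i * \<mu> i = 1" using \<mu>_pos[of i] by (simp add: r_def field_simps)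
    then have "complex_of_real (r i) * (complex_of_real (r i) * complex_of_real (\<mu> i)) = 1"
      by (metis mult.assoc of_real_1 of_real_mult)
    then show "hf g2 (E' $ i) (E' $ j) = (if i = j then 1 else 0)"
      using off[of i j] by (cases "i = j") (simp_all add: E'_def hf_scale_left hf_scale_right Eii)
  qed
  define M where "M = g1 ** adjoint_mat E ** E'"
  show ?thesis
  proof
    fix F assume F: "F \<in> frames g1"
    have "(E ** g1) ** adjoint_mat E = mat 1" using E by (simp add: frames_matrix)
    then have 2: "adjoint_mat E ** (E ** g1) = mat 1" using matrix_left_right_inverse by blast
    have "adjoint_mat (F ** M) = adjoint_mat E' ** E ** g1 ** adjoint_mat F"
      by (simp add: M_def adjoint_mat_mul adjoint_mat_adjoint adjoint_mat_hermitian[OF h1] matrix_mul_assoc)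
    then have "F ** M ** g2 ** adjoint_mat (F ** M)
      = F ** g1 ** adjoint_mat E ** (E' ** g2 ** adjoint_mat E') ** E ** g1 ** adjoint_mat F"
      by (simp add: M_def matrix_mul_assoc)
    also have "\<dots> = F ** g1 ** (adjoint_mat E ** (E ** g1)) ** adjoint_mat F"
      using E' by (simp add: frames_matrix matrix_mul_assoc)
    also have "\<dots> = mat 1" using F by (simp add: 2 frames_matrix)
    finally show "F ** M \<in> frames g2" by (simp add: frames_matrix)
  next
    fix v
    have "v v* M - v = (\<Sum>i\<in>UNIV. hf g1 v (E $ i) *s (E' $ i)) - (\<Sum>i\<in>UNIV. hf g1 v (E $ i) *s (E $ i))"
      unfolding M_def frame_expansion(1)[OF E] using frame_expansion(2)[OF E, of v] by simp
    also have "\<dots> = (\<Sum>i\<in>UNIV. (hf g1 v (E $ i) * of_real (r i - 1)) *s (E $ i))"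
      unfolding sum_subtractf[symmetric] by (intro sum.cong refl) (simp add: E'_def vec_eq_iff algebra_simps)
    finally have eq: "v v* M - v = (\<Sum>i\<in>UNIV. (hf g1 v (E $ i) * of_real (r i - 1)) *s (E $ i))" .
    have "norm (v v* M - v) \<le> (\<Sum>i\<in>(UNIV::'n set). (K * norm v * (1 / sqrt m)) * (D / m * sqrt (K / m)) * (1 / sqrt m))"
      unfolding eq
    proof (intro order_trans[OF norm_sum] sum_mono)
      fix i
      have "norm (hf g1 v (E $ i)) \<le> K * norm v * (1 / sqrt m)"
        using g1K[of v "E $ i"] mult_left_mono[OF nE'[of i], of "K * norm v"] K by simp
      moreover have "norm (complex_of_real (r i - 1)) \<le> D / m * sqrt (K / m)" using r_close[of i] by (simp only: norm_of_real)
      ultimately show "norm ((hf g1 v (E $ i) * of_real (r i - 1)) *s (E $ i)) \<le> (K * norm v * (1 / sqrt m)) * (D / m * sqrt (K / m)) * (1 / sqrt m)"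
        unfolding norm_vector_smult norm_mult[of "hf g1 v (E $ i)"] using K m D0 nE'[of i]
        by (intro mult_mono mult_nonneg_nonneg) auto
    qed
    also have "\<dots> = CARD('n) * K * sqrt (K / m) / m\<^sup>2 * D * norm v"
    proof -
      have "1 / sqrt m * (1 / sqrt m) = 1 / m" using m by (simp add: field_simps)
      moreover have "a * x * y * x = a * y * (x * x)" for a x y :: real by simp
      ultimately have "(K * norm v * (1 / sqrt m)) * (D / m * sqrt (K / m)) * (1 / sqrt m) = K * norm v * (D / m * sqrt (K / m)) * (1 / m)"
        by (simp only:)
      then show ?thesis by (simp only: sum_constant) (simp add: power2_eq_square)
    qed
    finally show "norm (v v* M - v) \<le> CARD('n) * K * sqrt (K / m) / m\<^sup>2 * D * norm v" .
  qed
qed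

section \<open>Holomorphic functions are of class C2\<close>

text \<open>Needed because \<open>loc c P\<close> agrees with the intended quadratic only on the
  image of the chart; outside it the value of \<open>inv_into\<close> is arbitrary.\<close>

lemma dd_cong_open:
  assumes S: "open S" and eq: "\<And>y. y \<in> S \<Longrightarrow> h y = h' y" and z: "z \<in> S"
  shows "dd h vs z = dd h' vs z"
  using z
proof (induction vs arbitrary: z)
  case Nil then show ?case using eq by simp
next
  case (Cons v vs)
  have "\<forall>\<^sub>F t in nhds (0::real). z + t *\<^sub>R v \<in> S"
  proof -
    have "open ((\<lambda>t::real. z + t *\<^sub>R v) -` S)" by (intro open_vimage S continuous_intros)
    then show ?thesis using eventually_nhds_in_open[of "(\<lambda>t::real. z + t *\<^sub>R v) -` S" 0] Cons.prems by simp
  qed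
  then have "\<forall>\<^sub>F t in nhds 0. dd h vs (z + t *\<^sub>R v) = dd h' vs (z + t *\<^sub>R v)"
    by (rule eventually_mono) (rule Cons.IH)
  then show ?case by (simp add: deriv_cong_ev)
qed

lemma dd_quadratic:
  fixes B :: "'a::euclidean_space \<Rightarrow> 'a \<Rightarrow> real" and a :: real and z0 :: 'a
  assumes l: "linear l" and B: "bilinear B"
  defines "q \<equiv> \<lambda>y. a + l (y - z0) + B (y - z0) (y - z0) / 2"
  shows "dd q [v] z = l v + (B (z - z0) v + B v (z - z0)) / 2"
    and "dd q [u, v] z = (B u v + B v u) / 2"
proof -
  have 1: "dd q [v] z = l v + (B (z - z0) v + B v (z - z0)) / 2" for z v
  proof -
    have eq: "q (z + t *\<^sub>R v) = q z + t * (l v + (B (z - z0) v + B v (z - z0)) / 2) + t\<^sup>2 * (B v v / 2)" for t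
    proof -
      have *: "z + t *\<^sub>R v - z0 = (z - z0) + t *\<^sub>R v" by simp
      show ?thesis
        unfolding q_def * linear_add[OF l] bilinear_ladd[OF B] bilinear_radd[OF B] linear_cmul[OF l]
          bilinear_lmul[OF B] bilinear_rmul[OF B]
        by (simp add: field_simps power2_eq_square)
    qed
    have "((\<lambda>t. q (z + t *\<^sub>R v)) has_real_derivative (l v + (B (z - z0) v + B v (z - z0)) / 2)) (at 0)"
      unfolding eq by (auto intro!: derivative_eq_intros)
    then show ?thesis by (simp add: DERIV_imp_deriv)
  qed
  then show "dd q [v] z = l v + (B (z - z0) v + B v (z - z0)) / 2" .
  have "dd q [u, v] z = deriv (\<lambda>t. l v + (B (z + t *\<^sub>R u - z0) v + B v (z + t *\<^sub>R u - z0)) / 2) 0"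
    unfolding dd.simps(2)[of q u "[v]"] 1 ..
  also have "\<dots> = (B u v + B v u) / 2"
  proof (rule DERIV_imp_deriv)
    have eq: "l v + (B (z + t *\<^sub>R u - z0) v + B v (z + t *\<^sub>R u - z0)) / 2
      = l v + (B (z - z0) v + B v (z - z0)) / 2 + t * ((B u v + B v u) / 2)" for t
    proof -
      have *: "z + t *\<^sub>R u - z0 = (z - z0) + t *\<^sub>R u" by simp
      show ?thesis
        unfolding * bilinear_ladd[OF B] bilinear_radd[OF B] bilinear_lmul[OF B] bilinear_rmul[OF B]
        by (simp add: field_simps)
    qed
    show "((\<lambda>t. l v + (B (z + t *\<^sub>R u - z0) v + B v (z + t *\<^sub>R u - z0)) / 2) has_real_derivative (B u v + B v u) / 2) (at 0)"
      unfolding eq by (auto intro!: derivative_eq_intros)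
  qed
  finally show "dd q [u, v] z = (B u v + B v u) / 2" .
qed

text \<open>Formulated with witnesses for the derivatives instead of \<open>deriv\<close>, so that
  closure under sums and products follows by exhibiting the new derivative;
  \<open>C2f_imp_Ck_on\<close> translates back.\<close>

definition C1f :: "'a::real_normed_vector set \<Rightarrow> ('a \<Rightarrow> real) \<Rightarrow> bool" where
  "C1f S f \<longleftrightarrow> continuous_on S f \<and> (\<forall>v. \<exists>f1. continuous_on S f1 \<and>
     (\<forall>z\<in>S. ((\<lambda>t. f (z + t *\<^sub>R v)) has_real_derivative f1 z) (at 0)))"

definition C2f :: "'a::real_normed_vector set \<Rightarrow> ('a \<Rightarrow> real) \<Rightarrow> bool" where
  "C2f S f \<longleftrightarrow> continuous_on S f \<and> (\<forall>v. \<exists>f1. C1f S f1 \<and>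
     (\<forall>z\<in>S. ((\<lambda>t. f (z + t *\<^sub>R v)) has_real_derivative f1 z) (at 0)))"

lemma C2f_imp_C1f: "C2f S f \<Longrightarrow> C1f S f"
  unfolding C1f_def C2f_def by metis

lemma C1f_const: "C1f S (\<lambda>z. c)"
  unfolding C1f_def by (auto intro!: exI[of _ "\<lambda>z. 0"])

lemma C2f_const: "C2f S (\<lambda>z. c)"
  unfolding C2f_def by (auto intro!: exI[of _ "\<lambda>z. 0"] C1f_const)

lemma C1f_add:
  assumes f: "C1f S f" and g: "C1f S g" shows "C1f S (\<lambda>z. f z + g z)"
  unfolding C1f_def
proof (intro conjI allI)
  show "continuous_on S (\<lambda>z. f z + g z)" using f g by (auto simp: C1f_def intro: continuous_on_add)
  fix v
  obtain f1 g1 where *: "continuous_on S f1" "\<And>z. z \<in> S \<Longrightarrow> ((\<lambda>t. f (z + t *\<^sub>R v)) has_real_derivative f1 z) (at 0)"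
    "continuous_on S g1" "\<And>z. z \<in> S \<Longrightarrow> ((\<lambda>t. g (z + t *\<^sub>R v)) has_real_derivative g1 z) (at 0)"
    using f g unfolding C1f_def by meson
  then show "\<exists>f1. continuous_on S f1 \<and> (\<forall>z\<in>S. ((\<lambda>t. f (z + t *\<^sub>R v) + g (z + t *\<^sub>R v)) has_real_derivative f1 z) (at 0))"
    by (intro exI[of _ "\<lambda>z. f1 z + g1 z"]) (auto intro: continuous_on_add DERIV_add)
qed

lemma C1f_mult:
  assumes f: "C1f S f" and g: "C1f S g" shows "C1f S (\<lambda>z. f z * g z)"
  unfolding C1f_def
proof (intro conjI allI)
  show "continuous_on S (\<lambda>z. f z * g z)" using f g by (auto simp: C1f_def intro: continuous_on_mult)
  fix v
  obtain f1 g1 where *: "continuous_on S f1" "\<And>z. z \<in> S \<Longrightarrow> ((\<lambda>t. f (z + t *\<^sub>R v)) has_real_derivative f1 z) (at 0)"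
    "continuous_on S g1" "\<And>z. z \<in> S \<Longrightarrow> ((\<lambda>t. g (z + t *\<^sub>R v)) has_real_derivative g1 z) (at 0)"
    using f g unfolding C1f_def by meson
  have "((\<lambda>t. f (z + t *\<^sub>R v) * g (z + t *\<^sub>R v)) has_real_derivative f1 z * g z + g1 z * f z) (at 0)" if "z \<in> S" for z
    using DERIV_mult[OF *(2)[OF that] *(4)[OF that]] by simp
  moreover have "continuous_on S (\<lambda>z. f1 z * g z + g1 z * f z)"
    using * f g by (auto simp: C1f_def intro!: continuous_on_add continuous_on_mult)
  ultimately show "\<exists>f1. continuous_on S f1 \<and> (\<forall>z\<in>S. ((\<lambda>t. f (z + t *\<^sub>R v) * g (z + t *\<^sub>R v)) has_real_derivative f1 z) (at 0))"
    by blast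
qed

lemma C2f_add:
  assumes f: "C2f S f" and g: "C2f S g" shows "C2f S (\<lambda>z. f z + g z)"
  unfolding C2f_def
proof (intro conjI allI)
  show "continuous_on S (\<lambda>z. f z + g z)" using f g by (auto simp: C2f_def intro: continuous_on_add)
  fix v
  obtain f1 g1 where *: "C1f S f1" "\<And>z. z \<in> S \<Longrightarrow> ((\<lambda>t. f (z + t *\<^sub>R v)) has_real_derivative f1 z) (at 0)"
    "C1f S g1" "\<And>z. z \<in> S \<Longrightarrow> ((\<lambda>t. g (z + t *\<^sub>R v)) has_real_derivative g1 z) (at 0)"
    using f g unfolding C2f_def by meson
  then show "\<exists>f1. C1f S f1 \<and> (\<forall>z\<in>S. ((\<lambda>t. f (z + t *\<^sub>R v) + g (z + t *\<^sub>R v)) has_real_derivative f1 z) (at 0))"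
    by (intro exI[of _ "\<lambda>z. f1 z + g1 z"]) (auto intro: C1f_add DERIV_add)
qed

lemma C2f_mult:
  assumes f: "C2f S f" and g: "C2f S g" shows "C2f S (\<lambda>z. f z * g z)"
  unfolding C2f_def
proof (intro conjI allI)
  show "continuous_on S (\<lambda>z. f z * g z)" using f g by (auto simp: C2f_def intro: continuous_on_mult)
  fix v
  obtain f1 g1 where *: "C1f S f1" "\<And>z. z \<in> S \<Longrightarrow> ((\<lambda>t. f (z + t *\<^sub>R v)) has_real_derivative f1 z) (at 0)"
    "C1f S g1" "\<And>z. z \<in> S \<Longrightarrow> ((\<lambda>t. g (z + t *\<^sub>R v)) has_real_derivative g1 z) (at 0)"
    using f g unfolding C2f_def by meson
  have "((\<lambda>t. f (z + t *\<^sub>R v) * g (z + t *\<^sub>R v)) has_real_derivative f1 z * g z + g1 z * f z) (at 0)" if "z \<in> S" for z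
    using DERIV_mult[OF *(2)[OF that] *(4)[OF that]] by simp
  moreover have "C1f S (\<lambda>z. f1 z * g z + g1 z * f z)"
    by (rule C1f_add[OF C1f_mult[OF *(1) C2f_imp_C1f[OF g]] C1f_mult[OF *(3) C2f_imp_C1f[OF f]]])
  ultimately show "\<exists>f1. C1f S f1 \<and> (\<forall>z\<in>S. ((\<lambda>t. f (z + t *\<^sub>R v) * g (z + t *\<^sub>R v)) has_real_derivative f1 z) (at 0))"
    by blast
qed

lemma C2f_sum:
  assumes "\<And>i. i \<in> I \<Longrightarrow> C2f S (f i)" shows "C2f S (\<lambda>z. \<Sum>i\<in>I. f i z)"
  using assms
proof (induction I rule: infinite_finite_induct)
  case (insert i I)
  have "C2f S (\<lambda>z. f i z + (\<Sum>i\<in>I. f i z))" by (rule C2f_add) (use insert in auto)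
  then show ?case using insert by simp
qed (simp_all add: C2f_const)

lemma C2f_imp_Ck_on:
  assumes S: "open S" and f: "C2f S f" shows "Ck_on 2 S f"
proof -
  have "\<forall>v. \<exists>f1. C1f S f1 \<and> (\<forall>z\<in>S. ((\<lambda>t. f (z + t *\<^sub>R v)) has_real_derivative f1 z) (at 0))"
    using f by (simp add: C2f_def)
  from choice[OF this] obtain f1 where f1: "\<And>v. C1f S (f1 v)"
    "\<And>v z. z \<in> S \<Longrightarrow> ((\<lambda>t. f (z + t *\<^sub>R v)) has_real_derivative f1 v z) (at 0)" by blast
  have "\<forall>p. \<exists>g. continuous_on S g \<and> (\<forall>z\<in>S. ((\<lambda>t. f1 (snd p) (z + t *\<^sub>R fst p)) has_real_derivative g z) (at 0))"
    using f1(1) by (simp add: C1f_def)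
  from choice[OF this] obtain g where g: "\<And>p. continuous_on S (g p)"
    "\<And>p z. z \<in> S \<Longrightarrow> ((\<lambda>t. f1 (snd p) (z + t *\<^sub>R fst p)) has_real_derivative g p z) (at 0)" by blast
  define f2 where "f2 = (\<lambda>u v. g (u, v))"
  have f2: "\<And>u v. continuous_on S (f2 u v)"
    "\<And>u v z. z \<in> S \<Longrightarrow> ((\<lambda>t. f1 v (z + t *\<^sub>R u)) has_real_derivative f2 u v z) (at 0)"
    using g(1) g(2)[of _ "(_, _)"] by (auto simp: f2_def)
  have d1: "dd f [v] z = f1 v z" if "z \<in> S" for v z
    using f1(2)[OF that, of v] by (simp add: DERIV_imp_deriv)
  have near: "\<forall>\<^sub>F t in nhds (0::real). dd f [v] (z + t *\<^sub>R u) = f1 v (z + t *\<^sub>R u)" if "z \<in> S" for u v z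
  proof -
    have "open ((\<lambda>t::real. z + t *\<^sub>R u) -` S)" by (intro open_vimage S continuous_intros)
    then have "\<forall>\<^sub>F t in nhds (0::real). z + t *\<^sub>R u \<in> S"
      using eventually_nhds_in_open[of "(\<lambda>t::real. z + t *\<^sub>R u) -` S" 0] that by simp
    then show ?thesis by (rule eventually_mono) (rule d1)
  qed
  have d2': "((\<lambda>t. dd f [v] (z + t *\<^sub>R u)) has_real_derivative f2 u v z) (at 0)" if z: "z \<in> S" for u v z
    using f2(2)[OF z] DERIV_cong_ev[OF refl near[OF z] refl] by blast
  have d2: "dd f [u, v] z = f2 u v z" if z: "z \<in> S" for u v z
    unfolding dd.simps(2)[of f u "[v]"] by (rule DERIV_imp_deriv[OF d2'[OF z]])
  show ?thesis
    unfolding Ck_on_def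
  proof (intro conjI allI impI S)
    fix vs :: "'a list" assume "length vs \<le> 2"
    then consider "vs = []" | v where "vs = [v]" | u v where "vs = [u, v]"
      by (cases vs rule: remdups_adj.cases) (auto simp: Suc_le_eq)
    then show "continuous_on S (dd f vs)"
    proof cases
      case 1 then show ?thesis using f by (simp add: C2f_def)
    next
      case 2
      have "continuous_on S (f1 v)" using f1(1) by (simp add: C1f_def)
      then show ?thesis unfolding 2 by (subst continuous_on_cong[OF refl d1]) auto
    next
      case 3 show ?thesis unfolding 3 by (subst continuous_on_cong[OF refl d2]) (auto intro: f2)
    qed
  next
    fix vs :: "'a list" and v z assume "length vs < 2" and z: "z \<in> S"
    then consider "vs = []" | u where "vs = [u]" by (cases vs; cases "tl vs") auto
    then show "(\<lambda>t. dd f vs (z + t *\<^sub>R v)) differentiable (at 0)"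
    proof cases
      case 1 then show ?thesis using f1(2)[OF z] real_differentiable_def by auto
    next
      case 2 then show ?thesis using d2'[OF z] real_differentiable_def by blast
    qed
  qed
qed

lemma complex_linear_scale:
  fixes L :: "complex^'n \<Rightarrow> complex"
  assumes L: "linear L" and i: "\<And>v. L (\<i> *s v) = \<i> * L v"
  shows "L (c *s v) = c * L v"
proof -
  have "c *s v = Re c *\<^sub>R v + Im c *\<^sub>R (\<i> *s v)" by (simp add: vec_eq_iff complex_eq_iff)
  then have "L (c *s v) = Re c *\<^sub>R L v + Im c *\<^sub>R (\<i> * L v)"
    by (simp only: linear_add[OF L] linear_cmul[OF L] i)
  then show ?thesis by (simp add: complex_eq_iff)
qed

text \<open>A complex differentiable function is C^2: by Cauchy's formula along a complex line, every directional derivative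
  is an average of translates of the function, and averaging preserves continuity and directional differentiability.\<close>

definition cauchy_average :: "real \<Rightarrow> complex^'n \<Rightarrow> (complex^'n \<Rightarrow> complex) \<Rightarrow> complex^'n \<Rightarrow> complex" where
  "cauchy_average r v G z = integral (cbox 0 1) (\<lambda>\<theta>. G (z + circlepath 0 r \<theta> *s v) / circlepath 0 r \<theta>)"

lemma circlepath_norm: "r > 0 \<Longrightarrow> norm (circlepath 0 r \<theta>) = r"
  by (simp add: circlepath norm_mult)

lemma cauchy_average_continuous:
  fixes v :: "complex^'n"
  assumes G: "continuous_on S G" and r: "r > 0"
    and sub: "\<And>z \<zeta>. z \<in> U \<Longrightarrow> norm \<zeta> \<le> r \<Longrightarrow> z + \<zeta> *s v \<in> S"
  shows "continuous_on U (cauchy_average r v G)"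
  unfolding cauchy_average_def[abs_def]
proof (rule integral_continuous_on_param)
  have c: "continuous_on T (\<lambda>p. circlepath 0 r (snd p))" for T :: "((complex^'n) \<times> real) set"
    unfolding circlepath by (intro continuous_intros)
  have nz: "circlepath 0 r \<theta> \<noteq> 0" for \<theta> using circlepath_norm[OF r, of \<theta>] r by auto
  have cs: "continuous_on T (\<lambda>p. fst p + circlepath 0 r (snd p) *s v)" for T :: "((complex^'n) \<times> real) set"
    unfolding vector_scalar_mult_def by (intro continuous_intros c)
  have "continuous_on (U \<times> cbox 0 1) (\<lambda>p. G (fst p + circlepath 0 r (snd p) *s v) / circlepath 0 r (snd p))"
    by (intro continuous_on_divide continuous_on_compose2[OF G cs] c)
       (use sub circlepath_norm[OF r] nz in auto)
  then show "continuous_on (U \<times> cbox 0 1) (\<lambda>(z, \<theta>). G (z + circlepath 0 r \<theta> *s v) / circlepath 0 r \<theta>)"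
    by (simp add: case_prod_beta)
qed

text \<open>Differentiation under the integral sign along z + t u. Restricting t to the interval I
  keeps all translated circles inside S.\<close>

lemma cauchy_average_derivative:
  fixes z u v :: "complex^'n"
  assumes G: "continuous_on S G" and G1: "continuous_on S G1" and S: "open S"
    and der: "\<And>y. y \<in> S \<Longrightarrow> ((\<lambda>t. G (y + t *\<^sub>R u)) has_vector_derivative G1 y) (at 0)"
    and r: "r > 0" and U: "open U" "z \<in> U"
    and sub: "\<And>z \<zeta>. z \<in> U \<Longrightarrow> norm \<zeta> \<le> r \<Longrightarrow> z + \<zeta> *s v \<in> S"
  shows "((\<lambda>t. cauchy_average r v G (z + t *\<^sub>R u)) has_vector_derivative cauchy_average r v G1 z) (at 0)"
proof -
  obtain \<delta> where \<delta>: "\<delta> > 0" "ball z \<delta> \<subseteq> U" using U openE by blast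
  define I where "I = {t::real. z + t *\<^sub>R u \<in> ball z \<delta>}"
  have I: "open I" "0 \<in> I"
  proof -
    have "I = (\<lambda>t. z + t *\<^sub>R u) -` ball z \<delta>" by (auto simp: I_def)
    then show "open I" by (simp only:) (intro open_vimage open_ball continuous_intros)
    show "0 \<in> I" using \<delta> by (simp add: I_def)
  qed
  have cI: "convex I"
  proof -
    have "I = {t. \<bar>t\<bar> * norm u < \<delta>}" by (simp add: I_def dist_norm)
    also have "\<dots> = (\<lambda>t. t *\<^sub>R u) -` ball 0 \<delta>" by (auto simp: dist_norm)
    also have "convex \<dots>" by (intro convex_linear_vimage) (auto simp: linear_iff algebra_simps)
    finally show ?thesis .
  qed
  have IU: "z + t *\<^sub>R u \<in> U" if "t \<in> I" for t using that \<delta> by (auto simp: I_def)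
  have nz: "circlepath 0 r \<theta> \<noteq> 0" for \<theta> using circlepath_norm[OF r, of \<theta>] r by auto
  have inS: "z + t *\<^sub>R u + circlepath 0 r \<theta> *s v \<in> S" if "t \<in> I" for t \<theta>
    by (rule sub[OF IU[OF that]]) (simp add: circlepath_norm[OF r])
  have c: "continuous_on T (\<lambda>p. circlepath 0 r (snd p))" for T :: "(real \<times> real) set"
    unfolding circlepath by (intro continuous_intros)
  have cs: "continuous_on T (\<lambda>p. z + fst p *\<^sub>R u + circlepath 0 r (snd p) *s v)" for T :: "(real \<times> real) set"
    unfolding vector_scalar_mult_def by (intro continuous_intros c)
  have cont: "continuous_on (I \<times> T) (\<lambda>p. H (z + fst p *\<^sub>R u + circlepath 0 r (snd p) *s v) / circlepath 0 r (snd p))"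
    if "continuous_on S H" for H T
    by (intro continuous_on_divide continuous_on_compose2[OF that cs] c) (use inS nz in auto)
  have "((\<lambda>t. integral (cbox 0 1) (\<lambda>\<theta>. G (z + t *\<^sub>R u + circlepath 0 r \<theta> *s v) / circlepath 0 r \<theta>)) has_vector_derivative
      integral (cbox 0 1) (\<lambda>\<theta>. G1 (z + 0 *\<^sub>R u + circlepath 0 r \<theta> *s v) / circlepath 0 r \<theta>)) (at 0 within I)"
  proof (rule leibniz_rule_vector_derivative[where fx = "\<lambda>t \<theta>. G1 (z + t *\<^sub>R u + circlepath 0 r \<theta> *s v) / circlepath 0 r \<theta>"])
    fix t \<theta> :: real assume t: "t \<in> I"
    let ?y = "z + t *\<^sub>R u + circlepath 0 r \<theta> *s v"
    have "((\<lambda>s. s - t) has_vector_derivative 1) (at t)" by (auto intro!: derivative_eq_intros)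
    then have comp: "((\<lambda>s. G (?y + s *\<^sub>R u)) \<circ> (\<lambda>s. s - t) has_vector_derivative 1 *\<^sub>R G1 ?y) (at t)"
      by (rule vector_diff_chain_at) (use der[OF inS[OF t]] in simp)
    have eq: "((\<lambda>s. G (?y + s *\<^sub>R u)) \<circ> (\<lambda>s. s - t)) = (\<lambda>s. G (z + s *\<^sub>R u + circlepath 0 r \<theta> *s v))"
      by (rule ext) (simp add: algebra_simps)
    have "((\<lambda>s. G (z + s *\<^sub>R u + circlepath 0 r \<theta> *s v)) has_vector_derivative G1 ?y) (at t)"
      using comp unfolding eq scaleR_one .
    from has_vector_derivative_mult_left[OF this, of "inverse (circlepath 0 r \<theta>)"]
    show "((\<lambda>t. G (z + t *\<^sub>R u + circlepath 0 r \<theta> *s v) / circlepath 0 r \<theta>) has_vector_derivative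
        G1 (z + t *\<^sub>R u + circlepath 0 r \<theta> *s v) / circlepath 0 r \<theta>) (at t within I)"
      unfolding divide_inverse by (rule has_vector_derivative_at_within)
  next
    fix t assume t: "t \<in> I"
    have "continuous_on (cbox 0 1) (\<lambda>\<theta>. G (z + t *\<^sub>R u + circlepath 0 r \<theta> *s v) / circlepath 0 r \<theta>)"
    proof -
      have "continuous_on (cbox 0 1) (\<lambda>\<theta>. (t, \<theta>))" by (intro continuous_intros)
      from continuous_on_compose2[OF cont[OF G, of UNIV] this] t show ?thesis by (simp add: image_subset_iff)
    qed
    then show "(\<lambda>\<theta>. G (z + t *\<^sub>R u + circlepath 0 r \<theta> *s v) / circlepath 0 r \<theta>) integrable_on cbox 0 1"
      by (rule integrable_continuous)
  next
    show "continuous_on (I \<times> cbox 0 1) (\<lambda>(t, \<theta>). G1 (z + t *\<^sub>R u + circlepath 0 r \<theta> *s v) / circlepath 0 r \<theta>)"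
      using cont[OF G1, of "cbox 0 1"] by (simp add: case_prod_beta)
  qed (rule I cI)+
  then show ?thesis
    unfolding cauchy_average_def at_within_open[OF I(2) I(1)] by (simp only: scaleR_zero_left add_0_right)
qed

text \<open>Cauchy's formula for the derivative at 0 of the one-variable function \<zeta> -> F(z +
  \<zeta> v); on the circle the line element contributes a factor \<zeta>, which cancels one of the
  two powers in the denominator.\<close>

lemma cauchy_average_eq:
  fixes F :: "complex^'n \<Rightarrow> complex"
  assumes r: "r > 0" and e: "e > r"
    and F: "\<And>\<zeta>. norm \<zeta> < e \<Longrightarrow> \<exists>L. (F has_derivative L) (at (z + \<zeta> *s v)) \<and> (\<forall>v. L (\<i> *s v) = \<i> * L v)"
    and L: "(F has_derivative L) (at z)" "\<And>v. L (\<i> *s v) = \<i> * L v"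
  shows "L v = cauchy_average r v F z"
proof -
  define h where "h = (\<lambda>\<zeta>. F (z + \<zeta> *s v))"
  have smult: "((\<lambda>\<zeta>. z + \<zeta> *s v) has_derivative (\<lambda>\<zeta>. \<zeta> *s v)) (at \<zeta>)" for \<zeta> :: complex
  proof -
    have "bounded_linear (\<lambda>\<zeta>. \<zeta> *s v)"
      by (rule linear_conv_bounded_linear[THEN iffD1]) (simp add: linear_iff vec_eq_iff algebra_simps)
    then show ?thesis by (auto intro!: derivative_eq_intros bounded_linear_imp_has_derivative)
  qed
  have der: "(h has_field_derivative M v) (at \<zeta>)"
    if "(F has_derivative M) (at (z + \<zeta> *s v))" "\<forall>v. M (\<i> *s v) = \<i> * M v" for \<zeta> M
  proof -
    have "(h has_derivative (\<lambda>x. M (x *s v))) (at \<zeta>)"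
      unfolding h_def using has_derivative_compose[OF smult that(1)] .
    moreover have "M (x *s v) = M v * x" for x
      using complex_linear_scale[of M x v] that has_derivative_linear[OF that(1)] by (simp add: mult.commute)
    ultimately show ?thesis by (simp add: has_field_derivative_def)
  qed
  have hol: "h holomorphic_on ball 0 e"
    unfolding holomorphic_on_open[OF open_ball] using F der by (metis mem_ball_0)
  have d0: "(h has_field_derivative L v) (at 0)" by (rule der) (use L in auto)
  have "(h has_field_derivative (1 / (2 * of_real pi * \<i>) * contour_integral(circlepath 0 r) (\<lambda>u. h u / (u-0)^2))) (at 0)"
    by (rule Cauchy_derivative_integral_circlepath(2)[of 0 r h 0])
       (use e r in \<open>auto intro!: continuous_on_subset[OF holomorphic_on_imp_continuous_on[OF hol]]
          holomorphic_on_subset[OF hol]\<close>)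
  then have "L v = 1 / (2 * of_real pi * \<i>) * contour_integral(circlepath 0 r) (\<lambda>u. h u / u^2)"
    using d0 DERIV_unique by force
  also have "contour_integral(circlepath 0 r) (\<lambda>u. h u / u^2)
    = integral {0..1} (\<lambda>\<theta>. h (circlepath 0 r \<theta>) / (circlepath 0 r \<theta>)^2 * vector_derivative (circlepath 0 r) (at \<theta>))"
    by (rule contour_integral_integral)
  also have "\<dots> = integral {0..1} (\<lambda>\<theta>. (2 * of_real pi * \<i>) * (h (circlepath 0 r \<theta>) / circlepath 0 r \<theta>))"
  proof (intro Henstock_Kurzweil_Integration.integral_cong)
    fix \<theta> :: real
    have nz: "circlepath 0 r \<theta> \<noteq> 0" using circlepath_norm[OF r, of \<theta>] r by auto
    have "vector_derivative (circlepath 0 r) (at \<theta>) = 2 * of_real pi * \<i> * circlepath 0 r \<theta>"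
      unfolding vector_derivative_circlepath by (simp add: circlepath mult_ac)
    then show "h (circlepath 0 r \<theta>) / (circlepath 0 r \<theta>)^2 * vector_derivative (circlepath 0 r) (at \<theta>)
      = (2 * of_real pi * \<i>) * (h (circlepath 0 r \<theta>) / circlepath 0 r \<theta>)"
      using nz by (simp add: power2_eq_square)
  qed
  also have "\<dots> = (2 * of_real pi * \<i>) * cauchy_average r v F z"
    unfolding cauchy_average_def h_def box_real by (rule integral_mult_right)
  finally show ?thesis by simp
qed

text \<open>The derivative in direction v is locally an average of F, hence continuous.
  Differentiating that average in direction u puts the u-derivative of F in place of F; since this
  was just shown to be continuous, the second derivatives are continuous averages as well.
  \<open>P\<close> stands for the real or imaginary part.\<close>

lemma holomorphic_C2f:
  fixes F :: "complex^'n \<Rightarrow> complex" and P :: "complex \<Rightarrow> real"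
  assumes S: "open S" and F: "\<And>z. z \<in> S \<Longrightarrow> \<exists>L. (F has_derivative L) (at z) \<and> (\<forall>v. L (\<i> *s v) = \<i> * L v)"
    and P: "bounded_linear P"
  shows "C2f S (\<lambda>z. P (F z))"
proof -
  define D where "D = (\<lambda>z. frechet_derivative F (at z))"
  have D: "(F has_derivative D z) (at z)" "D z (\<i> *s v) = \<i> * D z v" if "z \<in> S" for z v
  proof -
    obtain L where L: "(F has_derivative L) (at z)" "\<forall>v. L (\<i> *s v) = \<i> * L v" using F[OF \<open>z \<in> S\<close>] by blast
    then have "D z = L" unfolding D_def by (metis frechet_derivative_at)
    with L show "(F has_derivative D z) (at z)" "D z (\<i> *s v) = \<i> * D z v" by auto
  qed
  have Fc: "continuous_on S F"
    by (rule continuous_at_imp_continuous_on) (use D(1) has_derivative_continuous in blast)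
  have local: "\<exists>r U. r > 0 \<and> open U \<and> z0 \<in> U \<and> U \<subseteq> S \<and> (\<forall>z\<in>U. \<forall>\<zeta>. norm \<zeta> \<le> r \<longrightarrow> z + \<zeta> *s v \<in> S) \<and>
      (\<forall>z\<in>U. D z v = cauchy_average r v F z)" if z0: "z0 \<in> S" for z0 v
  proof -
    obtain e where e: "e > 0" "ball z0 e \<subseteq> S" using S z0 openE by blast
    define r where "r = e / (4 * (norm v + 1))"
    have r: "r > 0" using e by (simp add: r_def add_nonneg_pos)
    have near: "z + \<zeta> *s v \<in> S" if "z \<in> ball z0 (e / 2)" "norm \<zeta> < 2 * r" for z \<zeta>
    proof -
      have "norm (\<zeta> *s v) \<le> norm \<zeta> * (norm v + 1)" by (simp add: norm_vector_smult mult_left_mono)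
      also have "\<dots> < 2 * r * (norm v + 1)" using that(2) by (intro mult_strict_right_mono) (simp_all add: add_nonneg_pos)
      also have "\<dots> = e / 2"
      proof -
        have "2 * (e / (4 * a)) * a = e / 2" if "a \<noteq> 0" for a :: real using that by simp
        moreover have "norm v + 1 \<noteq> 0" using norm_ge_zero[of v] by linarith
        ultimately show ?thesis unfolding r_def by blast
      qed
      finally have "norm (\<zeta> *s v) < e / 2" .
      moreover have "norm (z - z0) < e / 2" using that(1) by (simp add: dist_norm norm_minus_commute)
      ultimately have "z + \<zeta> *s v \<in> ball z0 e"
        using norm_triangle_ineq[of "z - z0" "\<zeta> *s v"] by (simp add: dist_norm norm_minus_commute[of z0] algebra_simps)
      then show ?thesis using e by blast
    qed
    have z0S: "z \<in> S" if "z \<in> ball z0 (e / 2)" for z using near[OF that, of 0] r by simp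
    have avg: "D z v = cauchy_average r v F z" if z: "z \<in> ball z0 (e / 2)" for z
    proof (rule cauchy_average_eq[OF r, of "2 * r"])
      fix \<zeta> :: complex assume "norm \<zeta> < 2 * r"
      then show "\<exists>L. (F has_derivative L) (at (z + \<zeta> *s v)) \<and> (\<forall>v. L (\<i> *s v) = \<i> * L v)" by (intro F near z)
    qed (use r D[OF z0S[OF z]] in auto)
    show ?thesis
    proof (intro exI[of _ r] exI[of _ "ball z0 (e / 2)"] conjI ballI allI impI r open_ball avg)
      show "z0 \<in> ball z0 (e / 2)" using e by simp
      show "ball z0 (e / 2) \<subseteq> S" using z0S by blast
      fix z \<zeta> assume "z \<in> ball z0 (e / 2)" "cmod \<zeta> \<le> r"
      then show "z + \<zeta> *s v \<in> S" using r by (intro near) auto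
    qed
  qed
  have Dc: "continuous_on S (\<lambda>z. D z v)" for v
  proof (rule continuous_at_imp_continuous_on, rule ballI)
    fix z0 assume "z0 \<in> S"
    from local[OF this, of v] obtain r U where rU: "r > 0" "open U" "z0 \<in> U" "U \<subseteq> S"
      "\<And>z \<zeta>. z \<in> U \<Longrightarrow> norm \<zeta> \<le> r \<Longrightarrow> z + \<zeta> *s v \<in> S" "\<And>z. z \<in> U \<Longrightarrow> D z v = cauchy_average r v F z" by blast
    have "continuous_on U (cauchy_average r v F)" by (rule cauchy_average_continuous[OF Fc rU(1,5)])
    then have "continuous_on U (\<lambda>z. D z v)" by (subst continuous_on_cong[OF refl rU(6)]) auto
    then show "isCont (\<lambda>z. D z v) z0" using rU(2,3) continuous_on_eq_continuous_at by blast
  qed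
  have der1: "((\<lambda>t. F (y + t *\<^sub>R u)) has_vector_derivative D y u) (at 0)" if "y \<in> S" for y u
  proof -
    have "((\<lambda>t. y + t *\<^sub>R u) has_derivative (\<lambda>t. t *\<^sub>R u)) (at 0)" by (auto intro!: derivative_eq_intros)
    moreover have "(F has_derivative D y) (at (y + 0 *\<^sub>R u))" using D(1)[OF that] by simp
    ultimately have "((\<lambda>t. F (y + t *\<^sub>R u)) has_derivative (\<lambda>t. D y (t *\<^sub>R u))) (at 0)" by (rule has_derivative_compose)
    then show ?thesis
      unfolding has_vector_derivative_def using linear_cmul[OF has_derivative_linear[OF D(1)[OF that]]] by simp
  qed
  define D2 where "D2 = (\<lambda>u v z. vector_derivative (\<lambda>t. D (z + t *\<^sub>R u) v) (at 0))"
  have local2: "\<exists>r U. r > 0 \<and> open U \<and> z0 \<in> U \<and> U \<subseteq> S \<and> (\<forall>z\<in>U. \<forall>\<zeta>. norm \<zeta> \<le> r \<longrightarrow> z + \<zeta> *s v \<in> S) \<and>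
      (\<forall>z\<in>U. ((\<lambda>t. D (z + t *\<^sub>R u) v) has_vector_derivative cauchy_average r v (\<lambda>y. D y u) z) (at 0))"
    if z0: "z0 \<in> S" for z0 u v
  proof -
    from local[OF z0, of v] obtain r U where rU: "r > 0" "open U" "z0 \<in> U" "U \<subseteq> S"
      "\<And>z \<zeta>. z \<in> U \<Longrightarrow> norm \<zeta> \<le> r \<Longrightarrow> z + \<zeta> *s v \<in> S" "\<And>z. z \<in> U \<Longrightarrow> D z v = cauchy_average r v F z" by blast
    have "((\<lambda>t. D (z + t *\<^sub>R u) v) has_vector_derivative cauchy_average r v (\<lambda>y. D y u) z) (at 0)" if z: "z \<in> U" for z
    proof (rule has_vector_derivative_transform_within_open)
      show "((\<lambda>t. cauchy_average r v F (z + t *\<^sub>R u)) has_vector_derivative cauchy_average r v (\<lambda>y. D y u) z) (at 0)"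
        by (rule cauchy_average_derivative[OF Fc Dc S der1 rU(1,2) z rU(5)])
      show "open ((\<lambda>t. z + t *\<^sub>R u) -` U)" by (intro open_vimage rU continuous_intros)
      show "0 \<in> (\<lambda>t. z + t *\<^sub>R u) -` U" using z by simp
    qed (simp add: rU(6))
    then show ?thesis using rU(1-5) by blast
  qed
  have D2: "((\<lambda>t. D (z + t *\<^sub>R u) v) has_vector_derivative D2 u v z) (at 0)" if "z \<in> S" for u v z
  proof -
    from local2[OF that, of v u] have "(\<lambda>t. D (z + t *\<^sub>R u) v) differentiable (at 0)"
      unfolding has_vector_derivative_def differentiable_def by blast
    then show ?thesis unfolding D2_def by (simp add: vector_derivative_works)
  qed
  have D2c: "continuous_on S (D2 u v)" for u v
  proof (rule continuous_at_imp_continuous_on, rule ballI)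
    fix z0 assume "z0 \<in> S"
    from local2[OF this, of v u] obtain r U where rU: "r > 0" "open U" "z0 \<in> U" "U \<subseteq> S"
      "\<And>z \<zeta>. z \<in> U \<Longrightarrow> norm \<zeta> \<le> r \<Longrightarrow> z + \<zeta> *s v \<in> S"
      "\<And>z. z \<in> U \<Longrightarrow> ((\<lambda>t. D (z + t *\<^sub>R u) v) has_vector_derivative cauchy_average r v (\<lambda>y. D y u) z) (at 0)" by blast
    have eq: "D2 u v z = cauchy_average r v (\<lambda>y. D y u) z" if "z \<in> U" for z
      unfolding D2_def by (rule vector_derivative_at[OF rU(6)[OF that]])
    have "continuous_on U (cauchy_average r v (\<lambda>y. D y u))" by (rule cauchy_average_continuous[OF Dc rU(1,5)])
    then have "continuous_on U (D2 u v)" by (subst continuous_on_cong[OF refl eq]) auto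
    then show "isCont (D2 u v) z0" using rU(2,3) continuous_on_eq_continuous_at by blast
  qed
  have Pder: "((\<lambda>t. P (G t)) has_real_derivative P G') (at 0)" if "(G has_vector_derivative G') (at 0)" for G G'
    unfolding has_real_derivative_iff_has_vector_derivative by (rule bounded_linear.has_vector_derivative[OF P that])
  have Pc: "continuous_on S (\<lambda>z. P (G z))" if "continuous_on S G" for G
    by (rule bounded_linear.continuous_on[OF P that])
  have "C1f S (\<lambda>z. P (D z v))" for v
    unfolding C1f_def
  proof (intro conjI allI Pc Dc)
    fix u
    show "\<exists>f1. continuous_on S f1 \<and> (\<forall>z\<in>S. ((\<lambda>t. P (D (z + t *\<^sub>R u) v)) has_real_derivative f1 z) (at 0))"
      by (rule exI[of _ "\<lambda>z. P (D2 u v z)"]) (use Pc[OF D2c] Pder[OF D2] in blast)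
  qed
  then show ?thesis
    unfolding C2f_def
  proof (intro conjI allI Pc Fc)
    fix v
    show "\<exists>f1. C1f S f1 \<and> (\<forall>z\<in>S. ((\<lambda>t. P (F (z + t *\<^sub>R v))) has_real_derivative f1 z) (at 0))"
      by (rule exI[of _ "\<lambda>z. P (D z v)"]) (use \<open>\<And>v. C1f S (\<lambda>z. P (D z v))\<close> Pder[OF der1] in blast)
  qed
qed

section \<open>Quadratic test functions in charts\<close>

lemma complex_vector_decomp: "(v::complex^'n) = (\<Sum>j\<in>UNIV. Re (v $ j) *\<^sub>R axis j 1 + Im (v $ j) *\<^sub>R axis j \<i>)"
proof -
  have "(\<Sum>j\<in>UNIV. Re (v $ j) *\<^sub>R axis j 1 + Im (v $ j) *\<^sub>R axis j \<i>) $ i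
    = (\<Sum>j\<in>UNIV. if j = i then v $ j else 0)" for i
    unfolding sum_component by (intro sum.cong refl) (auto simp: axis_def complex_eq_iff)
  then show ?thesis by (simp add: vec_eq_iff)
qed

lemma bilinear_expansion:
  fixes B :: "complex^'n \<Rightarrow> complex^'n \<Rightarrow> real"
  assumes B: "bilinear B"
  shows "B v w = (\<Sum>j\<in>UNIV. \<Sum>k\<in>UNIV. Re (v $ j) * Re (w $ k) * B (axis j 1) (axis k 1) + Re (v $ j) * Im (w $ k) * B (axis j 1) (axis k \<i>)
      + Im (v $ j) * Re (w $ k) * B (axis j \<i>) (axis k 1) + Im (v $ j) * Im (w $ k) * B (axis j \<i>) (axis k \<i>))"
proof -
  let ?x = "\<lambda>v j. Re (v $ j) *\<^sub>R axis j 1 + Im (v $ j) *\<^sub>R axis j \<i> :: complex^'n"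
  have l1: "linear (\<lambda>x. B x w)" for w using B by (simp add: bilinear_def)
  have l2: "linear (\<lambda>y. B x y)" for x using B by (simp add: bilinear_def)
  have "B v w = B (\<Sum>j\<in>UNIV. ?x v j) (\<Sum>k\<in>UNIV. ?x w k)"
    using complex_vector_decomp[of v] complex_vector_decomp[of w] by simp
  also have "\<dots> = (\<Sum>j\<in>UNIV. \<Sum>k\<in>UNIV. B (?x v j) (?x w k))"
    by (simp only: linear_sum[OF l1]) (simp only: linear_sum[OF l2])
  also have "\<dots> = (\<Sum>j\<in>UNIV. \<Sum>k\<in>UNIV. Re (v $ j) * Re (w $ k) * B (axis j 1) (axis k 1) + Re (v $ j) * Im (w $ k) * B (axis j 1) (axis k \<i>)
      + Im (v $ j) * Re (w $ k) * B (axis j \<i>) (axis k 1) + Im (v $ j) * Im (w $ k) * B (axis j \<i>) (axis k \<i>))"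
    by (intro sum.cong refl) (simp only: bilinear_ladd[OF B] bilinear_radd[OF B] bilinear_lmul[OF B] bilinear_rmul[OF B], simp add: algebra_simps)
  finally show ?thesis .
qed

definition quad :: "real \<Rightarrow> ('a::euclidean_space \<Rightarrow> real) \<Rightarrow> ('a \<Rightarrow> 'a \<Rightarrow> real) \<Rightarrow> 'a \<Rightarrow> 'a \<Rightarrow> real" where
  "quad a l B z0 = (\<lambda>y. a + l (y - z0) + B (y - z0) (y - z0) / 2)"

text \<open>The complex Hessian at (v, v) expressed through the real Hessian B: the part of B that
  survives in dd^c. The factor 1/4 comes from the two halves in the Wirtinger derivatives.\<close>

definition levi :: "(complex^'n \<Rightarrow> complex^'n \<Rightarrow> real) \<Rightarrow> complex^'n \<Rightarrow> real" where
  "levi B v = (B v v + B (\<i> *s v) (\<i> *s v)) / 4"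

lemma cHess_quad:
  fixes B :: "complex^'n \<Rightarrow> complex^'n \<Rightarrow> real"
  assumes l: "linear l" and B: "bilinear B"
  shows "Re (hf (cHess (quad a l B z0) z) v v) = levi B v" and "hermitian (cHess (quad a l B z0) z)"
proof -
  \<comment> \<open>Second directional derivatives of the quadratic see only the symmetric part of
    B.\<close>
  define S where "S = (\<lambda>u v. (B u v + B v u) / 2)"
  have S: "bilinear S"
    using B unfolding S_def bilinear_def linear_iff by (auto simp: algebra_simps add_divide_distrib)
  have Ssym: "S u v = S v u" for u v by (simp add: S_def add.commute)
  have dd2: "dd (quad a l B z0) [u, v] z = S u v" for u v
    unfolding quad_def S_def by (rule dd_quadratic(2)[OF l B])
  have entry: "cHess (quad a l B z0) z $ j $ k = (complex_of_real (S (axis j 1) (axis k 1) + S (axis j \<i>) (axis k \<i>))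
       + \<i> * complex_of_real (S (axis j 1) (axis k \<i>) - S (axis j \<i>) (axis k 1))) / 4" for j k
    unfolding cHess_def dd2 by simp
  show "hermitian (cHess (quad a l B z0) z)"
    unfolding hermitian_def entry
    using Ssym by (auto simp: complex_eq_iff)
  have "4 * Re (hf (cHess (quad a l B z0) z) v v) = S v v + S (\<i> *s v) (\<i> *s v)"
    unfolding bilinear_expansion[OF S, of v v] bilinear_expansion[OF S, of "\<i> *s v" "\<i> *s v"] hf_def entry Re_sum
      sum_distrib_left sum.distrib[symmetric]
    by (intro sum.cong refl) (simp add: field_simps)
  then show "Re (hf (cHess (quad a l B z0) z) v v) = levi B v" by (simp add: S_def levi_def)
qed

text \<open>A test function has to be C^2 in every chart, whereas P is quadratic only in c. In
  another chart it is a quadratic polynomial in the components of a holomorphic transition map;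
  expanded in coordinates, it is built from C^2 functions by sums and products.\<close>

lemma quad_in_chart:
  fixes A :: "('m::t2_space, 'n::finite) chart set" and a :: real
  assumes A: "complex_atlas A" and c: "c \<in> A" and x0: "x0 \<in> fst c" and l: "linear l" and B: "bilinear B"
  defines "P \<equiv> \<lambda>x. quad a l B (snd c x0) (snd c x)"
  shows "C2_near A P x0" and "cHess (loc c P) (snd c x0) = cHess (quad a l B (snd c x0)) (snd c x0)"
proof -
  obtain U \<phi> where c_eq: "c = (U, \<phi>)" by (cases c)
  have U: "open U" "open (\<phi> ` U)" "homeomorphism U (\<phi> ` U) \<phi> (inv_into U \<phi>)"
    using A c unfolding complex_atlas_def c_eq by auto
  let ?q = "quad a l B (\<phi> x0)"
  show "C2_near A P x0"
    unfolding C2_near_def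
  proof (intro exI[of _ U] conjI ballI)
    show "x0 \<in> U" using x0 by (simp add: c_eq)
    fix c' assume c': "c' \<in> A"
    obtain V \<psi> where c'_eq: "c' = (V, \<psi>)" by (cases c')
    have V: "open V" "open (\<psi> ` V)" "homeomorphism V (\<psi> ` V) \<psi> (inv_into V \<psi>)"
      using A c' unfolding complex_atlas_def c'_eq by auto
    define \<tau> where "\<tau> = \<phi> \<circ> inv_into V \<psi>"
    have "holo_on (\<psi> ` (V \<inter> U)) \<tau>"
      using A c c' unfolding complex_atlas_def c_eq c'_eq \<tau>_def by blast
    then have holo: "\<exists>L. (\<tau> has_derivative L) (at z) \<and> (\<forall>v. L (\<i> *s v) = \<i> *s L v)" if "z \<in> \<psi> ` (V \<inter> U)" for z
      using that unfolding holo_on_def by blast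
    have "open (\<psi> ` (V \<inter> U))"
    proof -
      have "openin (top_of_set (\<psi> ` V)) (\<psi> ` (V \<inter> U))"
        by (rule homeomorphism_imp_open_map[OF V(3)]) (simp add: U(1) V(1) openin_open_Int)
      then show ?thesis using V(2) openin_open_trans by blast
    qed
    note op = this
    have comp: "C2f (\<psi> ` (V \<inter> U)) (\<lambda>z. (\<tau> z - \<phi> x0) \<bullet> b)" if b: "b \<in> Basis" for b
    proof -
      obtain i w where b: "b = axis i w" "w \<in> Basis" using b unfolding Basis_vec_def by auto
      have "C2f (\<psi> ` (V \<inter> U)) (\<lambda>z. (\<tau> z $ i) \<bullet> w)"
      proof (rule holomorphic_C2f[OF op _ bounded_linear_inner_left])
        fix z assume "z \<in> \<psi> ` (V \<inter> U)"
        then obtain L where L: "(\<tau> has_derivative L) (at z)" "\<forall>v. L (\<i> *s v) = \<i> *s L v" using holo by blast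
        have "((\<lambda>z. \<tau> z $ i) has_derivative (\<lambda>v. L v $ i)) (at z)"
          by (rule bounded_linear.has_derivative[OF bounded_linear_vec_nth L(1)])
        then show "\<exists>L. ((\<lambda>z. \<tau> z $ i) has_derivative L) (at z) \<and> (\<forall>v. L (\<i> *s v) = \<i> * L v)"
          using L(2) by (intro exI[of _ "\<lambda>v. L v $ i"]) simp
      qed
      from C2f_add[OF this C2f_const[of _ "- (\<phi> x0 \<bullet> b)"]] show ?thesis
        by (simp add: b inner_diff_left inner_axis)
    qed
    have repr: "?q (\<tau> z) = (a + (\<Sum>b\<in>Basis. ((\<tau> z - \<phi> x0) \<bullet> b) * l b))
        + (\<Sum>b\<in>Basis. \<Sum>b'\<in>Basis. (((\<tau> z - \<phi> x0) \<bullet> b) * ((\<tau> z - \<phi> x0) \<bullet> b')) * (B b b' / 2))" for z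
    proof -
      define y where "y = \<tau> z - \<phi> x0"
      have y: "y = (\<Sum>b\<in>Basis. (y \<bullet> b) *\<^sub>R b)" by (simp add: euclidean_representation)
      have l1: "linear (\<lambda>x. B x w)" for w using B by (simp add: bilinear_def)
      have l2: "linear (\<lambda>y. B x y)" for x using B by (simp add: bilinear_def)
      have "l (\<Sum>b\<in>Basis. (y \<bullet> b) *\<^sub>R b) = (\<Sum>b\<in>Basis. (y \<bullet> b) * l b)"
        by (simp add: linear_sum[OF l] linear_cmul[OF l])
      then have ly: "l y = (\<Sum>b\<in>Basis. (y \<bullet> b) * l b)" using y by simp
      have "B (\<Sum>b\<in>Basis. (y \<bullet> b) *\<^sub>R b) (\<Sum>b\<in>Basis. (y \<bullet> b) *\<^sub>R b)
        = (\<Sum>b\<in>Basis. \<Sum>b'\<in>Basis. B ((y \<bullet> b) *\<^sub>R b) ((y \<bullet> b') *\<^sub>R b'))"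
        by (simp only: linear_sum[OF l1]) (simp only: linear_sum[OF l2])
      then have "B y y = (\<Sum>b\<in>Basis. \<Sum>b'\<in>Basis. ((y \<bullet> b) * (y \<bullet> b')) * B b b')"
        using y by (simp add: bilinear_scaleR_both[OF B])
      then have By: "B y y / 2 = (\<Sum>b\<in>Basis. \<Sum>b'\<in>Basis. ((y \<bullet> b) * (y \<bullet> b')) * (B b b' / 2))"
        by (simp add: sum_divide_distrib)
      show ?thesis unfolding quad_def y_def[symmetric] By ly ..
    qed
    have "C2f (\<psi> ` (V \<inter> U)) (\<lambda>z. ?q (\<tau> z))"
      unfolding repr
      by (rule C2f_add[OF C2f_add[OF C2f_const C2f_sum[OF C2f_mult[OF comp C2f_const]]]
            C2f_sum[OF C2f_sum[OF C2f_mult[OF C2f_mult[OF comp comp] C2f_const]]]])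
    then have "Ck_on 2 (\<psi> ` (V \<inter> U)) (\<lambda>z. ?q (\<tau> z))" by (rule C2f_imp_Ck_on[OF op])
    moreover have "loc c' P = (\<lambda>z. ?q (\<tau> z))" by (simp add: loc_def P_def c_eq c'_eq \<tau>_def fun_eq_iff)
    ultimately show "Ck_on 2 (snd c' ` (fst c' \<inter> U)) (loc c' P)" by (simp add: c'_eq)
  qed (rule U)
  have z0: "\<phi> x0 \<in> \<phi> ` U" using x0 by (simp add: c_eq)
  have "loc c P y = ?q y" if "y \<in> \<phi> ` U" for y
    using homeomorphism_apply2[OF U(3) that] by (simp add: loc_def P_def c_eq)
  then have eq: "dd (loc c P) vs (\<phi> x0) = dd ?q vs (\<phi> x0)" for vs by (rule dd_cong_open[OF U(2) _ z0])
  have "snd c = \<phi>" by (simp add: c_eq)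
  then show "cHess (loc c P) (snd c x0) = cHess (quad a l B (snd c x0)) (snd c x0)"
    by (simp only: cHess_def eq)
qed

section \<open>From viscosity tests on the manifold to paraboloids in a chart\<close>

definition touch_below :: "('a::euclidean_space \<Rightarrow> real) \<Rightarrow> 'a \<Rightarrow> ('a \<Rightarrow> real) \<Rightarrow> ('a \<Rightarrow> 'a \<Rightarrow> real) \<Rightarrow> bool" where
  "touch_below w x l B \<longleftrightarrow> linear l \<and> bilinear B \<and>
     (\<exists>d>0. \<forall>k. norm k < d \<longrightarrow> w x + l k + B k k / 2 \<le> w (x + k))"

lemma eventually_in_chart:
  fixes A :: "('m::t2_space, 'n::finite) chart set"
  assumes A: "complex_atlas A" and c: "c \<in> A" and x0: "x0 \<in> fst c" and d: "d > 0"
  shows "\<forall>\<^sub>F x in nhds x0. x \<in> fst c \<and> norm (snd c x - snd c x0) < d"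
proof -
  obtain U \<phi> where c_eq: "c = (U, \<phi>)" by (cases c)
  have U: "open U" "homeomorphism U (\<phi> ` U) \<phi> (inv_into U \<phi>)"
    using A c unfolding complex_atlas_def c_eq by auto
  have "continuous_on U \<phi>" using U(2) by (rule homeomorphism_cont1)
  then have "open (\<phi> -` ball (\<phi> x0) d \<inter> U)" using U(1) open_ball continuous_on_open_vimage by blast
  then have "\<forall>\<^sub>F x in nhds x0. x \<in> \<phi> -` ball (\<phi> x0) d \<inter> U"
    by (rule eventually_nhds_in_open) (use x0 d in \<open>simp add: c_eq\<close>)
  then show ?thesis by (rule eventually_mono) (simp add: c_eq dist_norm norm_minus_commute)
qed

lemma visc_sub_touch:
  fixes A :: "('m::t2_space, 'n::finite) chart set"
  assumes A: "complex_atlas A" and c: "c \<in> A" and x0: "x0 \<in> fst c" and u: "visc_sub A g \<chi>' \<Gamma> f H u"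
    and t: "touch_above (loc c u) (snd c x0) l B"
    and lam: "eig_tuple (g c x0) (\<chi>' c x0 + cHess (quad (u x0) l B (snd c x0)) (snd c x0)) lam"
  shows "lam \<in> \<Gamma> \<and> f lam \<ge> H x0 (u x0)"
proof -
  have l: "linear l" and B: "bilinear B" using t by (auto simp: touch_above_def)
  define P where "P = (\<lambda>x. quad (u x0) l B (snd c x0) (snd c x))"
  have inv: "inv_into (fst c) (snd c) (snd c x) = x" if "x \<in> fst c" for x
    using A c that unfolding complex_atlas_def by (auto simp: homeomorphism_def)
  have P0: "P x0 = u x0" by (simp add: P_def quad_def linear_0[OF l] bilinear_lzero[OF B])
  obtain d where d: "d > 0" "\<And>k. norm k < d \<Longrightarrow> loc c u (snd c x0 + k) \<le> loc c u (snd c x0) + l k + B k k / 2"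
    using t by (auto simp: touch_above_def)
  have "\<forall>\<^sub>F x in nhds x0. u x \<le> P x"
    using eventually_in_chart[OF A c x0 d(1)]
  proof (rule eventually_mono)
    fix x assume x: "x \<in> fst c \<and> norm (snd c x - snd c x0) < d"
    then show "u x \<le> P x" using d(2)[of "snd c x - snd c x0"] inv x0 by (simp add: loc_def P_def quad_def)
  qed
  then have "touches_above P u x0" using P0 by (simp add: touches_above_def)
  moreover have "eig_tuple (g c x0) (ddc_add \<chi>' P c x0) lam"
    using lam quad_in_chart(2)[OF A c x0 l B, of "u x0"] by (simp add: ddc_add_def P_def)
  moreover have "C2_near A P x0" unfolding P_def by (rule quad_in_chart(1)[OF A c x0 l B])
  ultimately show ?thesis using u c x0 P0 unfolding visc_sub_def by metis
qed

lemma visc_super_touch: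
  fixes A :: "('m::t2_space, 'n::finite) chart set"
  assumes A: "complex_atlas A" and c: "c \<in> A" and x0: "x0 \<in> fst c" and u: "visc_super A g \<chi>' \<Gamma> f H u"
    and t: "touch_below (loc c u) (snd c x0) l B"
    and lam: "eig_tuple (g c x0) (\<chi>' c x0 + cHess (quad (u x0) l B (snd c x0)) (snd c x0)) lam"
  shows "lam \<notin> \<Gamma> \<or> f lam \<le> H x0 (u x0)"
proof -
  have l: "linear l" and B: "bilinear B" using t by (auto simp: touch_below_def)
  define P where "P = (\<lambda>x. quad (u x0) l B (snd c x0) (snd c x))"
  have inv: "inv_into (fst c) (snd c) (snd c x) = x" if "x \<in> fst c" for x
    using A c that unfolding complex_atlas_def by (auto simp: homeomorphism_def)
  have P0: "P x0 = u x0" by (simp add: P_def quad_def linear_0[OF l] bilinear_lzero[OF B])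
  obtain d where d: "d > 0" "\<And>k. norm k < d \<Longrightarrow> loc c u (snd c x0) + l k + B k k / 2 \<le> loc c u (snd c x0 + k)"
    using t by (auto simp: touch_below_def)
  have "\<forall>\<^sub>F x in nhds x0. P x \<le> u x"
    using eventually_in_chart[OF A c x0 d(1)]
  proof (rule eventually_mono)
    fix x assume x: "x \<in> fst c \<and> norm (snd c x - snd c x0) < d"
    then show "P x \<le> u x" using d(2)[of "snd c x - snd c x0"] inv x0 by (simp add: loc_def P_def quad_def)
  qed
  then have "touches_below P u x0" using P0 by (simp add: touches_below_def)
  moreover have "eig_tuple (g c x0) (ddc_add \<chi>' P c x0) lam"
    using lam quad_in_chart(2)[OF A c x0 l B, of "u x0"] by (simp add: ddc_add_def P_def)
  moreover have "C2_near A P x0" unfolding P_def by (rule quad_in_chart(1)[OF A c x0 l B])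
  ultimately show ?thesis using u c x0 P0 unfolding visc_super_def by metis
qed

section \<open>Sup-convolution and doubling of variables\<close>

text \<open>At z the function w is squeezed between a concave paraboloid with Hessian -2a and the
  touching quadratic, and both have the value w z there.\<close>

lemma touch_above_convex_lower:
  assumes t: "touch_above w z l B" and low: "\<And>k. w z - a * ((z + k - p) \<bullet> (z + k - p)) + a * ((z - p) \<bullet> (z - p)) \<le> w (z + k)"
  shows "B h h \<ge> - 2 * a * (h \<bullet> h)"
proof -
  obtain d where d: "d > 0" "\<And>k. norm k < d \<Longrightarrow> w (z + k) \<le> w z + l k + B k k / 2" and l: "linear l" and B: "bilinear B"
    using t by (auto simp: touch_above_def)
  define C where "C = (\<lambda>u v::'a. (-2 * a) * (u \<bullet> v) + 0 * (u \<bullet> v))"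
  have C: "bilinear C" unfolding C_def by (intro bilinear_scale_combine bilinear_inner)
  define m where "m = (\<lambda>v::'a. (-2 * a) * ((z - p) \<bullet> v))"
  have m: "linear m" by (simp add: m_def linear_iff inner_simps algebra_simps)
  have q: "taylor2 (\<lambda>y. w z + m (y - z) + C (y - z) (y - z) / 2) z (\<lambda>v. m v + (C (z - z) v + C v (z - z)) / 2) C"
    by (rule taylor2_quadratic[OF m C])
  have "qsum [(1, h)] C \<le> qsum [(1, h)] B"
  proof (rule taylor2_touch[OF _ q l B d(1)])
    fix k :: 'a assume "norm k < d"
    then have "w z - a * ((z + k - p) \<bullet> (z + k - p)) + a * ((z - p) \<bullet> (z - p)) \<le> w z + l k + B k k / 2"
      using low[of k] d(2)[of k] by linarith
    then show "w z + m (z + k - z) + C (z + k - z) (z + k - z) / 2 \<le> w z + m (z - z) + C (z - z) (z - z) / 2 + l k + B k k / 2"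
      by (simp add: m_def C_def inner_simps inner_commute algebra_simps)
  qed (simp add: nonneg_weights_def)
  then show ?thesis by (simp add: qsum_def C_def)
qed

text \<open>The supremum runs over a compact ball, so it is attained although f is only known there,
  while w is defined everywhere. The bound \<open>diff\<close> shows that w is locally
  Lipschitz.\<close>

lemma sup_convolution:
  fixes f :: "'a::euclidean_space \<Rightarrow> real"
  assumes f: "continuous_on (cball p \<rho>) f" and \<rho>: "\<rho> > 0" and a: "a \<ge> 0"
  obtains w where "continuous_on UNIV w"
    "\<And>x z. x \<in> cball p \<rho> \<Longrightarrow> f x - a * ((z - x) \<bullet> (z - x)) \<le> w z"
    "\<And>z. \<exists>x\<in>cball p \<rho>. w z = f x - a * ((z - x) \<bullet> (z - x))"
proof -
  have "\<exists>x\<in>cball p \<rho>. \<forall>y\<in>cball p \<rho>. f y - a * ((z - y) \<bullet> (z - y)) \<le> f x - a * ((z - x) \<bullet> (z - x))" for z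
    by (rule continuous_attains_sup) (use \<rho> in \<open>auto intro!: continuous_intros f\<close>)
  then obtain X where X: "\<And>z. X z \<in> cball p \<rho>"
    "\<And>z y. y \<in> cball p \<rho> \<Longrightarrow> f y - a * ((z - y) \<bullet> (z - y)) \<le> f (X z) - a * ((z - X z) \<bullet> (z - X z))" by metis
  define w where "w = (\<lambda>z. f (X z) - a * ((z - X z) \<bullet> (z - X z)))"
  have diff: "w z - w z' \<le> a * (norm (z' - z) * (norm (z' + z) + 2 * (norm p + \<rho>)))" for z z'
  proof -
    have "w z - w z' \<le> a * ((z' - z) \<bullet> (z' + z - 2 *\<^sub>R X z))"
      using X(2)[OF X(1)[of z], of z'] by (simp add: w_def inner_simps inner_commute algebra_simps)
    also have "\<dots> \<le> a * (norm (z' - z) * (norm (z' + z) + 2 * (norm p + \<rho>)))"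
    proof (rule mult_left_mono[OF _ a])
      have "norm (X z) \<le> norm p + \<rho>"
        using X(1)[of z] norm_triangle_ineq[of p "X z - p"] by (simp add: dist_norm norm_minus_commute)
      then have "norm (z' + z - 2 *\<^sub>R X z) \<le> norm (z' + z) + 2 * (norm p + \<rho>)"
        using norm_triangle_ineq4[of "z' + z" "2 *\<^sub>R X z"] by simp
      then show "(z' - z) \<bullet> (z' + z - 2 *\<^sub>R X z) \<le> norm (z' - z) * (norm (z' + z) + 2 * (norm p + \<rho>))"
        using norm_cauchy_schwarz[of "z' - z" "z' + z - 2 *\<^sub>R X z"] mult_left_mono[of _ _ "norm (z' - z)"]
        by (meson norm_ge_zero order_trans)
    qed
    finally show ?thesis .
  qed
  have "continuous_on UNIV w"
  proof (rule continuous_at_imp_continuous_on, rule ballI)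
    fix z
    have "((\<lambda>z'. w z' - w z) \<longlongrightarrow> 0) (at z)"
    proof (rule Lim_null_comparison)
      show "\<forall>\<^sub>F z' in at z. norm (w z' - w z) \<le> a * (norm (z' - z) * (norm (z' + z) + 2 * (norm p + \<rho>)))"
      proof (rule always_eventually, rule allI)
        fix z'
        show "norm (w z' - w z) \<le> a * (norm (z' - z) * (norm (z' + z) + 2 * (norm p + \<rho>)))"
          using diff[of z z'] diff[of z' z] by (simp add: norm_minus_commute[of z] add.commute[of z] abs_le_iff)
      qed
      have "((\<lambda>z'. a * (norm (z' - z) * (norm (z' + z) + 2 * (norm p + \<rho>)))) \<longlongrightarrow> a * (norm (z - z) * (norm (z + z) + 2 * (norm p + \<rho>)))) (at z)"
        by (intro tendsto_intros)
      then show "((\<lambda>z'. a * (norm (z' - z) * (norm (z' + z) + 2 * (norm p + \<rho>)))) \<longlongrightarrow> 0) (at z)" by simp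
    qed
    then show "isCont w z" by (simp add: isCont_def LIM_zero_iff)
  qed
  then show ?thesis
    by (rule that[of w]) (use X in \<open>auto simp: w_def\<close>)
qed

text \<open>Testing the maximum against (z0, z0) and using the strict maximum of f - v eliminates f
  and leaves a|x - y|^2 + \<eta>|x - z0|^2 <= v x - v y. Boundedness of v first makes |x - y| small;
  then uniform continuity makes the right-hand side small.\<close>

lemma doubling:
  fixes f v :: "'a::euclidean_space \<Rightarrow> real"
  assumes S: "compact S" and f: "continuous_on S f" and v: "continuous_on S v" and z0: "z0 \<in> S"
    and \<eta>: "\<eta> > 0" and \<theta>: "\<theta> > 0"
    and max: "\<And>x. x \<in> S \<Longrightarrow> f x - v x + \<eta> * (norm (x - z0))\<^sup>2 \<le> f z0 - v z0"
  obtains a x y where "a \<ge> 1" "x \<in> S" "y \<in> S"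
    "\<And>x' y'. x' \<in> S \<Longrightarrow> y' \<in> S \<Longrightarrow> f x' - v y' - a * ((x' - y') \<bullet> (x' - y')) \<le> f x - v y - a * ((x - y) \<bullet> (x - y))"
    "norm (x - z0) < \<theta>" "norm (y - z0) < \<theta>" "a * (norm (x - y))\<^sup>2 < \<theta>"
proof -
  define \<theta>' where "\<theta>' = min \<theta> (\<eta> * (\<theta> / 2)\<^sup>2)"
  have \<theta>': "\<theta>' > 0" using \<theta> \<eta> by (simp add: \<theta>'_def)
  have "uniformly_continuous_on S v" by (rule compact_uniformly_continuous[OF v S])
  then obtain d where d: "d > 0" "\<And>x y. x \<in> S \<Longrightarrow> y \<in> S \<Longrightarrow> dist y x < d \<Longrightarrow> dist (v y) (v x) < \<theta>'"
    using \<theta>' unfolding uniformly_continuous_on_def by metis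
  have "compact (v ` S)" by (rule compact_continuous_image[OF v S])
  then obtain V where V: "\<And>x. x \<in> S \<Longrightarrow> \<bar>v x\<bar> \<le> V" using compact_imp_bounded[of "v ` S"] unfolding bounded_iff by auto
  define e where "e = min d (\<theta> / 2)"
  have e: "e > 0" using d \<theta> by (simp add: e_def)
  have V0: "V \<ge> 0" using V[OF z0] by linarith
  \<comment> \<open>If |x - y| were at least e, the penalty would be at least e^2 + 2V, more than
    the oscillation of v.\<close>
  define a where "a = 1 + 2 * V / e\<^sup>2"
  have a: "a \<ge> 1" using V0 by (simp add: a_def)
  have "continuous_on (S \<times> S) (\<lambda>p. f (fst p) - v (snd p) - a * ((fst p - snd p) \<bullet> (fst p - snd p)))"
    by (intro continuous_intros continuous_on_compose2[OF f] continuous_on_compose2[OF v]) auto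
  then obtain p where p: "p \<in> S \<times> S" "\<forall>q\<in>S \<times> S. f (fst q) - v (snd q) - a * ((fst q - snd q) \<bullet> (fst q - snd q))
      \<le> f (fst p) - v (snd p) - a * ((fst p - snd p) \<bullet> (fst p - snd p))"
    using continuous_attains_sup[OF compact_Times[OF S S]] z0 by blast
  obtain x y where xy: "p = (x, y)" by (cases p)
  have xS: "x \<in> S" "y \<in> S" using p(1) xy by auto
  have mx: "f x' - v y' - a * ((x' - y') \<bullet> (x' - y')) \<le> f x - v y - a * ((x - y) \<bullet> (x - y))" if "x' \<in> S" "y' \<in> S" for x' y'
    using p(2) that xy by force
  have key: "a * (norm (x - y))\<^sup>2 + \<eta> * (norm (x - z0))\<^sup>2 \<le> v x - v y"
    using mx[OF z0 z0] max[OF xS(1)] by (simp add: power2_norm_eq_inner)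
  have nn: "0 \<le> \<eta> * (norm (x - z0))\<^sup>2" "0 \<le> a * (norm (x - y))\<^sup>2" using \<eta> a by auto
  have ne: "norm (x - y) < e"
  proof (rule ccontr)
    assume "\<not> norm (x - y) < e"
    then have "e\<^sup>2 \<le> (norm (x - y))\<^sup>2" using e by (intro power_mono) auto
    then have "a * e\<^sup>2 \<le> a * (norm (x - y))\<^sup>2" using a by (intro mult_left_mono) auto
    moreover have "a * e\<^sup>2 = e\<^sup>2 + 2 * V" using e by (simp add: a_def distrib_right)
    moreover have "e\<^sup>2 > 0" using e by simp
    ultimately show False using key nn V[OF xS(1)] V[OF xS(2)] by linarith
  qed
  then have "dist (v x) (v y) < \<theta>'" using d(2)[OF xS(2,1)] by (simp add: e_def dist_norm)
  then have k2: "v x - v y < \<theta>'" by (simp add: dist_real_def abs_less_iff)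
  have 1: "a * (norm (x - y))\<^sup>2 < \<theta>" using key nn k2 by (simp add: \<theta>'_def)
  have "\<eta> * (norm (x - z0))\<^sup>2 < \<eta> * (\<theta> / 2)\<^sup>2" using key nn k2 unfolding \<theta>'_def by linarith
  then have "(norm (x - z0))\<^sup>2 < (\<theta> / 2)\<^sup>2" using \<eta> by (simp only: mult_less_cancel_left_pos)
  then have 2: "norm (x - z0) < \<theta> / 2" by (rule power_less_imp_less_base) (use \<theta> in simp)
  have 3: "norm (y - z0) < \<theta>"
    using norm_triangle_ineq4[of "x - z0" "x - y"] 2 ne by (simp add: e_def)
  have 4: "norm (x - z0) < \<theta>" using 2 \<theta> by linarith
  show ?thesis by (rule that[OF a xS mx 4 3 1])
qed

text \<open>Mixed terms are paired through B(x, y) + B(y, x) <= B(x, x) + B(y, y). This costs the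
  factor DIM, but works for nonsymmetric B.\<close>

lemma psd_le_trace:
  fixes B :: "'a::euclidean_space \<Rightarrow> 'a \<Rightarrow> real"
  assumes B: "bilinear B" and nn: "\<And>h. 0 \<le> B h h"
  shows "B h h \<le> DIM('a) * (norm h)\<^sup>2 * (\<Sum>b\<in>Basis. B b b)"
proof -
  have two: "B x y + B y x \<le> B x x + B y y" for x y
    using nn[of "x - y"] by (simp add: bilinear_lsub[OF B] bilinear_rsub[OF B])
  have l1: "linear (\<lambda>x. B x w)" for w using B by (simp add: bilinear_def)
  have l2: "linear (\<lambda>y. B x y)" for x using B by (simp add: bilinear_def)
  let ?x = "\<lambda>b. (h \<bullet> b) *\<^sub>R b"
  have "B (\<Sum>b\<in>Basis. ?x b) (\<Sum>b\<in>Basis. ?x b) = (\<Sum>b\<in>Basis. \<Sum>c\<in>Basis. B (?x b) (?x c))"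
    by (simp only: linear_sum[OF l1]) (simp only: linear_sum[OF l2])
  then have eq: "B h h = (\<Sum>b\<in>Basis. \<Sum>c\<in>Basis. B (?x b) (?x c))" by (simp add: euclidean_representation)
  have "2 * B h h = (\<Sum>b\<in>Basis. \<Sum>c\<in>Basis. B (?x b) (?x c)) + (\<Sum>b\<in>Basis. \<Sum>c\<in>Basis. B (?x c) (?x b))"
    using eq sum.swap[of "\<lambda>b c. B (?x c) (?x b)" Basis Basis] by simp
  also have "\<dots> = (\<Sum>b\<in>Basis. \<Sum>c\<in>Basis. B (?x b) (?x c) + B (?x c) (?x b))" by (simp add: sum.distrib)
  also have "\<dots> \<le> (\<Sum>b\<in>Basis. \<Sum>c\<in>Basis. B (?x b) (?x b) + B (?x c) (?x c))"
    by (intro sum_mono two)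
  also have "\<dots> = 2 * (DIM('a) * (\<Sum>b\<in>Basis. B (?x b) (?x b)))"
    by (simp add: sum.distrib sum_distrib_left)
  finally have "B h h \<le> DIM('a) * (\<Sum>b\<in>Basis. B (?x b) (?x b))" by simp
  also have "\<dots> \<le> DIM('a) * (\<Sum>b\<in>Basis. (norm h)\<^sup>2 * B b b)"
  proof (intro mult_left_mono sum_mono)
    fix b :: 'a assume b: "b \<in> Basis"
    have "(h \<bullet> b)\<^sup>2 \<le> (norm h)\<^sup>2" using Basis_le_norm[OF b, of h] by (metis abs_ge_zero power2_abs power_mono)
    then show "B (?x b) (?x b) \<le> (norm h)\<^sup>2 * B b b"
      unfolding bilinear_scaleR_both[OF B] by (intro mult_right_mono nn) (simp add: power2_eq_square)
  qed simp
  finally show ?thesis by (simp add: sum_distrib_left mult.assoc)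
qed

text \<open>Young's inequality for a nonnegative form. Below, y is the displacement of a frame
  vector and s the slack \<delta>.\<close>

lemma psd_perturb:
  fixes B :: "'a::real_vector \<Rightarrow> 'a \<Rightarrow> real"
  assumes B: "bilinear B" and nn: "\<And>h. 0 \<le> B h h" and s: "s > 0"
  shows "B (x + y) (x + y) \<le> (1 + s) * B x x + (1 + 1 / s) * B y y"
proof -
  have "0 \<le> B (s *\<^sub>R x - y) (s *\<^sub>R x - y)" by (rule nn)
  also have "\<dots> = s\<^sup>2 * B x x - s * (B x y + B y x) + B y y"
    by (simp add: bilinear_lsub[OF B] bilinear_rsub[OF B] bilinear_lmul[OF B] bilinear_rmul[OF B] power2_eq_square algebra_simps)
  finally have "s * (B x y + B y x) \<le> s * (s * B x x + B y y / s)"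
    using s by (simp add: power2_eq_square algebra_simps)
  then have "B x y + B y x \<le> s * B x x + B y y / s" using s by simp
  then show ?thesis by (simp add: bilinear_ladd[OF B] bilinear_radd[OF B] algebra_simps)
qed

section \<open>Levi forms as constant-coefficient operators\<close>

lemma qsum_append: "qsum (xs @ ys) B = qsum xs B + qsum ys B"
  by (simp add: qsum_def)

lemma qsum_list_sum:
  assumes "finite I" "\<And>i. i \<in> I \<Longrightarrow> \<exists>xs. nonneg_weights xs \<and> (\<forall>B. F i B = qsum xs B)"
  shows "\<exists>xs. nonneg_weights xs \<and> (\<forall>B. (\<Sum>i\<in>I. F i B) = qsum xs B)"
  using assms
proof (induction I rule: finite_induct)
  case empty then show ?case by (intro exI[of _ "[]"]) (auto simp: nonneg_weights_def qsum_def)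
next
  case (insert i I)
  then obtain xs ys where "nonneg_weights xs" "\<forall>B. F i B = qsum xs B" "nonneg_weights ys" "\<forall>B. (\<Sum>i\<in>I. F i B) = qsum ys B"
    by (metis insertCI)
  then show ?case using insert by (intro exI[of _ "xs @ ys"]) (auto simp: nonneg_weights_def qsum_append)
qed

lemma qsum_levi:
  assumes "c \<ge> 0" shows "\<exists>xs. nonneg_weights xs \<and> (\<forall>B. c * levi B v = qsum xs B)"
  by (rule exI[of _ "[(c / 4, v), (c / 4, \<i> *s v)]"])
     (use assms in \<open>auto simp: nonneg_weights_def qsum_def levi_def algebra_simps add_divide_distrib\<close>)

lemma levi_combine: "levi (\<lambda>u v. a * B u v + c * C u v) h = a * levi B h + c * levi C h"
  by (simp add: levi_def algebra_simps add_divide_distrib)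

lemma levi_inner: "levi (\<bullet>) h = (norm h)\<^sup>2 / 2"
  by (simp add: levi_def power2_norm_eq_inner[symmetric] norm_vector_smult)

lemma levi_mono: "(\<And>h. B h h \<le> C h h) \<Longrightarrow> levi B h \<le> levi C h"
  by (simp add: levi_def add_mono divide_right_mono)

section \<open>The local comparison argument\<close>

text \<open>\<open>K1\<close> and \<open>K\<close> stand for superlevel sets of f at levels whose
  ratio is 1 - t, and \<open>margin\<close> records how far \<chi> is inside \<Gamma>. The two
  viscosity conditions are asymmetric: by convexity every diagonal of a subsolution test lies in
  \<open>K1\<close>, whereas a supersolution test only provides some frame, an eigenframe, whose
  diagonal misses \<open>K\<close>.\<close>

locale local_problem =
  fixes G X :: "complex^'n \<Rightarrow> complex^'n^'n" and u v :: "complex^'n \<Rightarrow> real" and z0 :: "complex^'n"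
    and R m Kg Lg Kx t s0 :: real and \<Gamma> K K1 :: "(real^'n) set"
  assumes R: "R > 0" and t: "0 < t" "t < 1" and Kg: "Kg > 0" and Lg: "Lg \<ge> 0" and Kx: "Kx \<ge> 0" and s0: "s0 > 0"
    and coer: "\<And>z. z \<in> cball z0 R \<Longrightarrow> coercive m (G z)"
    and G_bound: "\<And>z v w. z \<in> cball z0 R \<Longrightarrow> norm (hf (G z) v w) \<le> Kg * norm v * norm w"
    and G_lip: "\<And>x y v w. x \<in> cball z0 R \<Longrightarrow> y \<in> cball z0 R \<Longrightarrow> norm (hf (G y - G x) v w) \<le> Lg * norm (y - x) * norm v * norm w"
    and X_bound: "\<And>z v w. z \<in> cball z0 R \<Longrightarrow> norm (hf (X z) v w) \<le> Kx * norm v * norm w"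
    and X_cont: "\<And>e. e > 0 \<Longrightarrow> \<exists>d>0. \<forall>x\<in>cball z0 R. \<forall>y\<in>cball z0 R. norm (y - x) < d \<longrightarrow>
      (\<forall>v w. norm (hf (X y - X x) v w) \<le> e * norm v * norm w)"
    and u_cont: "continuous_on (cball z0 R) u" and v_cont: "continuous_on (cball z0 R) v"
    and max: "\<And>z. z \<in> cball z0 R \<Longrightarrow> (1 - t) * u z - v z \<le> (1 - t) * u z0 - v z0"
    and sub: "\<And>z l B E. z \<in> ball z0 R \<Longrightarrow> touch_above u z l B \<Longrightarrow> E \<in> frames (G z) \<Longrightarrow>
      (\<chi> i. Re (hf (X z) (E $ i) (E $ i)) + levi B (E $ i)) \<in> K1"
    and super: "\<And>z l B. z \<in> ball z0 R \<Longrightarrow> touch_below v z l B \<Longrightarrow>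
      \<exists>E\<in>frames (G z). (\<chi> i. Re (hf (X z) (E $ i) (E $ i)) + levi B (E $ i)) \<notin> K"
    and margin: "\<And>E. E \<in> frames (G z0) \<Longrightarrow> (\<chi> i. Re (hf (X z0) (E $ i) (E $ i)) - s0) \<in> \<Gamma>"
    and K: "closed K" "convex K" "K \<noteq> {}" and K1: "\<And>x. x \<in> K1 \<Longrightarrow> (1 - t) *\<^sub>R x \<in> K"
    and K_add: "\<And>x y. x \<in> K \<Longrightarrow> y \<in> \<Gamma> \<Longrightarrow> x + y \<in> K"
    and \<Gamma>_scale: "\<And>c x. c > 0 \<Longrightarrow> x \<in> \<Gamma> \<Longrightarrow> c *\<^sub>R x \<in> \<Gamma>"
    and \<Gamma>_nonneg: "\<And>x. (\<And>i. x $ i \<ge> 0) \<Longrightarrow> x \<in> \<Gamma>"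
begin

text \<open>\<open>C\<close> is the Lipschitz constant, in the distance of the base points, of the
  transport of frames; \<open>Cf\<close> bounds the length of frame vectors.\<close>

definition "C = CARD('n) * Kg * sqrt (Kg / m) / m\<^sup>2 * Lg"
definition "Cf = 1 / sqrt m"

lemma m_pos: "m > 0"
  using coer[of z0] R by (simp add: coercive_def)

lemma C_nonneg: "C \<ge> 0"
  using Kg Lg m_pos by (simp add: C_def)

lemma Cf_pos: "Cf > 0"
  using m_pos by (simp add: Cf_def)

lemma frame_le: "z \<in> cball z0 R \<Longrightarrow> E \<in> frames (G z) \<Longrightarrow> norm (E $ i) \<le> Cf"
  unfolding Cf_def by (rule frame_norm_le'[OF coer])

lemma transport:
  assumes x: "x \<in> cball z0 R" and y: "y \<in> cball z0 R"
  obtains M where "\<And>F. F \<in> frames (G x) \<Longrightarrow> F ** M \<in> frames (G y)"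
    "\<And>v. norm (v v* M - v) \<le> C * norm (y - x) * norm v"
proof (rule frame_transport[OF coer[OF x] coer[OF y] Kg G_bound[OF x] G_lip[OF x y]])
  fix M assume M: "\<And>F. F \<in> frames (G x) \<Longrightarrow> F ** M \<in> frames (G y)"
    "\<And>v. norm (v v* M - v) \<le> CARD('n) * Kg * sqrt (Kg / m) / m\<^sup>2 * (Lg * norm (y - x)) * norm v"
  show thesis by (rule that[OF M(1)]) (use M(2) in \<open>simp_all add: C_def mult.assoc\<close>)
qed

text \<open>The nonnegative orthant lies in \<Gamma>. This monotonicity is how every error term is
  finally discarded.\<close>

lemma K_upward:
  assumes "x \<in> K" "\<And>i. x $ i \<le> y $ i" shows "y \<in> K"
proof -
  have "x + (y - x) \<in> K" by (intro K_add \<Gamma>_nonneg assms) (use assms(2) in simp)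
  then show ?thesis by simp
qed

text \<open>The change splits into that of the coefficients, controlled by the modulus of continuity
  of X, and that of the frame vectors, controlled by C|y - x|; hence d is uniform over all frames
  and all admissible M.\<close>

lemma X_transport:
  assumes e: "e > 0"
  obtains d where "d > 0" "\<And>x y M E i. x \<in> cball z0 R \<Longrightarrow> y \<in> cball z0 R \<Longrightarrow> norm (y - x) < d \<Longrightarrow>
     (\<And>v. norm (v v* M - v) \<le> C * norm (y - x) * norm v) \<Longrightarrow> E \<in> frames (G x) \<Longrightarrow> E ** M \<in> frames (G y) \<Longrightarrow>
     \<bar>Re (hf (X y) ((E ** M) $ i) ((E ** M) $ i)) - Re (hf (X x) (E $ i) (E $ i))\<bar> \<le> e"
proof -
  define e1 where "e1 = e / (2 * Cf\<^sup>2)"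
  have e1: "e1 > 0" using e Cf_pos by (simp add: e1_def)
  obtain d1 where d1: "d1 > 0" "\<And>x y v w. x \<in> cball z0 R \<Longrightarrow> y \<in> cball z0 R \<Longrightarrow> norm (y - x) < d1 \<Longrightarrow>
      norm (hf (X y - X x) v w) \<le> e1 * norm v * norm w"
    using X_cont[OF e1] by blast
  define q where "q = 2 * Kx * C * Cf\<^sup>2"
  have q: "q \<ge> 0" using Kx C_nonneg by (simp add: q_def)
  define d where "d = min d1 (e / (2 * (q + 1)))"
  have d: "d > 0" using d1 e q by (simp add: d_def)
  show ?thesis
  proof (rule that[OF d])
    fix x y M E i
    assume x: "x \<in> cball z0 R" and y: "y \<in> cball z0 R" and xy: "norm (y - x) < d"
      and M: "\<And>v. norm (v v* M - v) \<le> C * norm (y - x) * norm v" and E: "E \<in> frames (G x)" and EM: "E ** M \<in> frames (G y)"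
    define a b where "a = E $ i" and "b = (E ** M) $ i"
    have na: "norm a \<le> Cf" and nb: "norm b \<le> Cf" using frame_le[OF x E] frame_le[OF y EM] by (auto simp: a_def b_def)
    have "norm (b - a) \<le> C * norm (y - x) * norm a" using M[of a] by (simp add: a_def b_def row_matrix_mult)
    also have "\<dots> \<le> C * norm (y - x) * Cf" using na C_nonneg by (intro mult_left_mono) auto
    finally have nba: "norm (b - a) \<le> C * norm (y - x) * Cf" .
    have "hf (X y) b b - hf (X x) a a = hf (X y - X x) b b + (hf (X x) (b - a) b + hf (X x) a (b - a))"
    proof -
      have "hf (X x) b b = hf (X x) (b - a) b + hf (X x) a b" using hf_add_left[of "X x" "b - a" a b] by simp
      moreover have "hf (X x) a b = hf (X x) a (b - a) + hf (X x) a a" using hf_add_right[of "X x" a "b - a" a] by simp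
      ultimately show ?thesis by (simp add: hf_mat_diff)
    qed
    then have "norm (hf (X y) b b - hf (X x) a a) \<le> norm (hf (X y - X x) b b) + (norm (hf (X x) (b - a) b) + norm (hf (X x) a (b - a)))"
      by (simp only: order_trans[OF norm_triangle_ineq add_left_mono[OF norm_triangle_ineq]])
    moreover have "norm (hf (X y - X x) b b) \<le> e1 * Cf\<^sup>2"
    proof -
      have "norm (hf (X y - X x) b b) \<le> e1 * norm b * norm b" using d1(2)[OF x y] xy by (simp add: d_def)
      also have "\<dots> \<le> e1 * Cf * Cf" using nb e1 Cf_pos by (intro mult_mono) auto
      finally show ?thesis by (simp add: power2_eq_square mult.assoc)
    qed
    moreover have "norm (hf (X x) (b - a) b) \<le> Kx * (C * norm (y - x) * Cf) * Cf"
      by (rule order_trans[OF X_bound[OF x]]) (use nba nb Kx C_nonneg Cf_pos in \<open>intro mult_mono; simp\<close>)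
    moreover have "norm (hf (X x) a (b - a)) \<le> Kx * Cf * (C * norm (y - x) * Cf)"
      by (rule order_trans[OF X_bound[OF x]]) (use nba na Kx C_nonneg Cf_pos in \<open>intro mult_mono; simp\<close>)
    moreover have "Kx * (C * norm (y - x) * Cf) * Cf + Kx * Cf * (C * norm (y - x) * Cf) = q * norm (y - x)"
      by (simp add: q_def power2_eq_square)
    moreover have "q * norm (y - x) \<le> e / 2"
    proof -
      have "q * norm (y - x) \<le> (q + 1) * (e / (2 * (q + 1)))"
        using xy q by (intro mult_mono) (auto simp: d_def)
      also have "\<dots> = e / 2"
      proof -
        have "b * (e / (2 * b)) = e / 2" if "b \<noteq> 0" for b using that by simp
        then show ?thesis using q by (metis add_nonneg_pos less_numeral_extra(3) zero_less_one)
      qed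
      finally show ?thesis .
    qed
    moreover have "e1 * Cf\<^sup>2 = e / 2" using Cf_pos by (simp add: e1_def)
    ultimately have "norm (hf (X y) b b - hf (X x) a a) \<le> e" by linarith
    then show "\<bar>Re (hf (X y) ((E ** M) $ i) ((E ** M) $ i)) - Re (hf (X x) (E $ i) (E $ i))\<bar> \<le> e"
      using abs_Re_le_cmod[of "hf (X y) b b - hf (X x) a a"] by (simp add: a_def b_def)
  qed
qed

text \<open>The polarised Levi form, shifted by 2a so that it is nonnegative as soon as B >= -4a,
  which is the semiconvexity of the sup-convolution used below.\<close>

definition beta :: "real \<Rightarrow> (complex^'n \<Rightarrow> complex^'n \<Rightarrow> real) \<Rightarrow> complex^'n \<Rightarrow> complex^'n \<Rightarrow> real" where
  "beta a B = (\<lambda>h k. (1/4) * (B h k + B (\<i> *s h) (\<i> *s k)) + (2 * a) * (h \<bullet> k) :: real)"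

lemma beta_diag: "beta a B h h = levi B h + 2 * a * (norm h)\<^sup>2"
  by (simp add: beta_def levi_def power2_norm_eq_inner)

lemma beta_bilinear:
  assumes "bilinear B" shows "bilinear (beta a B)"
proof -
  have J: "linear (\<lambda>h::complex^'n. \<i> *s h)" by (simp add: linear_iff vec_eq_iff algebra_simps)
  have "bilinear (\<lambda>h k. B (\<i> *s h) (\<i> *s k))"
    unfolding bilinear_def
  proof (intro conjI allI)
    fix x
    have l: "linear (\<lambda>y. B (\<i> *s x) y)" "linear (\<lambda>y. B y (\<i> *s x))" using assms by (auto simp: bilinear_def)
    from linear_compose[OF J l(1)] linear_compose[OF J l(2)]
    show "linear (\<lambda>y. B (\<i> *s x) (\<i> *s y))" "linear (\<lambda>y. B (\<i> *s y) (\<i> *s x))" by (simp_all add: o_def)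
  qed
  then have "bilinear (\<lambda>h k. (1/4) * (1 * B h k + 1 * B (\<i> *s h) (\<i> *s k)) + (2 * a) * (h \<bullet> k))"
    by (intro bilinear_scale_combine bilinear_inner assms)
  then show ?thesis by (simp add: beta_def[abs_def])
qed

lemma beta_nonneg:
  assumes "\<And>h. B h h \<ge> - (4 * a) * (h \<bullet> h)" shows "0 \<le> beta a B h h"
proof -
  have "- (4 * a) * (norm h)\<^sup>2 \<le> B h h" "- (4 * a) * (norm h)\<^sup>2 \<le> B (\<i> *s h) (\<i> *s h)"
    using assms[of h] assms[of "\<i> *s h"] by (simp_all add: power2_norm_eq_inner[symmetric] norm_vector_smult)
  then show ?thesis unfolding beta_diag levi_def by (simp add: field_simps)
qed

definition "trb a B = (\<Sum>b\<in>Basis. beta a B b b)"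

text \<open>The vector obtained at a frame of \<open>G xh\<close> by freezing the coefficients: the slack \<open>\<delta>\<close> absorbs the change of
  frame, which is only possible because \<open>B\<close> is bounded below (semiconvexity).\<close>

definition "frozen xh a \<delta> \<sigma> B E = (\<chi> i. (1 + \<delta>) * beta a B (E $ i) (E $ i) + \<delta> * trb a B
    - 2 * a * (norm (E $ i))\<^sup>2 + (1 - t) * Re (hf (X xh) (E $ i) (E $ i)) + 3 * \<sigma>)"

text \<open>The passage from \<open>E ** M\<close> back to E costs one unit \<sigma> each for the
  change of X, for the change of 2a|e|^2 and for the term with \<eta>. The change of the Levi form
  has no a priori bound; Young's inequality and \<open>psd_le_trace\<close> charge it to \<delta>
  times beta and \<delta> times its trace.\<close>

lemma freeze:
  fixes B :: "complex^'n \<Rightarrow> complex^'n \<Rightarrow> real"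
  assumes xh: "xh \<in> cball z0 R" and z: "z \<in> cball z0 R"
    and M: "\<And>F. F \<in> frames (G xh) \<Longrightarrow> F ** M \<in> frames (G z)" "\<And>v. norm (v v* M - v) \<le> C * norm (z - xh) * norm v"
    and E: "E \<in> frames (G xh)" and B: "bilinear B" and low: "\<And>h. B h h \<ge> - (4 * a) * (h \<bullet> h)"
    and \<delta>: "\<delta> > 0" and a: "a \<ge> 0"
    and Xt: "\<And>i. Re (hf (X z) ((E ** M) $ i) ((E ** M) $ i)) \<le> Re (hf (X xh) (E $ i) (E $ i)) + \<sigma>"
    and \<eta>: "2 * \<eta> * Cf\<^sup>2 \<le> \<sigma>" "\<eta> \<ge> 0"
    and near1: "(1 + 1 / \<delta>) * (DIM(complex^'n) * (C * norm (z - xh) * Cf)\<^sup>2) \<le> \<delta>"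
    and near2: "4 * a * C * norm (z - xh) * Cf\<^sup>2 \<le> \<sigma>"
    and mem: "(\<chi> i. (1 - t) * Re (hf (X z) ((E ** M) $ i) ((E ** M) $ i)) + levi B ((E ** M) $ i) + 2 * \<eta> * (norm ((E ** M) $ i))\<^sup>2) \<in> K"
  shows "frozen xh a \<delta> \<sigma> B E \<in> K"
proof (rule K_upward[OF mem])
  fix i
  define e e' where "e = E $ i" and "e' = (E ** M) $ i"
  have ne: "norm e \<le> Cf" and ne': "norm e' \<le> Cf" using frame_le[OF xh E] frame_le[OF z M(1)[OF E]] by (auto simp: e_def e'_def)
  have "norm (e' - e) \<le> C * norm (z - xh) * norm e" using M(2)[of e] by (simp add: e_def e'_def row_matrix_mult)
  also have "\<dots> \<le> C * norm (z - xh) * Cf" using ne C_nonneg by (intro mult_left_mono) auto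
  finally have nd: "norm (e' - e) \<le> C * norm (z - xh) * Cf" .
  have \<sigma>: "\<sigma> \<ge> 0" using \<eta> Cf_pos by (meson mult_nonneg_nonneg order_trans zero_le_numeral zero_le_power2)
  note bl = beta_bilinear[OF B, of a]
  have nn: "0 \<le> beta a B h h" for h by (rule beta_nonneg) (rule low)
  have tr: "trb a B \<ge> 0" unfolding trb_def by (intro sum_nonneg nn)
  have "beta a B e' e' \<le> (1 + \<delta>) * beta a B e e + (1 + 1 / \<delta>) * beta a B (e' - e) (e' - e)"
    using psd_perturb[OF bl nn \<delta>, of e "e' - e"] by simp
  also have "(1 + 1 / \<delta>) * beta a B (e' - e) (e' - e) \<le> \<delta> * trb a B"
  proof -
    have "beta a B (e' - e) (e' - e) \<le> DIM(complex^'n) * (norm (e' - e))\<^sup>2 * trb a B"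
      unfolding trb_def by (rule psd_le_trace[OF bl nn])
    also have "\<dots> \<le> DIM(complex^'n) * (C * norm (z - xh) * Cf)\<^sup>2 * trb a B"
      using nd tr by (intro mult_right_mono mult_left_mono power_mono) auto
    finally have "(1 + 1 / \<delta>) * beta a B (e' - e) (e' - e) \<le> (1 + 1 / \<delta>) * (DIM(complex^'n) * (C * norm (z - xh) * Cf)\<^sup>2 * trb a B)"
      using \<delta> by (intro mult_left_mono) auto
    also have "\<dots> = (1 + 1 / \<delta>) * (DIM(complex^'n) * (C * norm (z - xh) * Cf)\<^sup>2) * trb a B" by simp
    also have "\<dots> \<le> \<delta> * trb a B" by (rule mult_right_mono[OF near1 tr])
    finally show ?thesis .
  qed
  finally have b: "beta a B e' e' \<le> (1 + \<delta>) * beta a B e e + \<delta> * trb a B" by simp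
  have "(norm e)\<^sup>2 - (norm e')\<^sup>2 \<le> C * norm (z - xh) * Cf * (2 * Cf)"
  proof -
    have "(norm e)\<^sup>2 - (norm e')\<^sup>2 = (norm e - norm e') * (norm e + norm e')" by (simp add: power2_eq_square algebra_simps)
    also have "\<dots> \<le> norm (e' - e) * (norm e + norm e')"
      using norm_triangle_ineq2[of e e'] by (intro mult_right_mono) (auto simp: norm_minus_commute)
    also have "\<dots> \<le> C * norm (z - xh) * Cf * (2 * Cf)" using nd ne ne' C_nonneg Cf_pos by (intro mult_mono) auto
    finally show ?thesis .
  qed
  then have "2 * a * ((norm e)\<^sup>2 - (norm e')\<^sup>2) \<le> 2 * a * (C * norm (z - xh) * Cf * (2 * Cf))" using a by (intro mult_left_mono) auto
  also have "\<dots> \<le> \<sigma>" using near2 by (simp add: power2_eq_square algebra_simps)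
  finally have n2: "2 * a * (norm e)\<^sup>2 \<le> 2 * a * (norm e')\<^sup>2 + \<sigma>" by (simp add: algebra_simps)
  have "2 * \<eta> * (norm e')\<^sup>2 \<le> 2 * \<eta> * Cf\<^sup>2" using ne' \<eta>(2) by (intro mult_left_mono power_mono) auto
  then have n3: "2 * \<eta> * (norm e')\<^sup>2 \<le> \<sigma>" using \<eta> by linarith
  have "(1 - t) * Re (hf (X z) e' e') \<le> (1 - t) * (Re (hf (X xh) e e) + \<sigma>)" using Xt[of i] t by (intro mult_left_mono) (auto simp: e_def e'_def)
  also have "\<dots> \<le> (1 - t) * Re (hf (X xh) e e) + \<sigma>" using t \<sigma> by (simp add: algebra_simps)
  finally have n4: "(1 - t) * Re (hf (X z) e' e') \<le> (1 - t) * Re (hf (X xh) e e) + \<sigma>" .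
  have n1: "levi B e' = beta a B e' e' - 2 * a * (norm e')\<^sup>2" by (simp add: beta_diag)
  show "(\<chi> i. (1 - t) * Re (hf (X z) ((E ** M) $ i) ((E ** M) $ i)) + levi B ((E ** M) $ i) + 2 * \<eta> * (norm ((E ** M) $ i))\<^sup>2) $ i \<le> frozen xh a \<delta> \<sigma> B E $ i"
    unfolding frozen_def vec_lambda_beta e_def[symmetric] e'_def[symmetric] n1 using b n2 n3 n4 by linarith
qed

text \<open>For q >= 0 the expression is affine in B, and its linear part is a nonnegative
  combination of Levi forms. A half-space thus becomes a constant-coefficient inequality, the kind
  that \<open>viscosity_regularization\<close> preserves.\<close>

lemma frozen_functional:
  assumes q: "\<And>i. q $ i \<ge> 0" "q \<noteq> 0" and \<delta>: "\<delta> > 0" and E: "E \<in> frames (G xh)"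
  obtains xs c where "nonneg_weights xs" "qsum xs (\<bullet>) > 0" "\<And>B. q \<bullet> frozen xh a \<delta> \<sigma> B E = qsum xs B + c"
proof -
  define F where "F = (\<lambda>B. (\<Sum>i\<in>UNIV. q $ i * (1 + \<delta>) * levi B (E $ i)) + (\<Sum>i\<in>UNIV. \<Sum>b\<in>Basis. q $ i * \<delta> * levi B b))"
  have "\<exists>xs. nonneg_weights xs \<and> (\<forall>B. (\<Sum>i\<in>UNIV. q $ i * (1 + \<delta>) * levi B (E $ i)) = qsum xs B)"
    by (intro qsum_list_sum qsum_levi) (use q \<delta> in auto)
  then obtain xs1 where xs1: "nonneg_weights xs1" "\<And>B. (\<Sum>i\<in>UNIV. q $ i * (1 + \<delta>) * levi B (E $ i)) = qsum xs1 B" by blast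
  have "\<exists>xs. nonneg_weights xs \<and> (\<forall>B. (\<Sum>i\<in>(UNIV::'n set). \<Sum>b\<in>(Basis::(complex^'n) set). q $ i * \<delta> * levi B b) = qsum xs B)"
    by (intro qsum_list_sum qsum_levi) (use q \<delta> in auto)
  then obtain xs2 where xs2: "nonneg_weights xs2" "\<And>B. (\<Sum>i\<in>(UNIV::'n set). \<Sum>b\<in>(Basis::(complex^'n) set). q $ i * \<delta> * levi B b) = qsum xs2 B" by blast
  have FB: "F B = qsum (xs1 @ xs2) B" for B by (simp add: F_def xs1 xs2 qsum_append)
  define c where "c = (\<Sum>i\<in>UNIV. q $ i * ((1 + \<delta>) * (2 * a * (norm (E $ i))\<^sup>2) + \<delta> * (\<Sum>b\<in>(Basis::(complex^'n) set). 2 * a * (norm b)\<^sup>2)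
    - 2 * a * (norm (E $ i))\<^sup>2 + (1 - t) * Re (hf (X xh) (E $ i) (E $ i)) + 3 * \<sigma>))"
  obtain i0 where i0: "q $ i0 > 0" using q by (metis less_eq_real_def vec_eq_iff zero_index)
  show ?thesis
  proof (rule that[of "xs1 @ xs2" c])
    show "nonneg_weights (xs1 @ xs2)" using xs1(1) xs2(1) by (auto simp: nonneg_weights_def)
    \<comment> \<open>A positive weight on a nonzero frame vector makes the trace of the operator
      positive.\<close>
    have "E $ i0 \<noteq> 0" using E unfolding frames_def by (auto simp: hf_def dest!: spec[of _ i0])
    then have "0 < q $ i0 * (1 + \<delta>) * levi (\<bullet>) (E $ i0)" using i0 \<delta> by (simp add: levi_inner)
    also have "\<dots> \<le> (\<Sum>i\<in>UNIV. q $ i * (1 + \<delta>) * levi (\<bullet>) (E $ i))"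
      by (rule member_le_sum) (use q \<delta> in \<open>auto simp: levi_inner\<close>)
    also have "\<dots> \<le> F (\<bullet>)"
      unfolding F_def using q \<delta> by (simp add: levi_inner sum_nonneg)
    finally show "qsum (xs1 @ xs2) (\<bullet>) > 0" by (simp add: FB)
    fix B
    have "q \<bullet> frozen xh a \<delta> \<sigma> B E = F B + c"
      unfolding inner_vec_def frozen_def F_def c_def trb_def beta_diag
      by (simp add: sum.distrib[symmetric] sum_distrib_left[symmetric]) (simp add: sum.distrib sum_distrib_left algebra_simps)
    then show "q \<bullet> frozen xh a \<delta> \<sigma> B E = qsum (xs1 @ xs2) B + c" by (simp add: FB)
  qed
qed

lemma contradiction: False
proof -
  define N where "N = real (DIM(complex^'n))"
  have N: "N > 0" by (simp add: N_def)
  \<comment> \<open>The slack t s0 is spent in eight units: three inside \<open>frozen\<close>, and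
    one each for the \<delta>-terms, the change of X from xh to z0, its change from xh to ym, the
    penalty a|e - e'|^2 and the \<tau>-terms.\<close>
  define \<sigma> where "\<sigma> = t * s0 / 8"
  have \<sigma>: "\<sigma> > 0" using t s0 by (simp add: \<sigma>_def)
  have Cf2: "Cf\<^sup>2 > 0" using Cf_pos by simp
  \<comment> \<open>The terms \<eta>|x - z0|^2 and \<eta>|x - xh|^2 subtracted below come back as
    2\<eta>|e|^2 in the Levi form, which is at most \<sigma>.\<close>
  define \<eta> where "\<eta> = \<sigma> / (2 * Cf\<^sup>2)"
  have \<eta>: "\<eta> > 0" "2 * \<eta> * Cf\<^sup>2 = \<sigma>" using \<sigma> Cf2 by (simp_all add: \<eta>_def)
  obtain d1 where d1: "d1 > 0" "\<And>x y M E i. x \<in> cball z0 R \<Longrightarrow> y \<in> cball z0 R \<Longrightarrow> norm (y - x) < d1 \<Longrightarrow>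
     (\<And>v. norm (v v* M - v) \<le> C * norm (y - x) * norm v) \<Longrightarrow> E \<in> frames (G x) \<Longrightarrow> E ** M \<in> frames (G y) \<Longrightarrow>
     \<bar>Re (hf (X y) ((E ** M) $ i) ((E ** M) $ i)) - Re (hf (X x) (E $ i) (E $ i))\<bar> \<le> \<sigma>"
    using X_transport[OF \<sigma>] by metis
  define r1 where "r1 = min R (d1 / 2)"
  have r1: "r1 > 0" "r1 \<le> R" "2 * r1 \<le> d1" using R d1(1) by (auto simp: r1_def)
  have in_R: "x \<in> cball z0 R" "x \<in> ball z0 R" if "norm (x - z0) < r1" for x
    using that r1 by (auto simp: dist_norm norm_minus_commute)
  have close: "norm (y - x) < d1" if "norm (x - z0) < r1" "norm (y - z0) < r1" for x y
    using norm_triangle_ineq4[of "y - z0" "x - z0"] that r1 by simp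
  \<comment> \<open>The quadratic term turns z0 into a strict maximum of f - v, as
    \<open>doubling\<close> requires.\<close>
  define f where "f = (\<lambda>x. (1 - t) * u x - \<eta> * ((x - z0) \<bullet> (x - z0)))"
  have f_cont: "continuous_on (cball z0 R) f" unfolding f_def by (intro continuous_intros u_cont)
  \<comment> \<open>The second bound yields \<open>gap\<close>, which later pays half of the error
    2a|e - e'|^2 caused by the displacement of frames.\<close>
  define \<theta> where "\<theta> = min (r1 / 2) (\<sigma> / (8 * C\<^sup>2 * Cf\<^sup>2 + 1))"
  have den: "8 * C\<^sup>2 * Cf\<^sup>2 + 1 > 0" by (simp add: add_nonneg_pos)
  have \<theta>: "\<theta> > 0" using r1 \<sigma> den by (simp add: \<theta>_def)
  have fmax: "f x - v x + \<eta> * (norm (x - z0))\<^sup>2 \<le> f z0 - v z0" if "x \<in> cball z0 R" for x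
    using max[OF that] by (simp add: f_def power2_norm_eq_inner)
  have z0R: "z0 \<in> cball z0 R" using R by simp
  obtain a xh yh where a1: "a \<ge> 1" and xyR: "xh \<in> cball z0 R" "yh \<in> cball z0 R"
    and dmax: "\<And>x' y'. x' \<in> cball z0 R \<Longrightarrow> y' \<in> cball z0 R \<Longrightarrow>
      f x' - v y' - a * ((x' - y') \<bullet> (x' - y')) \<le> f xh - v yh - a * ((xh - yh) \<bullet> (xh - yh))"
    and near: "norm (xh - z0) < \<theta>" "norm (yh - z0) < \<theta>" "a * (norm (xh - yh))\<^sup>2 < \<theta>"
    by (rule doubling[OF compact_cball f_cont v_cont z0R \<eta>(1) \<theta> fmax]) (assumption, rule that)
  have a: "a > 0" "a \<ge> 0" using a1 by auto
  have xh: "norm (xh - z0) < r1 / 2" and yh: "norm (yh - z0) < r1 / 2" using near by (auto simp: \<theta>_def)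
  have gap: "8 * C\<^sup>2 * Cf\<^sup>2 * (a * (norm (xh - yh))\<^sup>2) \<le> \<sigma>"
  proof -
    have "8 * C\<^sup>2 * Cf\<^sup>2 * (a * (norm (xh - yh))\<^sup>2) \<le> (8 * C\<^sup>2 * Cf\<^sup>2 + 1) * (\<sigma> / (8 * C\<^sup>2 * Cf\<^sup>2 + 1))"
      using near(3) den a by (intro mult_mono) (auto simp: \<theta>_def)
    then show ?thesis using den by simp
  qed
  define xt where "xt = (1/2) *\<^sub>R (xh + yh)"
  have xt_xh: "xt - xh = (1/2) *\<^sub>R (yh - xh)" and xt_yh: "xt - yh = (1/2) *\<^sub>R (xh - yh)"
    unfolding xt_def by (simp_all add: vec_eq_iff complex_eq_iff field_simps)
  \<comment> \<open>Parallelogram inequality, with equality at the midpoint xt: a sup-convolution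
    with constant 2a combined with a penalty 2a reproduces the penalty a.\<close>
  have par: "a * ((x' - y) \<bullet> (x' - y)) \<le> 2 * a * ((x - x') \<bullet> (x - x')) + 2 * a * ((x - y) \<bullet> (x - y))" for x x' y :: "complex^'n"
  proof -
    have "0 \<le> (2 *\<^sub>R x - x' - y) \<bullet> (2 *\<^sub>R x - x' - y)" by simp
    then have "(x' - y) \<bullet> (x' - y) \<le> 2 * ((x - x') \<bullet> (x - x')) + 2 * ((x - y) \<bullet> (x - y))"
      by (simp add: inner_simps inner_commute algebra_simps)
    then show ?thesis using mult_left_mono[OF _ a(2)] by (fastforce simp: algebra_simps)
  qed
  have par_eq: "2 * a * ((xt - xh) \<bullet> (xt - xh)) + 2 * a * ((xt - yh) \<bullet> (xt - yh)) = a * ((xh - yh) \<bullet> (xh - yh))"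
    unfolding xt_xh xt_yh by (simp add: inner_simps inner_commute algebra_simps)
  \<comment> \<open>At the regularised doubled maximum \<open>beta_up\<close> will bound the shifted
    Levi form by 5a|h|^2; this \<delta> makes \<delta> times its value at e plus \<delta> times its
    trace at most \<sigma>.\<close>
  define \<delta> where "\<delta> = \<sigma> / (5 * a * Cf\<^sup>2 + 5 * a * N)"
  have den2: "5 * a * Cf\<^sup>2 + 5 * a * N > 0" using a N Cf2 by (intro add_pos_pos mult_pos_pos) auto
  have \<delta>: "\<delta> > 0" "\<delta> * (5 * a * Cf\<^sup>2 + 5 * a * N) = \<sigma>" using \<sigma> den2 by (simp_all add: \<delta>_def)
  \<comment> \<open>The factor 1 + 1 / \<delta> is fixed by now, so the radius can be taken small
    relative to it and to a.\<close>
  obtain \<rho> where \<rho>: "\<rho> > 0" "\<rho> < r1 / 2" "\<And>s. 0 \<le> s \<Longrightarrow> s \<le> \<rho> \<Longrightarrow> (1 + 1 / \<delta>) * (DIM(complex^'n) * (C * s * Cf)\<^sup>2) \<le> \<delta>"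
    "\<And>s. 0 \<le> s \<Longrightarrow> s \<le> \<rho> \<Longrightarrow> 4 * a * C * s * Cf\<^sup>2 \<le> \<sigma>"
  proof -
    have lim1: "((\<lambda>s. (1 + 1 / \<delta>) * (DIM(complex^'n) * (C * s * Cf)\<^sup>2)) \<longlongrightarrow> (1 + 1 / \<delta>) * (DIM(complex^'n) * (C * 0 * Cf)\<^sup>2)) (at_right (0::real))"
      by (intro tendsto_intros)
    have lim2: "((\<lambda>s. 4 * a * C * s * Cf\<^sup>2) \<longlongrightarrow> 4 * a * C * 0 * Cf\<^sup>2) (at_right (0::real))"
      by (intro tendsto_intros)
    have e1: "\<forall>\<^sub>F s in at_right (0::real). (1 + 1 / \<delta>) * (DIM(complex^'n) * (C * s * Cf)\<^sup>2) < \<delta>"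
      by (rule order_tendstoD(2)[OF lim1]) (use \<delta> in simp)
    have e2: "\<forall>\<^sub>F s in at_right (0::real). 4 * a * C * s * Cf\<^sup>2 < \<sigma>"
      by (rule order_tendstoD(2)[OF lim2]) (use \<sigma> in simp)
    have e3: "\<forall>\<^sub>F s in at_right (0::real). s < r1 / 2"
      using r1 by (simp add: eventually_at_right_real) (auto simp: eventually_at_right_field intro!: exI[of _ "r1 / 2"])
    have "\<forall>\<^sub>F s in at_right (0::real). (0 < s \<and> s < r1 / 2) \<and> (1 + 1 / \<delta>) * (DIM(complex^'n) * (C * s * Cf)\<^sup>2) < \<delta> \<and> 4 * a * C * s * Cf\<^sup>2 < \<sigma>"
      by (intro eventually_conj e1 e2 e3 eventually_at_right_less)
    then obtain \<rho> where \<rho>: "0 < \<rho>" "\<rho> < r1 / 2" "(1 + 1 / \<delta>) * (DIM(complex^'n) * (C * \<rho> * Cf)\<^sup>2) < \<delta>" "4 * a * C * \<rho> * Cf\<^sup>2 < \<sigma>"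
      using eventually_happens'[OF trivial_limit_at_right_real] by blast
    show ?thesis
    proof (rule that[OF \<rho>(1,2)])
      fix s :: real assume s: "0 \<le> s" "s \<le> \<rho>"
      have "(1 + 1 / \<delta>) * (DIM(complex^'n) * (C * s * Cf)\<^sup>2) \<le> (1 + 1 / \<delta>) * (DIM(complex^'n) * (C * \<rho> * Cf)\<^sup>2)"
        using s \<delta>(1) C_nonneg Cf_pos by (intro mult_left_mono power_mono mult_right_mono) auto
      then show "(1 + 1 / \<delta>) * (DIM(complex^'n) * (C * s * Cf)\<^sup>2) \<le> \<delta>" using \<rho>(3) by linarith
      have "4 * a * C * s * Cf\<^sup>2 \<le> 4 * a * C * \<rho> * Cf\<^sup>2"
        using s a C_nonneg by (intro mult_right_mono mult_left_mono) auto
      then show "4 * a * C * s * Cf\<^sup>2 \<le> \<sigma>" using \<rho>(4) by linarith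
    qed
  qed
  have ball_xh: "norm (x - z0) < r1" if "norm (x - xh) \<le> \<rho>" for x
    using norm_triangle_ineq[of "x - xh" "xh - z0"] that \<rho>(2) xh by simp
  \<comment> \<open>The second quadratic term keeps the points attaining the sup-convolution off the
    boundary of its ball, see \<open>interior\<close>.\<close>
  define f2 where "f2 = (\<lambda>x. f x - \<eta> * ((x - xh) \<bullet> (x - xh)))"
  have f2_cont: "continuous_on (cball xh \<rho>) f2"
    unfolding f2_def
    by (intro continuous_intros continuous_on_subset[OF f_cont])
       (use ball_xh in_R in \<open>auto simp: dist_norm norm_minus_commute\<close>)
  obtain w where w: "continuous_on UNIV w"
    "\<And>x z. x \<in> cball xh \<rho> \<Longrightarrow> f2 x - 2 * a * ((z - x) \<bullet> (z - x)) \<le> w z"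
    "\<And>z. \<exists>x\<in>cball xh \<rho>. w z = f2 x - 2 * a * ((z - x) \<bullet> (z - x))"
    by (rule sup_convolution[OF f2_cont \<rho>(1), of "2 * a"]) (use a in simp, rule that)
  text \<open>The doubled functional of the sup-convolution keeps its maximum, at the midpoint of the old one.\<close>
  have wmax: "w x - v y - 2 * a * ((x - y) \<bullet> (x - y)) \<le> w xt - v yh - 2 * a * ((xt - yh) \<bullet> (xt - yh))"
    if y: "y \<in> cball z0 R" for x y
  proof -
    obtain x' where x': "x' \<in> cball xh \<rho>" "w x = f2 x' - 2 * a * ((x - x') \<bullet> (x - x'))" using w(3) by blast
    have "x' \<in> cball z0 R" using x'(1) ball_xh in_R by (auto simp: dist_norm norm_minus_commute)
    from dmax[OF this y] have "w x - v y - 2 * a * ((x - y) \<bullet> (x - y)) \<le> f xh - v yh - a * ((xh - yh) \<bullet> (xh - yh))"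
      using x'(2) par[of x' y x] mult_nonneg_nonneg[OF less_imp_le[OF \<eta>(1)] inner_ge_zero[of "x' - xh"]]
      unfolding f2_def by linarith
    moreover have "f xh - 2 * a * ((xt - xh) \<bullet> (xt - xh)) \<le> w xt" using w(2)[of xh xt] \<rho> by (simp add: f2_def)
    ultimately show ?thesis using par_eq by linarith
  qed
  \<comment> \<open>The first bound serves \<open>interior\<close>; the second pays for replacing yh
    by a nearby point ym in the displacement of frames.\<close>
  define r where "r = min (\<eta> * \<rho> / (16 * a)) (sqrt (\<sigma> / (8 * a * C\<^sup>2 * Cf\<^sup>2 + 1)))"
  define r' where "r' = min r (r1 / 2)"
  have den3: "8 * a * C\<^sup>2 * Cf\<^sup>2 + 1 > 0" using a by (simp add: add_nonneg_pos)
  have r': "r' > 0" using \<eta> \<rho> a \<sigma> den3 r1 by (simp add: r'_def r_def)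
  have r'1: "8 * a * C\<^sup>2 * Cf\<^sup>2 * r'\<^sup>2 \<le> \<sigma>"
  proof -
    have "r'\<^sup>2 \<le> (sqrt (\<sigma> / (8 * a * C\<^sup>2 * Cf\<^sup>2 + 1)))\<^sup>2" using r' by (intro power_mono) (auto simp: r'_def r_def)
    also have "\<dots> = \<sigma> / (8 * a * C\<^sup>2 * Cf\<^sup>2 + 1)" using \<sigma> den3 by simp
    finally have "8 * a * C\<^sup>2 * Cf\<^sup>2 * r'\<^sup>2 \<le> (8 * a * C\<^sup>2 * Cf\<^sup>2 + 1) * (\<sigma> / (8 * a * C\<^sup>2 * Cf\<^sup>2 + 1))"
      using a den3 by (intro mult_mono) auto
    then show ?thesis using den3 by simp
  qed
  \<comment> \<open>If the supremum were attained on the sphere of radius \<rho>, the loss \<eta>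
    \<rho>^2 would have to be recovered from 4a (z - xt).(x' - xh), which is less than half of it
    for z this close to xt.\<close>
  have interior: "norm (x' - xh) < \<rho>"
    if z: "z \<in> ball xt (2 * r')" and x': "x' \<in> cball xh \<rho>" and wz: "w z = f2 x' - 2 * a * ((z - x') \<bullet> (z - x'))" for z x'
  proof (rule ccontr)
    assume "\<not> norm (x' - xh) < \<rho>"
    then have nx: "norm (x' - xh) = \<rho>" using x' by (simp add: dist_norm norm_minus_commute)
    then have ip: "(x' - xh) \<bullet> (x' - xh) = \<rho>\<^sup>2" by (simp add: power2_norm_eq_inner[symmetric])
    have "x' \<in> cball z0 R" using x' ball_xh in_R by (auto simp: dist_norm norm_minus_commute)
    from dmax[OF this xyR(2)] have "f x' - a * ((x' - yh) \<bullet> (x' - yh)) \<le> f xh - a * ((xh - yh) \<bullet> (xh - yh))" by simp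
    with par[of x' yh xt] par_eq have "f x' - 2 * a * ((xt - x') \<bullet> (xt - x')) \<le> f xh - 2 * a * ((xt - xh) \<bullet> (xt - xh))" by linarith
    moreover have "f2 xh - 2 * a * ((z - xh) \<bullet> (z - xh)) \<le> f2 x' - 2 * a * ((z - x') \<bullet> (z - x'))"
      using w(2)[of xh z] \<rho>(1) wz by simp
    moreover have "f2 xh = f xh" "f2 x' = f x' - \<eta> * \<rho>\<^sup>2" by (simp_all add: f2_def ip)
    ultimately have "\<eta> * \<rho>\<^sup>2 \<le> 2 * a * ((z - xh) \<bullet> (z - xh)) - 2 * a * ((z - x') \<bullet> (z - x')) - (2 * a * ((xt - xh) \<bullet> (xt - xh)) - 2 * a * ((xt - x') \<bullet> (xt - x')))"
      by linarith
    also have "\<dots> = 4 * a * ((z - xt) \<bullet> (x' - xh))" by (simp add: inner_simps inner_commute algebra_simps)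
    also have "\<dots> \<le> 4 * a * (norm (z - xt) * \<rho>)" using norm_cauchy_schwarz[of "z - xt" "x' - xh"] nx a by (intro mult_left_mono) auto
    also have "\<dots> < 4 * a * ((2 * r') * \<rho>)"
      using z a \<rho> by (intro mult_strict_left_mono mult_strict_right_mono) (auto simp: dist_norm norm_minus_commute)
    also have "\<dots> \<le> 4 * a * ((2 * (\<eta> * \<rho> / (16 * a))) * \<rho>)"
      using a \<rho> by (intro mult_left_mono mult_right_mono) (auto simp: r'_def r_def)
    also have "\<dots> = \<eta> * \<rho>\<^sup>2 / 2" using a by (simp add: power2_eq_square)
    finally show False using \<eta> \<rho> by simp
  qed
  have semiconvex: "B h h \<ge> - (4 * a) * (h \<bullet> h)" if tw: "touch_above w z l B" for z l B h
  proof -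
    obtain p where p: "p \<in> cball xh \<rho>" "w z = f2 p - 2 * a * ((z - p) \<bullet> (z - p))" using w(3) by blast
    have "B h h \<ge> - 2 * (2 * a) * (h \<bullet> h)"
    proof (rule touch_above_convex_lower[OF tw])
      fix k
      show "w z - 2 * a * ((z + k - p) \<bullet> (z + k - p)) + 2 * a * ((z - p) \<bullet> (z - p)) \<le> w (z + k)"
        using w(2)[OF p(1), of "z + k"] p(2) by simp
    qed
    then show ?thesis by simp
  qed
  \<comment> \<open>A quadratic touching w at z also touches f2 at the point p where the supremum is
    attained, after translation. Restoring the \<eta>-terms and dividing by 1 - t gives a test
    function for u at p; its frame is then transported back to xh.\<close>
  have frozen: "frozen xh a \<delta> \<sigma> B E \<in> K"
    if z: "z \<in> ball xt (2 * r')" and tw: "touch_above w z l B" and E: "E \<in> frames (G xh)" for z l B E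
  proof -
    obtain p where p: "p \<in> cball xh \<rho>" "w z = f2 p - 2 * a * ((z - p) \<bullet> (z - p))" using w(3) by blast
    have pi: "norm (p - xh) < \<rho>" by (rule interior[OF z p])
    have pR: "norm (p - z0) < r1" using pi by (intro ball_xh) simp
    obtain d where d: "d > 0" "\<And>k. norm k < d \<Longrightarrow> w (z + k) \<le> w z + l k + B k k / 2" and l: "linear l" and B: "bilinear B"
      using tw by (auto simp: touch_above_def)
    define c where "c = 1 / (1 - t)"
    have c: "c > 0" "(1 - t) * c = 1" using t by (auto simp: c_def)
    define l' where "l' = (\<lambda>k. c * l k + (2 * \<eta> * c) * ((p - z0) \<bullet> k + (p - xh) \<bullet> k))"
    define B' where "B' = (\<lambda>h k. c * B h k + (4 * \<eta> * c) * (h \<bullet> k))"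
    have "touch_above u p l' B'"
      unfolding touch_above_def
    proof (intro conjI exI allI impI)
      show "linear l'" using l unfolding l'_def linear_iff by (auto simp: algebra_simps inner_simps)
      show "bilinear B'" unfolding B'_def by (intro bilinear_scale_combine B bilinear_inner)
      show "min d (\<rho> - norm (p - xh)) > 0" using d pi by simp
      fix k :: "complex^'n" assume k: "norm k < min d (\<rho> - norm (p - xh))"
      have "p + k \<in> cball xh \<rho>"
        using k norm_triangle_ineq[of "p - xh" k] by (simp add: dist_norm norm_minus_commute[of xh] algebra_simps)
      from w(2)[OF this, of "z + k"] have "f2 (p + k) - 2 * a * ((z - p) \<bullet> (z - p)) \<le> w (z + k)" by simp
      also have "\<dots> \<le> w z + l k + B k k / 2" using d(2) k by simp
      finally have "f2 (p + k) \<le> f2 p + l k + B k k / 2" using p(2) by simp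
      then have ineq: "(1 - t) * u (p + k) \<le> (1 - t) * u p + (l k + B k k / 2 + 2 * \<eta> * ((p - z0) \<bullet> k + (p - xh) \<bullet> k) + 2 * \<eta> * (k \<bullet> k))"
        by (simp add: f2_def f_def inner_simps inner_commute algebra_simps)
      define Z where "Z = l k + B k k / 2 + 2 * \<eta> * ((p - z0) \<bullet> k + (p - xh) \<bullet> k) + 2 * \<eta> * (k \<bullet> k)"
      have "c * ((1 - t) * u (p + k)) \<le> c * ((1 - t) * u p + Z)"
        unfolding Z_def using ineq c by (intro mult_left_mono) auto
      moreover have "c * ((1 - t) * y) = y" for y
      proof -
        have "c * ((1 - t) * y) = ((1 - t) * c) * y" by simp
        then show ?thesis by (simp only: c(2) mult_1)
      qed
      ultimately have "u (p + k) \<le> u p + c * Z" by (simp only: distrib_left)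
      moreover have "c * Z = l' k + B' k k / 2"
        unfolding Z_def l'_def B'_def by (simp add: field_simps)
      ultimately show "u (p + k) \<le> u p + l' k + B' k k / 2" by simp
    qed
    obtain M where M: "\<And>F. F \<in> frames (G xh) \<Longrightarrow> F ** M \<in> frames (G p)" "\<And>v. norm (v v* M - v) \<le> C * norm (p - xh) * norm v"
      using transport[OF xyR(1) in_R(1)[OF pR]] by metis
    have "(\<chi> i. Re (hf (X p) ((E ** M) $ i) ((E ** M) $ i)) + levi B' ((E ** M) $ i)) \<in> K1"
      by (rule sub[OF in_R(2)[OF pR] \<open>touch_above u p l' B'\<close> M(1)[OF E]])
    from K1[OF this] have "(1 - t) *\<^sub>R (\<chi> i. Re (hf (X p) ((E ** M) $ i) ((E ** M) $ i)) + levi B' ((E ** M) $ i)) \<in> K" .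
    also have "(1 - t) *\<^sub>R (\<chi> i. Re (hf (X p) ((E ** M) $ i) ((E ** M) $ i)) + levi B' ((E ** M) $ i))
      = (\<chi> i. (1 - t) * Re (hf (X p) ((E ** M) $ i) ((E ** M) $ i)) + levi B ((E ** M) $ i) + 2 * \<eta> * (norm ((E ** M) $ i))\<^sup>2)"
    proof -
      have "(1 - t) * levi B' h = levi B h + 2 * \<eta> * (norm h)\<^sup>2" for h
      proof -
        have "(1 - t) * levi B' h = ((1 - t) * c) * levi B h + ((1 - t) * c) * (2 * \<eta> * (norm h)\<^sup>2)"
          unfolding B'_def levi_combine levi_inner by (simp add: algebra_simps)
        then show ?thesis by (simp add: c(2))
      qed
      then show ?thesis by (simp add: vec_eq_iff distrib_left add.assoc)
    qed
    finally have mem: "(\<chi> i. (1 - t) * Re (hf (X p) ((E ** M) $ i) ((E ** M) $ i)) + levi B ((E ** M) $ i) + 2 * \<eta> * (norm ((E ** M) $ i))\<^sup>2) \<in> K" .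
    have Xt: "Re (hf (X p) ((E ** M) $ i) ((E ** M) $ i)) \<le> Re (hf (X xh) (E $ i) (E $ i)) + \<sigma>" for i
    proof -
      have "norm (xh - z0) < r1" using xh r1 by linarith
      from d1(2)[OF xyR(1) in_R(1)[OF pR] close[OF this pR] M(2) E M(1)[OF E], of i] show ?thesis by linarith
    qed
    show ?thesis
    proof (rule freeze[OF xyR(1) in_R(1)[OF pR] M E B semiconvex[OF tw] \<delta>(1) a(2) Xt _ _ _ _ mem])
      show "2 * \<eta> * Cf\<^sup>2 \<le> \<sigma>" "0 \<le> \<eta>" using \<eta> by auto
      show "(1 + 1 / \<delta>) * (DIM(complex^'n) * (C * norm (p - xh) * Cf)\<^sup>2) \<le> \<delta>" by (rule \<rho>(3)) (use pi in auto)
      show "4 * a * C * norm (p - xh) * Cf\<^sup>2 \<le> \<sigma>" by (rule \<rho>(4)) (use pi in auto)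
    qed
  qed
  \<comment> \<open>The final test function loses 2\<tau>|e|^2 + \<tau>|e'|^2, together at most
    \<sigma>; \<tau> <= a is used for the upper bound of the Hessian.\<close>
  define \<tau> where "\<tau> = min a (\<sigma> / (3 * Cf\<^sup>2))"
  have \<tau>: "\<tau> > 0" "\<tau> \<le> a" "3 * \<tau> * Cf\<^sup>2 \<le> \<sigma>"
  proof -
    show "\<tau> > 0" "\<tau> \<le> a" using a \<sigma> Cf2 by (auto simp: \<tau>_def)
    have "\<tau> \<le> \<sigma> / (3 * Cf\<^sup>2)" by (simp add: \<tau>_def)
    then show "3 * \<tau> * Cf\<^sup>2 \<le> \<sigma>" using Cf2 by (simp add: pos_le_divide_eq mult_ac)
  qed
  obtain W where W: "\<And>x. x \<in> cball xt r' \<Longrightarrow> \<bar>W x - w x\<bar> \<le> \<tau> * r'\<^sup>2 / 4"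
    and W2: "\<And>z. \<exists>l B. taylor2 W z l B \<and> (\<forall>xs b. nonneg_weights xs \<longrightarrow> qsum xs (\<bullet>) > 0 \<longrightarrow>
      (\<forall>x\<in>ball z r'. \<forall>l' B'. touch_above w x l' B' \<longrightarrow> qsum xs B' \<ge> b) \<longrightarrow> qsum xs B \<ge> b)"
    by (rule viscosity_regularization[OF w(1) r', of "\<tau> * r'\<^sup>2 / 4" xt]) (use \<tau> r' in simp, rule that)
  have Wc: "continuous_on S W" for S
    using W2 taylor2_imp_continuous continuous_at_imp_continuous_on by metis
  have yh_ball: "norm (y - z0) < r1" if "y \<in> cball yh r'" for y
  proof -
    have "norm (y - yh) \<le> r1 / 2" using that by (simp add: r'_def dist_norm norm_minus_commute)
    then show ?thesis using norm_triangle_ineq[of "y - yh" "yh - z0"] yh by simp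
  qed
  \<comment> \<open>W differs from w by at most \<tau> r'^2 / 4. Two such errors cannot outweigh a
    \<tau>-penalty at distance r', so the maximum of \<Psi> stays in the interior of both
    balls.\<close>
  define \<Psi> where "\<Psi> = (\<lambda>x y. W x - v y - 2 * a * ((x - y) \<bullet> (x - y)) - \<tau> * ((x - xt) \<bullet> (x - xt)) - \<tau> * ((y - yh) \<bullet> (y - yh)))"
  have \<Psi>c: "continuous_on (cball xt r' \<times> cball yh r') (\<lambda>p. \<Psi> (fst p) (snd p))"
    unfolding \<Psi>_def
    by (intro continuous_intros continuous_on_compose2[OF Wc[of UNIV]] continuous_on_compose2[OF v_cont])
       (use yh_ball in_R in auto)
  have "(xt, yh) \<in> cball xt r' \<times> cball yh r'" using r' by simp
  then have ne: "cball xt r' \<times> cball yh r' \<noteq> {}" by blast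
  obtain pm where pm: "pm \<in> cball xt r' \<times> cball yh r'" "\<And>p. p \<in> cball xt r' \<times> cball yh r' \<Longrightarrow> \<Psi> (fst p) (snd p) \<le> \<Psi> (fst pm) (snd pm)"
    using continuous_attains_sup[OF compact_Times[OF compact_cball compact_cball] ne \<Psi>c] by blast
  define xm ym where "xm = fst pm" and "ym = snd pm"
  have xm: "xm \<in> cball xt r'" and ym: "ym \<in> cball yh r'" using pm(1) by (auto simp: xm_def ym_def)
  have \<Psi>max: "\<Psi> x y \<le> \<Psi> xm ym" if "x \<in> cball xt r'" "y \<in> cball yh r'" for x y
    using pm(2)[of "(x, y)"] that by (simp add: xm_def ym_def)
  have ymR: "norm (ym - z0) < r1" by (rule yh_ball[OF ym])
  have int: "norm (xm - xt) < r'" "norm (ym - yh) < r'"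
  proof -
    have "\<Psi> xt yh \<le> \<Psi> xm ym" using r' by (intro \<Psi>max) auto
    moreover have "\<Psi> xt yh \<ge> w xt - \<tau> * r'\<^sup>2 / 4 - v yh - 2 * a * ((xt - yh) \<bullet> (xt - yh))"
    proof -
      have "xt \<in> cball xt r'" using r' by simp
      from W[OF this] have "w xt - \<tau> * r'\<^sup>2 / 4 \<le> W xt" by linarith
      then show ?thesis by (simp add: \<Psi>_def)
    qed
    moreover have "\<Psi> xm ym \<le> w xm + \<tau> * r'\<^sup>2 / 4 - v ym - 2 * a * ((xm - ym) \<bullet> (xm - ym)) - \<tau> * ((xm - xt) \<bullet> (xm - xt)) - \<tau> * ((ym - yh) \<bullet> (ym - yh))"
      using W[OF xm] unfolding \<Psi>_def by linarith
    moreover note wmax[OF in_R(1)[OF ymR], of xm]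
    ultimately have "\<tau> * ((xm - xt) \<bullet> (xm - xt)) + \<tau> * ((ym - yh) \<bullet> (ym - yh)) \<le> \<tau> * r'\<^sup>2 / 2" by linarith
    then have "\<tau> * ((xm - xt) \<bullet> (xm - xt) + (ym - yh) \<bullet> (ym - yh)) \<le> \<tau> * (r'\<^sup>2 / 2)" by (simp add: distrib_left)
    then have s: "(norm (xm - xt))\<^sup>2 + (norm (ym - yh))\<^sup>2 \<le> r'\<^sup>2 / 2" using \<tau> by (simp add: power2_norm_eq_inner)
    have "r'\<^sup>2 > 0" using r' by simp
    then have "(norm (xm - xt))\<^sup>2 < r'\<^sup>2" "(norm (ym - yh))\<^sup>2 < r'\<^sup>2"
      using s zero_le_power2[of "norm (xm - xt)"] zero_le_power2[of "norm (ym - yh)"] by linarith+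
    then show "norm (xm - xt) < r'" "norm (ym - yh) < r'" using r' by (auto intro: power_less_imp_less_base[of _ 2])
  qed
  obtain l B where taylor: "taylor2 W xm l B" and reg: "\<And>xs b. nonneg_weights xs \<Longrightarrow> qsum xs (\<bullet>) > 0 \<Longrightarrow>
      (\<forall>x\<in>ball xm r'. \<forall>l' B'. touch_above w x l' B' \<longrightarrow> qsum xs B' \<ge> b) \<Longrightarrow> qsum xs B \<ge> b"
    using W2[of xm] by blast
  have l: "linear l" and B: "bilinear B" using taylor by (auto simp: taylor2_def)
  have ball2: "x \<in> ball xt (2 * r')" if "x \<in> ball xm r'" for x
    using that int(1) norm_triangle_ineq[of "x - xm" "xm - xt"] by (simp add: dist_norm norm_minus_commute)
  \<comment> \<open>Semiconvexity is itself a constant-coefficient inequality, for the operator B(h,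
    h), and so it passes to the regularisation.\<close>
  have B_low: "B h h \<ge> - (4 * a) * (h \<bullet> h)" for h
  proof (cases "h = 0")
    case False
    have "qsum [(1, h)] B \<ge> - (4 * a) * (h \<bullet> h)"
      by (rule reg) (use False semiconvex in \<open>auto simp: nonneg_weights_def qsum_def\<close>)
    then show ?thesis by (simp add: qsum_def)
  qed (simp add: bilinear_lzero[OF B])
  \<comment> \<open>Maximality of \<Psi> in x alone, with y fixed.\<close>
  have B_up: "B h h \<le> (4 * a + 2 * \<tau>) * (h \<bullet> h)" for h
  proof -
    define l2 where "l2 = (\<lambda>k. 4 * a * ((xm - ym) \<bullet> k) + 2 * \<tau> * ((xm - xt) \<bullet> k))"
    define B2 where "B2 = (\<lambda>h k::complex^'n. (4 * a + 2 * \<tau>) * (h \<bullet> k) + 0 * (h \<bullet> k))"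
    have "qsum [(1, h)] B \<le> qsum [(1, h)] B2"
    proof (rule taylor2_touch[OF _ taylor])
      show "linear l2" by (simp add: l2_def linear_iff inner_simps algebra_simps)
      show "bilinear B2" unfolding B2_def by (intro bilinear_scale_combine bilinear_inner)
      show "r' - norm (xm - xt) > 0" using int by simp
      fix k :: "complex^'n" assume "norm k < r' - norm (xm - xt)"
      then have "xm + k \<in> cball xt r'" using norm_triangle_ineq[of "xm - xt" k] by (simp add: dist_norm norm_minus_commute[of xt] algebra_simps)
      from \<Psi>max[OF this ym] show "W (xm + k) \<le> W xm + l2 k + B2 k k / 2"
        by (simp add: \<Psi>_def l2_def B2_def inner_simps inner_commute field_simps)
    qed (simp add: nonneg_weights_def)
    then show ?thesis by (simp add: qsum_def B2_def)
  qed
  \<comment> \<open>K is an intersection of half-spaces, whose normals are nonnegative because K is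
    upward closed. Each half-space is a linear inequality for touching quadratics of w near xm,
    hence holds for the Hessian B of W at xm.\<close>
  have V: "frozen xh a \<delta> \<sigma> B E \<in> K" if E: "E \<in> frames (G xh)" for E
  proof (rule ccontr)
    assume "frozen xh a \<delta> \<sigma> B E \<notin> K"
    then obtain q b where q: "q \<bullet> frozen xh a \<delta> \<sigma> B E < b" "\<And>x. x \<in> K \<Longrightarrow> b < q \<bullet> x"
      using separating_hyperplane_closed_point[OF K(2,1)] by blast
    obtain k0 where k0: "k0 \<in> K" using K(3) by blast
    have q_nn: "q $ i \<ge> 0" for i
    proof (rule ccontr)
      assume "\<not> q $ i \<ge> 0"
      then have neg: "q $ i < 0" by simp
      \<comment> \<open>Moving k0 by this amount along the axis i would reach the separating
        hyperplane without leaving K.\<close>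
      define s where "s = (b - q \<bullet> k0) / q $ i"
      have "s \<ge> 0" using q(2)[OF k0] neg by (simp add: s_def divide_nonpos_neg)
      have "k0 + s *\<^sub>R axis i 1 \<in> K" by (rule K_upward[OF k0]) (use \<open>s \<ge> 0\<close> in \<open>simp add: axis_def\<close>)
      then have "b < q \<bullet> (k0 + s *\<^sub>R axis i 1)" by (rule q(2))
      also have "\<dots> = b" using neg by (simp add: inner_add_right inner_axis s_def)
      finally show False by simp
    qed
    have "q \<noteq> 0" using q(1) q(2)[OF k0] by auto
    then obtain xs c where xs: "nonneg_weights xs" "qsum xs (\<bullet>) > 0" "\<And>B. q \<bullet> frozen xh a \<delta> \<sigma> B E = qsum xs B + c"
      using frozen_functional[OF q_nn _ \<delta>(1) E] by metis
    have "qsum xs B \<ge> b - c"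
    proof (rule reg[OF xs(1,2)], intro ballI allI impI)
      fix x l' B' assume "x \<in> ball xm r'" and tw: "touch_above w x l' B'"
      then have "frozen xh a \<delta> \<sigma> B' E \<in> K" using frozen[OF ball2 tw E] by blast
      then have "b < q \<bullet> frozen xh a \<delta> \<sigma> B' E" by (rule q(2))
      then show "b - c \<le> qsum xs B'" using xs(3)[of B'] by linarith
    qed
    then show False using q(1) xs(3)[of B] by linarith
  qed
  obtain M where M: "\<And>F. F \<in> frames (G ym) \<Longrightarrow> F ** M \<in> frames (G xh)" "\<And>v. norm (v v* M - v) \<le> C * norm (xh - ym) * norm v"
    using transport[OF in_R(1)[OF ymR] xyR(1)] by metis
  \<comment> \<open>The displacement of x is tied to that of y by x = xm + T k, y = ym + k. The
    penalty then contributes to second order only through T k - k, and T carries the frame vectors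
    at ym to those at xh.\<close>
  define T where "T = (\<lambda>k::complex^'n. k v* M)"
  have T: "linear T" by (simp add: T_def linear_iff vector_matrix_mult_def vec_eq_iff algebra_simps sum.distrib scaleR_sum_right)
  \<comment> \<open>The coefficient -4\<tau> collects the \<tau>-penalty in x and an equal allowance
    for the Taylor remainder of W; -2\<tau> comes from the penalty in y.\<close>
  define BQ where "BQ = (\<lambda>h k. (1 * B (T h) (T k) + (- 4 * a) * ((T h - h) \<bullet> (T k - k))) + ((- 4 * \<tau>) * (T h \<bullet> T k) + (- 2 * \<tau>) * (h \<bullet> k)))"
  define lQ where "lQ = (\<lambda>k. l (T k) - 4 * a * ((xm - ym) \<bullet> (T k - k)) - 2 * \<tau> * ((xm - xt) \<bullet> T k) - 2 * \<tau> * ((ym - yh) \<bullet> k))"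
  have BQ: "bilinear BQ"
    using B T unfolding BQ_def bilinear_def linear_iff by (auto simp: algebra_simps inner_simps)
  have lQ: "linear lQ" using l T unfolding lQ_def linear_iff by (auto simp: algebra_simps inner_simps)
  have touch: "touch_below v ym lQ BQ"
  proof -
    obtain d where d: "d > 0" "\<And>h. norm h < d \<Longrightarrow> \<bar>W (xm + h) - W xm - l h - B h h / 2\<bar> \<le> \<tau> * norm h ^ 2"
      using taylor \<tau>(1) unfolding taylor2_def by metis
    obtain b where b: "b > 0" "\<And>k. norm (T k) \<le> b * norm k" using linear_bounded_pos[OF T] by blast
    define D where "D = min (min d (r' - norm (xm - xt)) / b) (r' - norm (ym - yh))"
    show ?thesis unfolding touch_below_def
    proof (intro conjI lQ BQ exI[of _ D] allI impI)
      show "D > 0" using d b int by (simp add: D_def)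
      fix k :: "complex^'n" assume k: "norm k < D"
      have "norm k * b < min d (r' - norm (xm - xt))" using k b(1) by (simp add: D_def pos_less_divide_eq)
      then have Tk: "norm (T k) < d" "norm (T k) < r' - norm (xm - xt)" using b(2)[of k] by (auto simp: mult.commute)
      have "xm + T k \<in> cball xt r'"
        using Tk(2) norm_triangle_ineq[of "xm - xt" "T k"] by (simp add: dist_norm norm_minus_commute[of xt] algebra_simps)
      moreover have "ym + k \<in> cball yh r'"
        using k norm_triangle_ineq[of "ym - yh" k] by (simp add: D_def dist_norm norm_minus_commute[of yh] algebra_simps)
      ultimately have "\<Psi> (xm + T k) (ym + k) \<le> \<Psi> xm ym" by (rule \<Psi>max)
      moreover have "W xm + l (T k) + B (T k) (T k) / 2 - \<tau> * (T k \<bullet> T k) \<le> W (xm + T k)"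
        using d(2)[OF Tk(1)] by (simp add: power2_norm_eq_inner abs_le_iff)
      ultimately have ineq: "W xm + l (T k) + B (T k) (T k) / 2 - \<tau> * (T k \<bullet> T k) - v (ym + k) - 2 * a * ((xm + T k - (ym + k)) \<bullet> (xm + T k - (ym + k)))
          - \<tau> * ((xm + T k - xt) \<bullet> (xm + T k - xt)) - \<tau> * ((ym + k - yh) \<bullet> (ym + k - yh))
        \<le> W xm - v ym - 2 * a * ((xm - ym) \<bullet> (xm - ym)) - \<tau> * ((xm - xt) \<bullet> (xm - xt)) - \<tau> * ((ym - yh) \<bullet> (ym - yh))"
        unfolding \<Psi>_def by linarith
      have "(p + q) \<bullet> (p + q) = p \<bullet> p + 2 * (p \<bullet> q) + q \<bullet> q" for p q :: "complex^'n"
        by (simp add: inner_simps inner_commute)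
      from this[of "xm - ym" "T k - k"] this[of "xm - xt" "T k"] this[of "ym - yh" k]
      have eqs: "(xm + T k - (ym + k)) \<bullet> (xm + T k - (ym + k)) = (xm - ym) \<bullet> (xm - ym) + 2 * ((xm - ym) \<bullet> (T k - k)) + (T k - k) \<bullet> (T k - k)"
        "(xm + T k - xt) \<bullet> (xm + T k - xt) = (xm - xt) \<bullet> (xm - xt) + 2 * ((xm - xt) \<bullet> T k) + T k \<bullet> T k"
        "(ym + k - yh) \<bullet> (ym + k - yh) = (ym - yh) \<bullet> (ym - yh) + 2 * ((ym - yh) \<bullet> k) + k \<bullet> k"
        by (simp_all add: algebra_simps)
      from ineq show "v ym + lQ k + BQ k k / 2 \<le> v (ym + k)"
        unfolding eqs lQ_def BQ_def by (simp add: field_simps)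
    qed
  qed
  obtain E' where E': "E' \<in> frames (G ym)" "(\<chi> i. Re (hf (X ym) (E' $ i) (E' $ i)) + levi BQ (E' $ i)) \<notin> K"
    using super[OF in_R(2)[OF ymR] touch] by blast
  define E where "E = E' ** M"
  have E: "E \<in> frames (G xh)" unfolding E_def by (rule M(1)[OF E'(1)])
  have xh1: "norm (xh - z0) < r1" using xh r1 by linarith
  have z01: "norm (z0 - z0) < r1" using r1 by simp
  obtain M0 where M0: "\<And>F. F \<in> frames (G xh) \<Longrightarrow> F ** M0 \<in> frames (G z0)" "\<And>v. norm (v v* M0 - v) \<le> C * norm (z0 - xh) * norm v"
    using transport[OF xyR(1) z0R] by metis
  define vec where "vec = (\<chi> i. Re (hf (X z0) ((E ** M0) $ i) ((E ** M0) $ i)) - s0)"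
  \<comment> \<open>Adding t times the slack at z0 restores (1 - t) X to X, up to the change of base
    point, and still leaves room to subtract t s0 = 8\<sigma>.\<close>
  have "frozen xh a \<delta> \<sigma> B E + t *\<^sub>R vec \<in> K"
    unfolding vec_def by (intro K_add V E \<Gamma>_scale margin M0(1) t)
  then have "(\<chi> i. Re (hf (X ym) (E' $ i) (E' $ i)) + levi BQ (E' $ i)) \<in> K"
  proof (rule K_upward)
    fix i
    define e e' where "e = E $ i" and "e' = E' $ i"
    have eT: "e = T e'" by (simp add: e_def e'_def E_def T_def row_matrix_mult)
    have ne: "norm e \<le> Cf" and ne': "norm e' \<le> Cf"
      using frame_le[OF xyR(1) E] frame_le[OF in_R(1)[OF ymR] E'(1)] by (auto simp: e_def e'_def)
    have sq: "(norm e)\<^sup>2 \<le> Cf\<^sup>2" "(norm e')\<^sup>2 \<le> Cf\<^sup>2" using ne ne' by (auto intro: power_mono)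
    have X1: "Re (hf (X xh) e e) - \<sigma> \<le> Re (hf (X ym) e' e')"
      using d1(2)[OF in_R(1)[OF ymR] xyR(1) close[OF ymR xh1] M(2) E'(1) M(1)[OF E'(1)], of i]
      unfolding e_def e'_def E_def by linarith
    have X0: "Re (hf (X z0) ((E ** M0) $ i) ((E ** M0) $ i)) \<le> Re (hf (X xh) e e) + \<sigma>"
      using d1(2)[OF xyR(1) z0R close[OF xh1 z01] M0(2) E M0(1)[OF E], of i] unfolding e_def by linarith
    \<comment> \<open>Complex linearity of T sends i e' to i e, so the Levi form of B(T ., T .) at
      e' is that of B at e.\<close>
    have lQ': "levi BQ e' = levi B e - 2 * a * (norm (e - e'))\<^sup>2 - 2 * \<tau> * (norm e)\<^sup>2 - \<tau> * (norm e')\<^sup>2"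
    proof -
      have Ti: "T (\<i> *s e') = \<i> *s e" by (simp add: T_def row_matrix_mult_scale eT)
      have n: "(\<i> *s x) \<bullet> (\<i> *s x) = x \<bullet> x" for x :: "complex^'n"
        by (simp add: power2_norm_eq_inner[symmetric] norm_vector_smult)
      have d: "\<i> *s e - \<i> *s e' = \<i> *s (e - e')" by (simp add: vec_eq_iff algebra_simps)
      show ?thesis
        unfolding levi_def BQ_def Ti eT[symmetric] d n power2_norm_eq_inner by (simp add: field_simps)
    qed
    \<comment> \<open>The displacement is at most C Cf |xh - ym|. Splitting |xh - ym|^2 <= 2|xh -
      yh|^2 + 2r'^2, the bounds \<open>gap\<close> and \<open>r'1\<close> pay half a unit \<sigma>
      each.\<close>
    have gap2: "2 * a * (norm (e - e'))\<^sup>2 \<le> \<sigma>"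
    proof -
      have "norm (e - e') \<le> C * norm (xh - ym) * norm e'" using M(2)[of e'] by (simp add: eT T_def)
      also have "\<dots> \<le> C * norm (xh - ym) * Cf" using ne' C_nonneg by (intro mult_left_mono) auto
      finally have "(norm (e - e'))\<^sup>2 \<le> (C * norm (xh - ym) * Cf)\<^sup>2" by (intro power_mono) auto
      also have "\<dots> = C\<^sup>2 * Cf\<^sup>2 * (norm (xh - ym))\<^sup>2" by (simp add: power_mult_distrib)
      also have "\<dots> \<le> C\<^sup>2 * Cf\<^sup>2 * (2 * (norm (xh - yh))\<^sup>2 + 2 * r'\<^sup>2)"
      proof (intro mult_left_mono)
        have "norm (xh - ym) \<le> norm (xh - yh) + r'"
          using norm_triangle_ineq4[of "xh - yh" "ym - yh"] int(2) by simp
        then have "(norm (xh - ym))\<^sup>2 \<le> (norm (xh - yh) + r')\<^sup>2" by (intro power_mono) auto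
        also have "\<dots> \<le> 2 * (norm (xh - yh))\<^sup>2 + 2 * r'\<^sup>2"
          using sum_squares_bound[of "norm (xh - yh)" r'] by (simp add: power2_sum)
        finally show "(norm (xh - ym))\<^sup>2 \<le> 2 * (norm (xh - yh))\<^sup>2 + 2 * r'\<^sup>2" .
      qed auto
      finally have "2 * a * (norm (e - e'))\<^sup>2 \<le> 2 * a * (C\<^sup>2 * Cf\<^sup>2 * (2 * (norm (xh - yh))\<^sup>2 + 2 * r'\<^sup>2))"
        using a by (intro mult_left_mono) auto
      also have "\<dots> = (8 * C\<^sup>2 * Cf\<^sup>2 * (a * (norm (xh - yh))\<^sup>2) + 8 * a * C\<^sup>2 * Cf\<^sup>2 * r'\<^sup>2) / 2"
        by (simp add: algebra_simps)
      also have "\<dots> \<le> \<sigma>" using gap r'1 by simp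
      finally show ?thesis .
    qed
    have \<tau>b: "2 * \<tau> * (norm e)\<^sup>2 + \<tau> * (norm e')\<^sup>2 \<le> \<sigma>"
    proof -
      have "2 * \<tau> * (norm e)\<^sup>2 + \<tau> * (norm e')\<^sup>2 \<le> 2 * \<tau> * Cf\<^sup>2 + \<tau> * Cf\<^sup>2"
        using sq \<tau>(1) by (intro add_mono mult_left_mono) auto
      then show ?thesis using \<tau>(3) by linarith
    qed
    have beta_up: "beta a B h h \<le> 5 * a * (norm h)\<^sup>2" for h
    proof -
      have "levi B h \<le> levi (\<lambda>h k. (4 * a + 2 * \<tau>) * (h \<bullet> k) + 0 * (h \<bullet> k)) h" by (rule levi_mono) (use B_up in simp)
      also have "\<dots> = (2 * a + \<tau>) * (norm h)\<^sup>2" unfolding levi_combine levi_inner by (simp add: field_simps)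
      finally have "beta a B h h \<le> (4 * a + \<tau>) * (norm h)\<^sup>2" by (simp add: beta_diag algebra_simps)
      also have "\<dots> \<le> 5 * a * (norm h)\<^sup>2" using \<tau>(2) by (intro mult_right_mono) auto
      finally show ?thesis .
    qed
    have fb: "\<delta> * beta a B e e + \<delta> * trb a B \<le> \<sigma>"
    proof -
      have "beta a B e e \<le> 5 * a * Cf\<^sup>2"
        using order_trans[OF beta_up[of e] mult_left_mono[OF sq(1), of "5 * a"]] a by simp
      moreover have "trb a B \<le> 5 * a * N"
      proof -
        have "trb a B \<le> (\<Sum>b\<in>(Basis::(complex^'n) set). 5 * a * (norm b)\<^sup>2)" unfolding trb_def by (intro sum_mono beta_up)
        also have "\<dots> = (\<Sum>b\<in>(Basis::(complex^'n) set). 5 * a)" by (intro sum.cong) auto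
        finally show ?thesis by (simp add: N_def mult.commute)
      qed
      ultimately have "\<delta> * (beta a B e e + trb a B) \<le> \<delta> * (5 * a * Cf\<^sup>2 + 5 * a * N)" using \<delta>(1) by (intro mult_left_mono) auto
      then show ?thesis using \<delta>(2) by (simp add: distrib_left)
    qed
    have tX: "t * (Re (hf (X z0) ((E ** M0) $ i) ((E ** M0) $ i)) - s0) \<le> t * Re (hf (X xh) e e) - 7 * \<sigma>"
    proof -
      have "t * (Re (hf (X z0) ((E ** M0) $ i) ((E ** M0) $ i)) - s0) \<le> t * (Re (hf (X xh) e e) + \<sigma> - s0)"
        using X0 t by (intro mult_left_mono) auto
      also have "\<dots> = t * Re (hf (X xh) e e) + t * \<sigma> - 8 * \<sigma>" by (simp add: \<sigma>_def algebra_simps)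
      also have "t * \<sigma> \<le> \<sigma>" using t \<sigma> by (simp add: mult_left_le_one_le)
      finally show ?thesis by simp
    qed
    have "(1 + \<delta>) * beta a B e e = beta a B e e + \<delta> * beta a B e e" by (simp add: algebra_simps)
    moreover have "(1 - t) * Re (hf (X xh) e e) = Re (hf (X xh) e e) - t * Re (hf (X xh) e e)" by (simp add: algebra_simps)
    ultimately have "(1 + \<delta>) * beta a B e e + \<delta> * trb a B - 2 * a * (norm e)\<^sup>2 + (1 - t) * Re (hf (X xh) e e) + 3 * \<sigma>
      + t * (Re (hf (X z0) ((E ** M0) $ i) ((E ** M0) $ i)) - s0) \<le> Re (hf (X ym) e' e') + levi BQ e'"
      using fb tX X1 gap2 \<tau>b beta_diag[of a B e] unfolding lQ' by linarith
    then show "(frozen xh a \<delta> \<sigma> B E + t *\<^sub>R vec) $ i \<le> (\<chi> i. Re (hf (X ym) (E' $ i) (E' $ i)) + levi BQ (E' $ i)) $ i"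
      by (simp add: frozen_def vec_def e_def e'_def)
  qed
  then show False using E'(2) by contradiction
qed

end

section \<open>Bounds for forms in a chart\<close>

text \<open>Only directional derivatives are at hand, so x is joined to y by changing one coordinate
  at a time. Such a path may leave the ball but not the circumscribed box, on which the derivatives
  are bounded by compactness.\<close>

lemma C1_lipschitz_on_box:
  fixes h :: "'a::euclidean_space \<Rightarrow> real"
  assumes h: "Ck_on 1 S h" and box: "\<And>z. (\<And>b. b \<in> Basis \<Longrightarrow> \<bar>(z - z0) \<bullet> b\<bar> \<le> R) \<Longrightarrow> z \<in> S"
  obtains L where "L \<ge> 0" "\<And>x y. x \<in> cball z0 R \<Longrightarrow> y \<in> cball z0 R \<Longrightarrow> \<bar>h y - h x\<bar> \<le> L * norm (y - x)"
proof -
  define Q where "Q = cbox (z0 - R *\<^sub>R One) (z0 + R *\<^sub>R One)"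
  have Q: "z \<in> Q \<longleftrightarrow> (\<forall>b\<in>Basis. \<bar>(z - z0) \<bullet> b\<bar> \<le> R)" for z
    unfolding Q_def mem_box by (intro ball_cong refl) (auto simp: inner_simps abs_le_iff)
  have QS: "Q \<subseteq> S" using Q box by blast
  have c: "continuous_on Q (dd h [b])" for b
    using h QS continuous_on_subset unfolding Ck_on_def by (metis One_nat_def length_Cons list.size(3) order_refl)
  have "\<exists>L. \<forall>z\<in>Q. \<bar>dd h [b] z\<bar> \<le> L" for b
  proof -
    have "compact (dd h [b] ` Q)" by (rule compact_continuous_image[OF c]) (simp add: Q_def)
    then show ?thesis using compact_imp_bounded[of "dd h [b] ` Q"] unfolding bounded_iff by auto
  qed
  then obtain Lb where Lb: "\<And>b z. z \<in> Q \<Longrightarrow> \<bar>dd h [b] z\<bar> \<le> Lb b" by metis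
  define L where "L = (\<Sum>b\<in>Basis. \<bar>Lb b\<bar>)"
  have L0: "L \<ge> 0" by (simp add: L_def sum_nonneg)
  have dL: "\<bar>dd h [b] z\<bar> \<le> L" if "b \<in> Basis" "z \<in> Q" for b z
  proof -
    have "\<bar>dd h [b] z\<bar> \<le> \<bar>Lb b\<bar>" using Lb[OF that(2), of b] by linarith
    also have "\<dots> \<le> L" unfolding L_def by (rule member_le_sum) (use that in auto)
    finally show ?thesis .
  qed
  have der: "((\<lambda>t. h (z + t *\<^sub>R b)) has_real_derivative dd h [b] (z + s *\<^sub>R b)) (at s)" if "z + s *\<^sub>R b \<in> S" for z b s
  proof -
    have "(\<lambda>t. dd h [] (z + s *\<^sub>R b + t *\<^sub>R b)) differentiable (at 0)"
      using h that unfolding Ck_on_def by (metis less_one list.size(3))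
    then have "((\<lambda>t. h (z + s *\<^sub>R b + t *\<^sub>R b)) has_real_derivative dd h [b] (z + s *\<^sub>R b)) (at 0)"
      by (simp add: DERIV_deriv_iff_real_differentiable[symmetric])
    then have "((\<lambda>t. h (z + s *\<^sub>R b + (t - s) *\<^sub>R b)) has_real_derivative dd h [b] (z + s *\<^sub>R b)) (at s)"
      using DERIV_shift[of "\<lambda>t. h (z + s *\<^sub>R b + (t - s) *\<^sub>R b)" "dd h [b] (z + s *\<^sub>R b)" 0 s] by simp
    then show ?thesis by (simp add: algebra_simps)
  qed
  show ?thesis
  proof (rule that[of "L * DIM('a)"])
    show "L * DIM('a) \<ge> 0" using L0 by simp
    fix x y assume x: "x \<in> cball z0 R" and y: "y \<in> cball z0 R"
    have coord: "\<bar>(z - z0) \<bullet> b\<bar> \<le> R" if "z \<in> cball z0 R" "b \<in> Basis" for z b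
      using Basis_le_norm[OF that(2), of "z - z0"] that(1) by (simp add: dist_norm norm_minus_commute)
    have step: "\<bar>h (x + (\<Sum>b\<in>D. ((y - x) \<bullet> b) *\<^sub>R b)) - h x\<bar> \<le> L * (\<Sum>b\<in>D. \<bar>(y - x) \<bullet> b\<bar>)"
      if "D \<subseteq> Basis" for D
      using finite_subset[OF that finite_Basis] that
    proof (induction D rule: finite_induct)
      case (insert b D)
      define p where "p = x + (\<Sum>b\<in>D. ((y - x) \<bullet> b) *\<^sub>R b)"
      define s where "s = (y - x) \<bullet> b"
      have bB: "b \<in> Basis" "b \<notin> D" using insert by auto
      have pcoord: "(p - z0) \<bullet> c = (if c \<in> D then (y - z0) \<bullet> c else (x - z0) \<bullet> c)" if "c \<in> Basis" for c
      proof -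
        have "(\<Sum>b\<in>D. ((y - x) \<bullet> b) *\<^sub>R b) \<bullet> c = (\<Sum>b\<in>D. if b = c then (y - x) \<bullet> c else 0)"
          unfolding inner_sum_left using insert(4) that
          by (intro sum.cong refl) (auto simp: inner_Basis subset_iff)
        then show ?thesis using insert(1) by (simp add: p_def inner_simps)
      qed
      have inQ: "p + t *\<^sub>R b \<in> Q" if "t \<in> closed_segment 0 s" for t
        unfolding Q
      proof (intro ballI)
        fix c :: 'a assume cB: "c \<in> Basis"
        show "\<bar>(p + t *\<^sub>R b - z0) \<bullet> c\<bar> \<le> R"
        proof (cases "c = b")
          case False
          then have "(p + t *\<^sub>R b - z0) \<bullet> c = (p - z0) \<bullet> c" using bB cB by (simp add: inner_simps inner_Basis)
          then show ?thesis using pcoord[OF cB] coord[OF x cB] coord[OF y cB] by simp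
        next
          case True
          have "(p + t *\<^sub>R b - z0) \<bullet> b = (x - z0) \<bullet> b + t"
            using pcoord[OF bB(1)] bB by (simp add: inner_simps inner_Basis algebra_simps)
          moreover have "(x - z0) \<bullet> b + s = (y - z0) \<bullet> b" by (simp add: s_def inner_simps)
          moreover have "(0 \<le> t \<and> t \<le> s) \<or> (s \<le> t \<and> t \<le> 0)"
            using that by (auto simp: closed_segment_eq_real_ivl split: if_splits)
          ultimately show ?thesis using coord[OF x bB(1)] coord[OF y bB(1)] True by (auto simp: abs_le_iff)
        qed
      qed
      have "norm (h (p + s *\<^sub>R b) - h (p + 0 *\<^sub>R b)) \<le> L * norm (s - 0)"
      proof (rule field_differentiable_bound[of "closed_segment 0 s" "\<lambda>t. h (p + t *\<^sub>R b)" "\<lambda>t. dd h [b] (p + t *\<^sub>R b)"])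
        fix t assume t: "t \<in> closed_segment 0 s"
        show "((\<lambda>t. h (p + t *\<^sub>R b)) has_real_derivative dd h [b] (p + t *\<^sub>R b)) (at t within closed_segment 0 s)"
          by (rule has_field_derivative_at_within[OF der]) (use inQ[OF t] QS in blast)
        show "norm (dd h [b] (p + t *\<^sub>R b)) \<le> L" using dL[OF bB(1) inQ[OF t]] by simp
      qed auto
      then have "\<bar>h (p + s *\<^sub>R b) - h p\<bar> \<le> L * \<bar>s\<bar>" by simp
      moreover have "\<bar>h p - h x\<bar> \<le> L * (\<Sum>b\<in>D. \<bar>(y - x) \<bullet> b\<bar>)" unfolding p_def by (rule insert(3)) (use insert(4) in auto)
      ultimately have le: "\<bar>h (p + s *\<^sub>R b) - h x\<bar> \<le> L * \<bar>s\<bar> + L * (\<Sum>b\<in>D. \<bar>(y - x) \<bullet> b\<bar>)" by linarith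
      have e1: "x + (\<Sum>b\<in>insert b D. ((y - x) \<bullet> b) *\<^sub>R b) = p + s *\<^sub>R b"
        using insert by (simp add: p_def s_def algebra_simps)
      have e2: "L * (\<Sum>b\<in>insert b D. \<bar>(y - x) \<bullet> b\<bar>) = L * \<bar>s\<bar> + L * (\<Sum>b\<in>D. \<bar>(y - x) \<bullet> b\<bar>)"
        using insert by (simp add: s_def distrib_left)
      show ?case unfolding e1 e2 by (rule le)
    qed simp
    have "x + (\<Sum>b\<in>Basis. ((y - x) \<bullet> b) *\<^sub>R b) = y" by (simp add: euclidean_representation)
    with step[OF order_refl] have "\<bar>h y - h x\<bar> \<le> L * (\<Sum>b\<in>Basis. \<bar>(y - x) \<bullet> b\<bar>)" by simp
    also have "(\<Sum>b\<in>Basis. \<bar>(y - x) \<bullet> b\<bar>) \<le> (\<Sum>b\<in>(Basis::'a set). norm (y - x))" by (intro sum_mono Basis_le_norm)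
    finally show "\<bar>h y - h x\<bar> \<le> L * DIM('a) * norm (y - x)" using L0 by (simp add: mult_left_mono mult.assoc)
  qed
qed

lemma norm_hf_le_norm:
  fixes M :: "complex^'n^'n"
  shows "norm (hf M v w) \<le> (CARD('n) * CARD('n) * norm M) * norm v * norm w"
proof -
  have "norm (M $ j $ k) \<le> norm M" for j k
    by (rule order_trans[OF Finite_Cartesian_Product.norm_nth_le Finite_Cartesian_Product.norm_nth_le])
  then have "(\<Sum>j\<in>UNIV. \<Sum>k\<in>UNIV. norm (M $ j $ k)) \<le> (\<Sum>j\<in>(UNIV::'n set). \<Sum>k\<in>(UNIV::'n set). norm M)"
    by (intro sum_mono)
  then have "(\<Sum>j\<in>UNIV. \<Sum>k\<in>UNIV. norm (M $ j $ k)) \<le> CARD('n) * CARD('n) * norm M" by (simp add: mult.assoc)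
  then have "(\<Sum>j\<in>UNIV. \<Sum>k\<in>UNIV. norm (M $ j $ k)) * norm v * norm w \<le> (CARD('n) * CARD('n) * norm M) * norm v * norm w"
    by (intro mult_right_mono) auto
  then show ?thesis using norm_hf_le[of M v w] by linarith
qed

section \<open>Superlevel sets of f\<close>

context
  fixes \<Gamma> :: "(real^'n) set" and f :: "real^'n \<Rightarrow> real"
  assumes cone: "admissible_cone \<Gamma>" and sf: "standing_f \<Gamma> f"
begin

lemma \<Gamma>_closed: "closed \<Gamma>" and \<Gamma>_convex: "convex \<Gamma>"
  using cone by (auto simp: admissible_cone_def)

lemma \<Gamma>_scaleR: "c > 0 \<Longrightarrow> x \<in> \<Gamma> \<Longrightarrow> c *\<^sub>R x \<in> \<Gamma>"
  using cone by (auto simp: admissible_cone_def Convex.cone_def)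

lemma \<Gamma>_add: "x \<in> \<Gamma> \<Longrightarrow> y \<in> \<Gamma> \<Longrightarrow> x + y \<in> \<Gamma>"
  using \<Gamma>_scaleR[of 2 "(1/2) *\<^sub>R x + (1/2) *\<^sub>R y"] convexD[OF \<Gamma>_convex, of x y "1/2" "1/2"] by (simp add: scaleR_right_distrib)

lemma \<Gamma>_pos: "(\<And>i. x $ i > 0) \<Longrightarrow> x \<in> \<Gamma>"
  using cone by (auto simp: admissible_cone_def)

lemma \<Gamma>_nonneg:
  assumes "\<And>i. x $ i \<ge> 0" shows "x \<in> \<Gamma>"
proof (rule Lim_in_closed_set[OF \<Gamma>_closed, of "\<lambda>s. x + s *\<^sub>R (\<chi> i. 1)" "at_right (0::real)"])
  show "\<forall>\<^sub>F s in at_right (0::real). x + s *\<^sub>R (\<chi> i. 1) \<in> \<Gamma>"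
    using eventually_at_right_less
    by (rule eventually_mono) (rule \<Gamma>_pos, use assms in \<open>simp add: add_nonneg_pos\<close>)
  have "((\<lambda>s. x + s *\<^sub>R (\<chi> i. 1)) \<longlongrightarrow> x + 0 *\<^sub>R (\<chi> i. 1)) (at_right (0::real))" by (intro tendsto_intros)
  then show "((\<lambda>s. x + s *\<^sub>R (\<chi> i. 1)) \<longlongrightarrow> x) (at_right (0::real))" by simp
qed simp

lemma f_scaleR: "c > 0 \<Longrightarrow> x \<in> \<Gamma> \<Longrightarrow> f (c *\<^sub>R x) = c * f x"
  using sf by (auto simp: standing_f_def)

lemma f_nonneg: "x \<in> \<Gamma> \<Longrightarrow> f x \<ge> 0"
proof -
  assume x: "x \<in> \<Gamma>"
  have i: "\<forall>lam\<in>interior \<Gamma>. f lam > 0" and b: "\<forall>lam\<in>frontier \<Gamma>. f lam = 0" using sf by (auto simp: standing_f_def)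
  have "x \<in> interior \<Gamma> \<or> x \<in> frontier \<Gamma>" using x closure_subset[of \<Gamma>] by (auto simp: frontier_def)
  then show "f x \<ge> 0" using i b by (metis less_eq_real_def)
qed

text \<open>Concavity at the midpoint combined with homogeneity of degree 1. Together with
  \<open>f_nonneg\<close> it makes f nondecreasing in every direction of \<Gamma>, the content of
  \<open>level_add\<close>.\<close>

lemma f_superadditive:
  assumes "x \<in> \<Gamma>" "y \<in> \<Gamma>" shows "f x + f y \<le> f (x + y)"
proof -
  have c: "concave_on \<Gamma> f" using sf by (simp add: standing_f_def)
  have "f x / 2 + f y / 2 \<le> f ((1/2) *\<^sub>R x + (1/2) *\<^sub>R y)"
    using concave_onD[OF c, of "1/2" x y] assms by simp
  moreover have "(1/2) *\<^sub>R x + (1/2) *\<^sub>R y \<in> \<Gamma>" using convexD[OF \<Gamma>_convex, of x y "1/2" "1/2"] assms by simp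
  moreover have "2 *\<^sub>R ((1/2) *\<^sub>R x + (1/2) *\<^sub>R y) = x + y" by (simp add: scaleR_right_distrib)
  ultimately show ?thesis using f_scaleR[of 2 "(1/2) *\<^sub>R x + (1/2) *\<^sub>R y"] by simp
qed

definition "level c = {x \<in> \<Gamma>. f x \<ge> c}"

lemma level_closed: "closed (level c)"
proof -
  have "continuous_on \<Gamma> f" using sf by (simp add: standing_f_def)
  then have "closed (\<Gamma> \<inter> f -` {c..})" by (rule continuous_closed_preimage[OF _ \<Gamma>_closed closed_atLeast])
  moreover have "level c = \<Gamma> \<inter> f -` {c..}" by (auto simp: level_def)
  ultimately show ?thesis by simp
qed

lemma level_convex: "convex (level c)"
proof (rule convexI)
  fix x y and a b :: real assume xy: "x \<in> level c" "y \<in> level c" and ab: "0 \<le> a" "0 \<le> b" "a + b = 1"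
  have cf: "concave_on \<Gamma> f" using sf by (simp add: standing_f_def)
  have a: "a = 1 - b" using ab by simp
  have "a * c + b * c \<le> a * f x + b * f y" using xy ab by (intro add_mono mult_left_mono) (auto simp: level_def)
  also have "\<dots> \<le> f (a *\<^sub>R x + b *\<^sub>R y)" using concave_onD[OF cf, of b x y] xy ab by (simp add: level_def a)
  finally have "c \<le> f (a *\<^sub>R x + b *\<^sub>R y)" using ab by (simp add: distrib_right[symmetric])
  then show "a *\<^sub>R x + b *\<^sub>R y \<in> level c" using xy ab convexD[OF \<Gamma>_convex] by (simp add: level_def)
qed

text \<open>The vector of ones is interior to \<Gamma>, where f > 0, and homogeneity scales its
  value beyond any level.\<close>

lemma level_nonempty: "level c \<noteq> {}"
proof -
  let ?e = "(\<chi> i. 1) :: real^'n"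
  have op: "open {x :: real^'n. \<forall>i. x $ i > 0}"
  proof -
    have "{x :: real^'n. \<forall>i. x $ i > 0} = (\<Inter>i. {x. x $ i > 0})" by auto
    also have "open \<dots>" by (intro open_INT finite ballI open_Collect_less continuous_intros)
    finally show ?thesis .
  qed
  have sub: "{x :: real^'n. \<forall>i. x $ i > 0} \<subseteq> \<Gamma>" using cone by (simp add: admissible_cone_def)
  have "?e \<in> {x :: real^'n. \<forall>i. x $ i > 0}" by simp
  then have "?e \<in> interior \<Gamma>" using interior_maximal[OF sub op] by (rule subsetD[rotated])
  moreover have "\<forall>lam\<in>interior \<Gamma>. f lam > 0" using sf by (simp add: standing_f_def)
  ultimately have fe: "f ?e > 0" by blast
  define s where "s = (\<bar>c\<bar> + 1) / f ?e"
  have s: "s > 0" using fe by (simp add: s_def add_nonneg_pos)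
  have e: "?e \<in> \<Gamma>" by (rule \<Gamma>_pos) simp
  have "f (s *\<^sub>R ?e) = \<bar>c\<bar> + 1" using f_scaleR[OF s e] fe by (simp add: s_def)
  then have "s *\<^sub>R ?e \<in> level c" using \<Gamma>_scaleR[OF s e] by (simp add: level_def)
  then show ?thesis by blast
qed

lemma level_add: "x \<in> level c \<Longrightarrow> y \<in> \<Gamma> \<Longrightarrow> x + y \<in> level c"
  using f_superadditive[of x y] f_nonneg[of y] \<Gamma>_add[of x y] by (simp add: level_def)

lemma level_scaleR: "s > 0 \<Longrightarrow> x \<in> level c \<Longrightarrow> s *\<^sub>R x \<in> level (s * c)"
  by (simp add: level_def \<Gamma>_scaleR f_scaleR)

end

section \<open>Comparison and uniqueness\<close>

lemma csmooth_on_imp: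
  assumes "csmooth_on S h"
  shows "continuous_on S h" and "Ck_on 1 S (\<lambda>z. Re (h z))" and "Ck_on 1 S (\<lambda>z. Im (h z))"
proof -
  show 1: "Ck_on 1 S (\<lambda>z. Re (h z))" and 2: "Ck_on 1 S (\<lambda>z. Im (h z))"
    using assms by (simp_all add: csmooth_on_def smooth_on_def)
  have "continuous_on S (dd (\<lambda>z. Re (h z)) [])" "continuous_on S (dd (\<lambda>z. Im (h z)) [])"
    using 1 2 unfolding Ck_on_def by (metis le0 list.size(3))+
  then have "continuous_on S (\<lambda>z. Re (h z))" "continuous_on S (\<lambda>z. Im (h z))" by simp_all
  then have "continuous_on S (\<lambda>z. of_real (Re (h z)) + \<i> * of_real (Im (h z)))"
    by (intro continuous_on_add continuous_on_mult continuous_on_of_real continuous_on_const)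
  then show "continuous_on S h" unfolding complex_eq[symmetric] .
qed

lemma continuous_matrix:
  fixes M :: "'a::topological_space \<Rightarrow> complex^'n^'n"
  assumes "\<And>j k. continuous_on S (\<lambda>z. M z $ j $ k)" shows "continuous_on S M"
proof -
  have "continuous_on S (\<lambda>z. \<chi> j. \<chi> k. M z $ j $ k)" by (intro continuous_on_vec_lambda assms)
  then show ?thesis by (simp add: vec_lambda_eta)
qed

text \<open>Stated for one subsolution and one supersolution; uniqueness applies it in both
  orders.\<close>

lemma comparison_principle:
  fixes A :: "('m::t2_space, 'n::finite) chart set" and f :: "real^'n \<Rightarrow> real"
  assumes compact: "compact (UNIV :: 'm set)"
    and A: "complex_atlas A" and g: "hermitian_metric A g" and \<chi>: "real_11_form A \<chi>'"
    and cone: "admissible_cone \<Gamma>" and sf: "standing_f \<Gamma> f"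
    and adm: "\<forall>c\<in>A. \<forall>x\<in>fst c. \<forall>lam. eig_tuple (g c x) (\<chi>' c x) lam \<longrightarrow> lam \<in> interior \<Gamma>"
    and H: "continuous_on UNIV (\<lambda>p. H (fst p) (snd p))" and mono: "\<And>x u1 u2. u1 < u2 \<Longrightarrow> H x u1 < H x u2"
    and c1: "continuous_on UNIV \<phi>1" and c2: "continuous_on UNIV \<phi>2"
    and sub: "visc_sub A g \<chi>' \<Gamma> f (\<lambda>x u. exp (H x u)) \<phi>1"
    and super: "visc_super A g \<chi>' \<Gamma> f (\<lambda>x u. exp (H x u)) \<phi>2"
  shows "\<phi>1 y0 \<le> \<phi>2 y0"
proof (rule ccontr)
  assume "\<not> \<phi>1 y0 \<le> \<phi>2 y0"
  define d where "d = \<phi>1 y0 - \<phi>2 y0"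
  have d: "d > 0" using \<open>\<not> \<phi>1 y0 \<le> \<phi>2 y0\<close> by (simp add: d_def)
  have Hc: "continuous_on UNIV (\<lambda>x. H x (\<phi> x))" if "continuous_on UNIV \<phi>" for \<phi>
    using continuous_on_compose2[OF H, of UNIV "\<lambda>x. (x, \<phi> x)"] that by (simp add: continuous_on_Pair continuous_on_id)
  have "compact (\<phi>1 ` UNIV)" by (rule compact_continuous_image[OF c1 compact])
  then obtain b where b: "\<And>x. \<bar>\<phi>1 x\<bar> \<le> b" using compact_imp_bounded[of "\<phi>1 ` UNIV"] unfolding bounded_iff by auto
  have b0: "b \<ge> 0" using b[of y0] by linarith
  define S where "S = {x. d / 2 \<le> \<phi>1 x - \<phi>2 x}"
  have "closed S" unfolding S_def by (intro closed_Collect_le continuous_intros c1 c2)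
  then have Sc: "compact S" using compact compact_Int_closed[of UNIV S] by simp
  have "y0 \<in> S" using d by (simp add: S_def d_def)
  \<comment> \<open>The ratio of the two right-hand sides. By strict monotonicity its maximum q over
    the compact set S is less than 1.\<close>
  define h where "h = (\<lambda>x. exp (H x (\<phi>2 x) - H x (\<phi>1 x)))"
  have "continuous_on S h" unfolding h_def
    by (intro continuous_intros continuous_on_subset[OF Hc[OF c1]] continuous_on_subset[OF Hc[OF c2]]) auto
  then obtain x1 where x1: "x1 \<in> S" "\<And>x. x \<in> S \<Longrightarrow> h x \<le> h x1"
    using continuous_attains_sup[OF Sc] \<open>y0 \<in> S\<close> by blast
  define q where "q = h x1"
  have "\<phi>2 x1 < \<phi>1 x1" using x1(1) d by (simp add: S_def)
  then have q: "0 < q" "q < 1" using mono by (simp_all add: q_def h_def)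
  \<comment> \<open>The first bound gives q < 1 - t, so the scaled right-hand side of the
    subsolution still wins on S. The second gives t|\<phi>1| <= d / 4, which keeps the maximum point
    of (1 - t) \<phi>1 - \<phi>2 in S.\<close>
  define t where "t = min ((1 - q) / 2) (d / (4 * (b + 1)))"
  have t: "0 < t" "t < 1" "t < 1 - q" 
  proof -
    show "0 < t" using q d b0 by (auto simp: t_def)
    have "t \<le> (1 - q) / 2" unfolding t_def by (rule min.cobounded1)
    then have tq: "2 * t \<le> 1 - q" by simp
    show "t < 1" using tq q by linarith
    show "t < 1 - q" using tq q by linarith
  qed
  have tb: "2 * t * b \<le> d / 2"
  proof -
    have t1: "t \<le> d / (4 * (b + 1))" unfolding t_def by (rule min.cobounded2)
    have t2: "0 \<le> d / (4 * (b + 1))" using d b0 by (intro divide_nonneg_nonneg) auto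
    have "t * b \<le> d / (4 * (b + 1)) * (b + 1)" by (rule mult_mono[OF t1 _ t2]) (use b0 in auto)
    also have "\<dots> = d / 4"
    proof -
      have "d / (4 * y) * y = d / 4" if "y \<noteq> 0" for y using that by simp
      moreover have "b + 1 \<noteq> 0" using b0 by linarith
      ultimately show ?thesis by blast
    qed
    finally show ?thesis by simp
  qed
  have "continuous_on UNIV (\<lambda>x. (1 - t) * \<phi>1 x - \<phi>2 x)" by (intro continuous_intros c1 c2)
  then obtain xm where xm: "\<And>x. (1 - t) * \<phi>1 x - \<phi>2 x \<le> (1 - t) * \<phi>1 xm - \<phi>2 xm"
    using continuous_attains_sup[OF compact] by blast
  have "xm \<in> S"
  proof -
    have "t * \<phi>1 y0 \<le> t * b" "t * \<phi>1 xm \<ge> - (t * b)"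
    proof -
      have "\<phi>1 y0 \<le> b" "- b \<le> \<phi>1 xm" using b[of y0] b[of xm] by (simp_all add: abs_le_iff)
      from this[THEN mult_left_mono, of t] have "t * \<phi>1 y0 \<le> t * b" "t * (- b) \<le> t * \<phi>1 xm" using t(1) by simp_all
      then show "t * \<phi>1 y0 \<le> t * b" "t * \<phi>1 xm \<ge> - (t * b)" by simp_all
    qed
    moreover have "(1 - t) * \<phi>1 y0 = \<phi>1 y0 - t * \<phi>1 y0" "(1 - t) * \<phi>1 xm = \<phi>1 xm - t * \<phi>1 xm"
      by (simp_all add: left_diff_distrib)
    moreover have "2 * (t * b) \<le> d / 2" using tb by simp
    ultimately have "d / 2 \<le> \<phi>1 xm - \<phi>2 xm" using xm[of y0] d_def by linarith
    then show ?thesis by (simp add: S_def)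
  qed
  define a1 a2 where "a1 = exp (H xm (\<phi>1 xm))" and "a2 = exp (H xm (\<phi>2 xm))"
  have a12: "a1 > 0" "a2 < (1 - t) * a1"
  proof -
    show "a1 > 0" by (simp add: a1_def)
    have "a2 = h xm * a1" by (simp add: a1_def a2_def h_def exp_add[symmetric])
    also have "\<dots> \<le> q * a1" using x1(2)[OF \<open>xm \<in> S\<close>] by (simp add: q_def a1_def)
    also have "\<dots> < (1 - t) * a1" using t \<open>a1 > 0\<close> by (intro mult_strict_right_mono) auto
    finally show "a2 < (1 - t) * a1" .
  qed
  \<comment> \<open>A level strictly between a2 and (1 - t) a1; strictness lets continuity spread
    both inequalities over the neighbourhood N.\<close>
  define k where "k = (a2 + (1 - t) * a1) / 2"
  define e1 where "e1 = k / (1 - t)"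
  have k: "a2 < k" "k < (1 - t) * a1" "(1 - t) * e1 = k" "e1 < a1"
  proof -
    have k2: "2 * k = a2 + (1 - t) * a1" by (simp add: k_def)
    show "a2 < k" using k2 a12(2) by linarith
    show 2: "k < (1 - t) * a1" using k2 a12(2) by linarith
    show "(1 - t) * e1 = k" using t(2) by (simp add: e1_def)
    show "e1 < a1" using 2 t(2) by (simp add: e1_def pos_divide_less_eq mult.commute)
  qed
  define N where "N = {x. e1 < exp (H x (\<phi>1 x))} \<inter> {x. exp (H x (\<phi>2 x)) < k}"
  have N: "open N" "xm \<in> N"
    using k unfolding N_def by (auto simp: a1_def a2_def intro!: open_Int open_Collect_less continuous_intros Hc c1 c2)
  have "xm \<in> \<Union> (fst ` A)" using A unfolding complex_atlas_def by blast
  then obtain c where c: "c \<in> A" "xm \<in> fst c" by blast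
  obtain U \<phi> where c_eq: "c = (U, \<phi>)" by (cases c)
  define \<psi> where "\<psi> = inv_into U \<phi>"
  have U: "open U" "open (\<phi> ` U)" "homeomorphism U (\<phi> ` U) \<phi> \<psi>"
    using A c unfolding complex_atlas_def c_eq \<psi>_def by auto
  have "openin (top_of_set (\<phi> ` U)) (\<phi> ` (U \<inter> N))"
    by (rule homeomorphism_imp_open_map[OF U(3)]) (use N in auto)
  then have opW: "open (\<phi> ` (U \<inter> N))" using U(2) openin_open_trans by blast
  define z0 where "z0 = \<phi> xm"
  have "z0 \<in> \<phi> ` (U \<inter> N)" using c N by (simp add: z0_def c_eq)
  then obtain e where e: "e > 0" "ball z0 e \<subseteq> \<phi> ` (U \<inter> N)" using opW openE by blast
  define n where "n = real (DIM(complex^'n))"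
  have n: "n > 0" by (simp add: n_def)
  \<comment> \<open>Small enough that, by the l1 bound, the whole box of half-width R lies in the
    chart image; \<open>C1_lipschitz_on_box\<close> asks for the box.\<close>
  define R where "R = e / (2 * (n + 1))"
  have R: "R > 0" unfolding R_def using e(1) n by (intro divide_pos_pos mult_pos_pos) linarith+
  have nR: "n * R < e" "R < e"
  proof -
    have "y * (e / (2 * y)) = e / 2" if "y \<noteq> 0" for y using that by simp
    from this[of "n + 1"] have "n * R + R = e / 2" using n unfolding R_def distrib_right by simp
    moreover have "n * R > 0" using n R by (rule mult_pos_pos)
    ultimately show "n * R < e" "R < e" using e(1) R by linarith+
  qed
  have box: "z \<in> \<phi> ` U" if "\<And>b. b \<in> Basis \<Longrightarrow> \<bar>(z - z0) \<bullet> b\<bar> \<le> R" for z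
  proof -
    have "norm (z - z0) \<le> (\<Sum>b\<in>Basis. \<bar>(z - z0) \<bullet> b\<bar>)" by (rule norm_le_l1)
    also have "\<dots> \<le> (\<Sum>b\<in>(Basis::(complex^'n) set). R)" by (intro sum_mono that)
    also have "\<dots> < e" using nR by (simp add: n_def)
    finally have "z \<in> ball z0 e" by (simp add: dist_norm norm_minus_commute)
    then show ?thesis using e by blast
  qed
  have cb: "z \<in> \<phi> ` (U \<inter> N)" if "z \<in> cball z0 R" for z
    using that nR e by (auto simp: subset_iff)
  have cbU: "cball z0 R \<subseteq> \<phi> ` U" using cb by blast
  have \<psi>: "\<psi> z \<in> U" "\<psi> z \<in> N" "\<phi> (\<psi> z) = z" if "z \<in> cball z0 R" for z
    using cb[OF that] homeomorphism_apply1[OF U(3)] by auto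
  define Gm Xm where "Gm = (\<lambda>z. g c (\<psi> z))" and "Xm = (\<lambda>z. \<chi>' c (\<psi> z))"
  have r11: "real_11_form A g" using g by (simp add: hermitian_metric_def)
  have sm: "csmooth_on (\<phi> ` U) (\<lambda>z. Gm z $ i $ j)" "csmooth_on (\<phi> ` U) (\<lambda>z. Xm z $ i $ j)" for i j
  proof -
    have "loc c (\<lambda>x. g c x $ i $ j) = (\<lambda>z. Gm z $ i $ j)" "loc c (\<lambda>x. \<chi>' c x $ i $ j) = (\<lambda>z. Xm z $ i $ j)"
      by (simp_all add: loc_def Gm_def Xm_def \<psi>_def c_eq fun_eq_iff)
    moreover have "csmooth_on (snd c ` fst c) (loc c (\<lambda>x. g c x $ i $ j))" "csmooth_on (snd c ` fst c) (loc c (\<lambda>x. \<chi>' c x $ i $ j))"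
      using r11 \<chi> c(1) unfolding real_11_form_def by blast+
    ultimately show "csmooth_on (\<phi> ` U) (\<lambda>z. Gm z $ i $ j)" "csmooth_on (\<phi> ` U) (\<lambda>z. Xm z $ i $ j)" by (simp_all add: c_eq)
  qed
  have hermG: "hermitian (Gm z)" and hermX: "hermitian (Xm z)" if "z \<in> cball z0 R" for z
  proof -
    have x: "\<psi> z \<in> fst c" using \<psi>(1)[OF that] by (simp add: c_eq)
    have "hermitian (\<eta> c (\<psi> z))" if "real_11_form A \<eta>" for \<eta>
      using that c(1) x unfolding real_11_form_def hermitian_def by meson
    then show "hermitian (Gm z)" "hermitian (Xm z)" using r11 \<chi> by (simp_all add: Gm_def Xm_def)
  qed
  have posG: "Re (hf (Gm z) w w) > 0" if "z \<in> cball z0 R" "w \<noteq> 0" for z w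
  proof -
    have x: "\<psi> z \<in> fst c" using \<psi>(1)[OF that(1)] by (simp add: c_eq)
    show ?thesis using g c(1) x that(2) unfolding hermitian_metric_def hf_def Gm_def by blast
  qed
  have Gc: "continuous_on (cball z0 R) Gm" and Xc: "continuous_on (cball z0 R) Xm"
    by (intro continuous_matrix continuous_on_subset[OF csmooth_on_imp(1)[OF sm(1)] cbU] continuous_on_subset[OF csmooth_on_imp(1)[OF sm(2)] cbU])+
  have bnd: "\<exists>B. \<forall>z\<in>cball z0 R. norm (M z) \<le> B" if "continuous_on (cball z0 R) M" for M :: "complex^'n \<Rightarrow> complex^'n^'n"
    using compact_imp_bounded[OF compact_continuous_image[OF that compact_cball]] unfolding bounded_iff by auto
  obtain BG where BG: "\<And>z. z \<in> cball z0 R \<Longrightarrow> norm (Gm z) \<le> BG" using bnd[OF Gc] by blast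
  obtain BX where BX: "\<And>z. z \<in> cball z0 R \<Longrightarrow> norm (Xm z) \<le> BX" using bnd[OF Xc] by blast
  let ?n2 = "real (CARD('n) * CARD('n))"
  have n2: "?n2 > 0" by simp
  have z0R: "z0 \<in> cball z0 R" using R by simp
  have BG0: "BG \<ge> 0" and BX0: "BX \<ge> 0" using BG[OF z0R] BX[OF z0R] norm_ge_zero order_trans by blast+
  have hfb: "norm (hf M v w) \<le> ?n2 * B * norm v * norm w" if "norm M \<le> B" for M :: "complex^'n^'n" and v w B
  proof -
    have "norm (hf M v w) \<le> (?n2 * norm M) * norm v * norm w" using norm_hf_le_norm[of M v w] by simp
    also have "\<dots> \<le> (?n2 * B) * norm v * norm w" using that by (intro mult_right_mono mult_left_mono) auto
    finally show ?thesis .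
  qed
  define Kg Kx where "Kg = ?n2 * (BG + 1)" and "Kx = ?n2 * BX"
  have Kg: "Kg > 0" using n2 BG0 by (simp add: Kg_def add_nonneg_pos del: of_nat_mult)
  have Kx: "Kx \<ge> 0" using BX0 by (simp add: Kx_def)
  have Gb: "norm (hf (Gm z) v w) \<le> Kg * norm v * norm w" if "z \<in> cball z0 R" for z v w
    unfolding Kg_def by (rule hfb) (use BG[OF that] in linarith)
  have Xb: "norm (hf (Xm z) v w) \<le> Kx * norm v * norm w" if "z \<in> cball z0 R" for z v w
    unfolding Kx_def by (rule hfb) (use BX[OF that] in linarith)
  have "\<exists>L\<ge>0. \<forall>x\<in>cball z0 R. \<forall>y\<in>cball z0 R. norm (Gm y $ i $ j - Gm x $ i $ j) \<le> L * norm (y - x)" for i j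
  proof -
    obtain L1 where L1: "L1 \<ge> 0" "\<And>x y. x \<in> cball z0 R \<Longrightarrow> y \<in> cball z0 R \<Longrightarrow> \<bar>Re (Gm y $ i $ j) - Re (Gm x $ i $ j)\<bar> \<le> L1 * norm (y - x)"
      by (rule C1_lipschitz_on_box[OF csmooth_on_imp(2)[OF sm(1)] box]) (assumption, rule that)
    obtain L2 where L2: "L2 \<ge> 0" "\<And>x y. x \<in> cball z0 R \<Longrightarrow> y \<in> cball z0 R \<Longrightarrow> \<bar>Im (Gm y $ i $ j) - Im (Gm x $ i $ j)\<bar> \<le> L2 * norm (y - x)"
      by (rule C1_lipschitz_on_box[OF csmooth_on_imp(3)[OF sm(1)] box]) (assumption, rule that)
    show ?thesis
    proof (intro exI[of _ "L1 + L2"] conjI ballI)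
      fix x y assume xy: "x \<in> cball z0 R" "y \<in> cball z0 R"
      have "norm (Gm y $ i $ j - Gm x $ i $ j) \<le> \<bar>Re (Gm y $ i $ j - Gm x $ i $ j)\<bar> + \<bar>Im (Gm y $ i $ j - Gm x $ i $ j)\<bar>" by (rule cmod_le)
      then show "norm (Gm y $ i $ j - Gm x $ i $ j) \<le> (L1 + L2) * norm (y - x)"
        using L1(2)[OF xy] L2(2)[OF xy] unfolding distrib_right minus_complex.sel by linarith
    qed (use L1 L2 in simp)
  qed
  then obtain L where L: "\<And>i j. L i j \<ge> 0"
    "\<And>i j x y. x \<in> cball z0 R \<Longrightarrow> y \<in> cball z0 R \<Longrightarrow> norm (Gm y $ i $ j - Gm x $ i $ j) \<le> L i j * norm (y - x)" by metis
  define Lg where "Lg = (\<Sum>i\<in>UNIV. \<Sum>j\<in>UNIV. L i j)"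
  have Lg: "Lg \<ge> 0" unfolding Lg_def by (intro sum_nonneg L)
  have Gl: "norm (hf (Gm y - Gm x) v w) \<le> Lg * norm (y - x) * norm v * norm w" if xy: "x \<in> cball z0 R" "y \<in> cball z0 R" for x y v w
  proof -
    have "(\<Sum>i\<in>UNIV. \<Sum>j\<in>UNIV. norm ((Gm y - Gm x) $ i $ j)) \<le> (\<Sum>i\<in>UNIV. \<Sum>j\<in>UNIV. L i j * norm (y - x))"
      using L(2)[OF xy] by (intro sum_mono) simp
    also have "\<dots> = Lg * norm (y - x)" by (simp add: Lg_def sum_distrib_right)
    finally show ?thesis using norm_hf_le[of "Gm y - Gm x" v w]
      by (meson mult_right_mono norm_ge_zero order_trans)
  qed
  have Xcont: "\<exists>d>0. \<forall>x\<in>cball z0 R. \<forall>y\<in>cball z0 R. norm (y - x) < d \<longrightarrow> (\<forall>v w. norm (hf (Xm y - Xm x) v w) \<le> \<epsilon> * norm v * norm w)"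
    if \<epsilon>: "\<epsilon> > 0" for \<epsilon>
  proof -
    have "uniformly_continuous_on (cball z0 R) Xm" by (rule compact_uniformly_continuous[OF Xc compact_cball])
    moreover have "\<epsilon> / ?n2 > 0" using \<epsilon> n2 by (rule divide_pos_pos)
    ultimately obtain r where r: "r > 0" "\<And>x y. x \<in> cball z0 R \<Longrightarrow> y \<in> cball z0 R \<Longrightarrow> dist y x < r \<Longrightarrow> dist (Xm y) (Xm x) < \<epsilon> / ?n2"
      unfolding uniformly_continuous_on_def by metis
    show ?thesis
    proof (intro exI[of _ r] conjI ballI impI allI r(1))
      fix x y v w assume "x \<in> cball z0 R" "y \<in> cball z0 R" "norm (y - x) < r"
      then have "norm (Xm y - Xm x) \<le> \<epsilon> / ?n2" using r(2)[of x y] by (simp add: dist_norm)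
      from hfb[OF this, of v w] show "norm (hf (Xm y - Xm x) v w) \<le> \<epsilon> * norm v * norm w" using n2 by simp
    qed
  qed
  \<comment> \<open>Homogeneity reduces coercivity to the positive minimum over base points and unit
    vectors, a compact set.\<close>
  obtain m where m: "\<And>z. z \<in> cball z0 R \<Longrightarrow> coercive m (Gm z)"
  proof -
    let ?T = "cball z0 R \<times> sphere (0::complex^'n) 1"
    have "continuous_on ?T (\<lambda>p. Re (hf (Gm (fst p)) (snd p) (snd p)))"
      by (intro continuous_intros continuous_hf continuous_on_compose2[OF Gc]) auto
    moreover have "compact ?T" by (intro compact_Times compact_cball compact_sphere)
    moreover have "(z0, axis undefined 1) \<in> ?T" using R by (simp add: norm_axis_1)
    ultimately obtain p where p: "p \<in> ?T" "\<And>p'. p' \<in> ?T \<Longrightarrow> Re (hf (Gm (fst p)) (snd p) (snd p)) \<le> Re (hf (Gm (fst p')) (snd p') (snd p'))"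
      using continuous_attains_inf[of ?T "\<lambda>p. Re (hf (Gm (fst p)) (snd p) (snd p))"] by blast
    define m where "m = Re (hf (Gm (fst p)) (snd p) (snd p))"
    have "snd p \<noteq> 0" using p(1) by auto
    then have m: "m > 0" unfolding m_def using p(1) by (intro posG) auto
    show ?thesis
    proof (rule that[of m])
      fix z assume z: "z \<in> cball z0 R"
      have "m * (norm w)\<^sup>2 \<le> Re (hf (Gm z) w w)" for w
      proof (cases "w = 0")
        case False
        define w1 where "w1 = (1 / norm w) *\<^sub>R w"
        have w: "w = complex_of_real (norm w) *s w1" using False by (simp add: w1_def vec_eq_iff complex_eq_iff)
        have "norm w1 = 1" using False by (simp add: w1_def)
        then have "m \<le> Re (hf (Gm z) w1 w1)" using p(2)[of "(z, w1)"] z by (simp add: m_def)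
        then have "m * (norm w)\<^sup>2 \<le> Re (hf (Gm z) w1 w1) * (norm w)\<^sup>2" by (intro mult_right_mono) auto
        also have "\<dots> = Re (hf (Gm z) (complex_of_real (norm w) *s w1) (complex_of_real (norm w) *s w1))"
          by (simp add: hf_scale_left hf_scale_right power2_eq_square)
        finally show ?thesis using w by simp
      qed (simp add: hf_def)
      then show "coercive m (Gm z)" using m hermG[OF z] by (simp add: coercive_def)
    qed
  qed
  define u v where "u = loc c \<phi>1" and "v = loc c \<phi>2"
  have u_eq: "u z = \<phi>1 (\<psi> z)" and v_eq: "v z = \<phi>2 (\<psi> z)" for z
    by (simp_all add: u_def v_def loc_def \<psi>_def c_eq)
  have \<psi>c: "continuous_on (cball z0 R) \<psi>" using homeomorphism_cont2[OF U(3)] cbU continuous_on_subset by blast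
  have uc: "continuous_on (cball z0 R) u" unfolding u_eq[abs_def] by (rule continuous_on_compose2[OF c1 \<psi>c]) auto
  have vc: "continuous_on (cball z0 R) v" unfolding v_eq[abs_def] by (rule continuous_on_compose2[OF c2 \<psi>c]) auto
  have \<psi>z0: "\<psi> z0 = xm" using homeomorphism_apply1[OF U(3)] c by (simp add: z0_def c_eq)
  have mx: "(1 - t) * u z - v z \<le> (1 - t) * u z0 - v z0" for z unfolding u_eq v_eq \<psi>z0 by (rule xm)
  have coerc: "coercive m (g c (\<psi> z))" if "z \<in> cball z0 R" for z using m[OF that] by (simp add: Gm_def)
  have diag: "diagvec (\<chi>' c (\<psi> z) + cHess (quad a l B (snd c (\<psi> z))) (snd c (\<psi> z))) E
      = (\<chi> i. Re (hf (Xm z) (E $ i) (E $ i)) + levi B (E $ i))" if "linear l" "bilinear B" for z a l B and E :: "complex^'n^'n"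
    by (simp add: diagvec_def hf_mat_add cHess_quad[OF that] Xm_def vec_eq_iff)
  have herm: "hermitian (\<chi>' c (\<psi> z) + cHess (quad a l B p) p')" if "z \<in> cball z0 R" "linear l" "bilinear B" for z a l B p p'
  proof -
    have "hermitian (M + M')" if "hermitian M" "hermitian M'" for M M' :: "complex^'n^'n"
    proof -
      have "M $ k $ j + M' $ k $ j = cnj (M $ j $ k) + cnj (M' $ j $ k)" for j k
        by (intro arg_cong2[where f = "(+)"]) (use that in \<open>unfold hermitian_def, blast\<close>)+
      then show ?thesis unfolding hermitian_def vector_add_component complex_cnj_add by blast
    qed
    from this[OF hermX[OF that(1)] cHess_quad(2)[OF that(2,3)]] show ?thesis unfolding Xm_def .
  qed
  \<comment> \<open>All eigenvalue tuples lie in the convex level set, and by Schur--Horn so does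
    every diagonal.\<close>
  have sb: "(\<chi> i. Re (hf (Xm z) (E $ i) (E $ i)) + levi B (E $ i)) \<in> level \<Gamma> f e1"
    if z: "z \<in> ball z0 R" and tch: "touch_above u z l B" and E: "E \<in> frames (Gm z)" for z l B E
  proof -
    have zc: "z \<in> cball z0 R" using z by auto
    have lB: "linear l" "bilinear B" using tch by (auto simp: touch_above_def)
    define x where "x = \<psi> z"
    have x: "x \<in> fst c" "snd c x = z" "x \<in> N" using \<psi>[OF zc] by (auto simp: x_def c_eq)
    let ?M = "\<chi>' c x + cHess (quad (\<phi>1 x) l B (snd c x)) (snd c x)"
    have "lam \<in> level \<Gamma> f e1" if "eig_tuple (g c x) ?M lam" for lam
      using visc_sub_touch[OF A c(1) x(1) sub _ that] tch x(2,3)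
      by (auto simp: level_def[OF cone sf] u_def N_def)
    then have "convex hull {lam. eig_tuple (g c x) ?M lam} \<subseteq> level \<Gamma> f e1"
      by (intro hull_minimal level_convex[where f = f, OF cone sf]) auto
    moreover have "diagvec ?M E \<in> convex hull {lam. eig_tuple (g c x) ?M lam}"
      by (rule diagvec_in_eig_hull[OF coerc[OF zc, folded x_def] herm[OF zc lB, folded x_def]]) (use E in \<open>simp add: Gm_def x_def\<close>)
    ultimately show ?thesis using diag[OF lB, of z] by (auto simp: x_def)
  qed
  \<comment> \<open>For an eigenframe the diagonal is itself an eigenvalue tuple, so the
    supersolution condition applies to it directly.\<close>
  have sp: "\<exists>E\<in>frames (Gm z). (\<chi> i. Re (hf (Xm z) (E $ i) (E $ i)) + levi B (E $ i)) \<notin> level \<Gamma> f k"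
    if z: "z \<in> ball z0 R" and tch: "touch_below v z l B" for z l B
  proof -
    have zc: "z \<in> cball z0 R" using z by auto
    have lB: "linear l" "bilinear B" using tch by (auto simp: touch_below_def)
    define x where "x = \<psi> z"
    have x: "x \<in> fst c" "snd c x = z" "x \<in> N" using \<psi>[OF zc] by (auto simp: x_def c_eq)
    let ?M = "\<chi>' c x + cHess (quad (\<phi>2 x) l B (snd c x)) (snd c x)"
    obtain E where E: "E \<in> frames (g c x)" "eig_tuple (g c x) ?M (diagvec ?M E)"
      by (rule eigenframe_exists[OF coerc[OF zc, folded x_def] herm[OF zc lB, folded x_def]]) (rule that)
    have "diagvec ?M E \<notin> level \<Gamma> f k"
      using visc_super_touch[OF A c(1) x(1) super _ E(2)] tch x(2,3)
      by (auto simp: level_def[OF cone sf] v_def N_def)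
    then show ?thesis using E(1) diag[OF lB, of z] by (auto simp: x_def Gm_def)
  qed
  \<comment> \<open>The diagonals of \<chi> at z0 over all frames form a compact subset of the
    interior of \<Gamma>; its distance to the complement gives the uniform margin.\<close>
  obtain s0 where s0: "s0 > 0" "\<And>E. E \<in> frames (Gm z0) \<Longrightarrow> (\<chi> i. Re (hf (Xm z0) (E $ i) (E $ i)) - s0) \<in> \<Gamma>"
  proof -
    let ?D = "diagvec (Xm z0) ` frames (Gm z0)"
    have "continuous_on (frames (Gm z0)) (diagvec (Xm z0))"
      unfolding diagvec_def[abs_def] by (intro continuous_on_vec_lambda continuous_intros continuous_hf)
    then have "compact ?D" by (rule compact_continuous_image[OF _ compact_frames[OF m[OF z0R]]])
    moreover have "?D \<subseteq> interior \<Gamma>"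
    proof (rule image_subsetI)
      fix E assume E: "E \<in> frames (Gm z0)"
      have "{lam. eig_tuple (Gm z0) (Xm z0) lam} \<subseteq> interior \<Gamma>"
        using adm c unfolding Gm_def Xm_def \<psi>z0 by blast
      then have "convex hull {lam. eig_tuple (Gm z0) (Xm z0) lam} \<subseteq> interior \<Gamma>"
        by (intro hull_minimal convex_interior \<Gamma>_convex[OF cone sf])
      then show "diagvec (Xm z0) E \<in> interior \<Gamma>" using diagvec_in_eig_hull[OF m[OF z0R] hermX[OF z0R] E] by blast
    qed
    moreover have "?D \<noteq> {}" using frames_nonempty[OF m[OF z0R]] by simp
    ultimately obtain \<epsilon> where \<epsilon>: "\<epsilon> > 0" "{x. infdist x ?D \<le> \<epsilon>} \<subseteq> interior \<Gamma>"
      using compact_in_open_separated[of ?D "interior \<Gamma>"] open_interior by metis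
    define o1 :: "real^'n" where "o1 = (\<chi> i. 1)"
    define s0 where "s0 = \<epsilon> / (norm o1 + 1)"
    have s0: "s0 > 0" using \<epsilon> by (simp add: s0_def add_nonneg_pos)
    show ?thesis
    proof (rule that[OF s0])
      fix E assume E: "E \<in> frames (Gm z0)"
      have "s0 * norm o1 \<le> s0 * (norm o1 + 1)" using s0 by simp
      also have "\<dots> = \<epsilon>" unfolding s0_def using norm_ge_zero[of o1] by (intro nonzero_eq_divide_eq[THEN iffD1]) (linarith, simp)
      finally have "dist (diagvec (Xm z0) E - s0 *\<^sub>R o1) (diagvec (Xm z0) E) \<le> \<epsilon>" using s0 by (simp add: dist_norm)
      moreover have "infdist (diagvec (Xm z0) E - s0 *\<^sub>R o1) ?D \<le> dist (diagvec (Xm z0) E - s0 *\<^sub>R o1) (diagvec (Xm z0) E)"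
        by (rule infdist_le) (use E in blast)
      ultimately have "diagvec (Xm z0) E - s0 *\<^sub>R o1 \<in> interior \<Gamma>" using \<epsilon>(2) by auto
      then have "diagvec (Xm z0) E - s0 *\<^sub>R o1 \<in> \<Gamma>" using interior_subset by blast
      moreover have "diagvec (Xm z0) E - s0 *\<^sub>R o1 = (\<chi> i. Re (hf (Xm z0) (E $ i) (E $ i)) - s0)"
        by (simp add: diagvec_def o1_def vec_eq_iff)
      ultimately show "(\<chi> i. Re (hf (Xm z0) (E $ i) (E $ i)) - s0) \<in> \<Gamma>" by simp
    qed
  qed
  have K1: "(1 - t) *\<^sub>R x \<in> level \<Gamma> f k" if "x \<in> level \<Gamma> f e1" for x
    using level_scaleR[OF cone sf _ that, of "1 - t"] t k(3) by simp
  have "local_problem Gm Xm u v z0 R m Kg Lg Kx t s0 \<Gamma> (level \<Gamma> f k) (level \<Gamma> f e1)"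
  proof (rule local_problem.intro)
    show "R > 0" "0 < t" "t < 1" "Kg > 0" "Lg \<ge> 0" "Kx \<ge> 0" "s0 > 0" by (fact R t Kg Lg Kx s0)+
    show "closed (level \<Gamma> f k)" "convex (level \<Gamma> f k)" "level \<Gamma> f k \<noteq> {}"
      by (rule level_closed[OF cone sf] level_convex[OF cone sf] level_nonempty[OF cone sf])+
  qed ((rule m Gb Gl Xb Xcont uc vc mx sb sp s0(2) K1 level_add[OF cone sf] \<Gamma>_scaleR[OF cone sf] \<Gamma>_nonneg[OF cone sf]; assumption?)+)
  then show False by (rule local_problem.contradiction)
qed

theorem theorem1p5:
  fixes A :: "('m::t2_space, 'n::finite) chart set"
    and g \<chi>' :: "('m, 'n) chart \<Rightarrow> 'm \<Rightarrow> complex^'n^'n"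
    and \<Gamma> :: "(real^'n) set"
    and f :: "real^'n \<Rightarrow> real"
    and G :: "'m \<Rightarrow> real \<Rightarrow> real"
    and \<phi>1 \<phi>2 :: "'m \<Rightarrow> real"
  assumes "compact (UNIV :: 'm set)"
    and "complex_atlas A"
    and "hermitian_metric A g"
    and "real_11_form A \<chi>'"
    and "admissible_cone \<Gamma>"
    and "standing_f \<Gamma> f"
    and "\<forall>c\<in>A. \<forall>x\<in>fst c. \<forall>lam. eig_tuple (g c x) (\<chi>' c x) lam \<longrightarrow> lam \<in> interior \<Gamma>"
    and "continuous_on UNIV (\<lambda>p. G (fst p) (snd p))"
    and "\<forall>x u1 u2. u1 < u2 \<longrightarrow> G x u1 < G x u2"
    and "visc_sol A g \<chi>' \<Gamma> f (\<lambda>x u. exp (G x u)) \<phi>1"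
    and "visc_sol A g \<chi>' \<Gamma> f (\<lambda>x u. exp (G x u)) \<phi>2"
  shows "\<phi>1 = \<phi>2"
proof -
  have mono: "G x u1 < G x u2" if "u1 < u2" for x u1 u2 using assms(9) that by blast
  have le: "\<phi> y \<le> \<phi>' y" if "visc_sol A g \<chi>' \<Gamma> f (\<lambda>x u. exp (G x u)) \<phi>" "visc_sol A g \<chi>' \<Gamma> f (\<lambda>x u. exp (G x u)) \<phi>'" for \<phi> \<phi>' y
    by (rule comparison_principle[OF assms(1-8) mono]) (use that in \<open>simp_all add: visc_sol_def\<close>)
  show ?thesis using le[OF assms(10,11)] le[OF assms(11,10)] by (intro ext antisym)
qed

end
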